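(* In the model-based bilevel reinforcement learning problem $\min_{x\in\mathbb{R}^n}\phi(x):=f(x,\pi^*(x))$, suppose $f$ satisfies: (i) $f:\mathbb{R}^n\times\mathbb{R}^{|\mathcal{S}||\mathcal{A}|}\to\mathbb{R}$ is continuously differentiable; for all $x_1,x_2\in\mathbb{R}^n$ and policies $\pi_1,\pi_2$, $\|\nabla f(x_1,\pi_1)-\nabla f(x_2,\pi_2)\|_2\le L_f(\|x_1-x_2\|_2+\|\pi_1-\pi_2\|_\infty)$; and $\|\nabla_\pi f(x,\pi^*(x))\|_2\le C_{f\pi}$ for all $x$; and the reward satisfies: (ii) for all $x,x_1,x_2\in\mathbb{R}^n$ and $(s,a)\in\mathcal{S}\times\mathcal{A}$: $|r_{sa}(x)|\le C_r$, $\|\nabla r_{sa}(x)\|_2\le C_{rx}$, $\|\nabla r_{sa}(x_1)-\nabla r_{sa}(x_2)\|_2\le L_r\|x_1-x_2\|_2$. Then in the M-SoBiRL algorithm one can choose constant step sizes $\beta,\eta>0$ and an inner iteration number $N=\mathcal{O}(1)$ ($\beta,\eta,N$ constants independent of the number $K$ of outer iterations and of the solution accuracy) such that the iterates $\{x_k\}$ satisfy $$\frac1K\sum_{k=1}^K\|\nabla\phi(x_k)\|_2^2=\mathcal{O}(K^{-1}).$$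
   Context: Setting. $\mathcal{S},\mathcal{A}$ are finite nonempty sets (states, actions), $P_{sas'}=P(s'|s,a)$ is a transition kernel, $\gamma\in(0,1)$, $\tau>0$, and $r:\mathbb{R}^n\to\mathbb{R}^{|\mathcal{S}||\mathcal{A}|}$ is a differentiable parameterized reward. A policy is $\pi=(\pi_s)_{s\in\mathcal{S}}$ with each $\pi_s=\pi(\cdot|s)$ a probability distribution on $\mathcal{A}$, viewed as a vector in $\mathbb{R}^{|\mathcal{S}||\mathcal{A}|}$; $P^\pi_{ss'}=\sum_a\pi_{sa}P_{sas'}$. With $h(\pi_s)=-\sum_a\pi_{sa}\log\pi_{sa}$ ($0\log0=0$), the soft value function is $V^\pi_s(x)=\mathbb{E}[\sum_{t\ge0}\gamma^t(r_{s_ta_t}(x)+\tau h(\pi_{s_t}))\mid s_0=s,\pi]$ (with $a_t\sim\pi(\cdot|s_t)$, $s_{t+1}\sim P(\cdot|s_t,a_t)$). For $\rho$ a distribution on $\mathcal{S}$ with positive entries, $\pi^*(x)$ is the unique minimizer over policies $\pi$ of $-\sum_s\rho_sV^\pi_s(x)$. Definitions. $\varphi_s(x,v)=\tau\log\sum_a\exp(\tau^{-1}(r_{sa}(x)+\gamma\sum_{s'}P_{sas'}v_{s'}))$ for $x\in\mathbb{R}^n$, $v\in\mathbb{R}^{|\mathcal{S}|}$, with partial Jacobian $\nabla_x\varphi(x,v)\in\mathbb{R}^{|\mathcal{S}|\times n}$. $U\in\mathbb{R}^{|\mathcal{S}||\mathcal{A}|\times|\mathcal{S}|}$: $U_{sas'}=1-\gamma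 P_{sas'}$ if $s'=s$, $U_{sas'}=-\gamma P_{sas'}$ otherwise. $\mathrm{softmax}(\theta)_{sa}=\exp(\theta_{sa})/\sum_{a'}\exp(\theta_{sa'})$. Soft Bellman optimality operator: $\mathcal{T}_x(Q)(s,a)=r_{sa}(x)+\gamma\sum_{s'}P_{sas'}\,\tau\log\sum_{a'}\exp(Q(s',a')/\tau)$. $\nabla r(x)\in\mathbb{R}^{|\mathcal{S}||\mathcal{A}|\times n}$ is the Jacobian of $r$. Algorithm M-SoBiRL (outer and inner iteration numbers $K,N$; step sizes $\beta,\eta$; separate initial inputs $x_1\in\mathbb{R}^n$, a policy $\pi_1$, $Q_1\in\mathbb{R}^{|\mathcal{S}||\mathcal{A}|}$, $w_0\in\mathbb{R}^{|\mathcal{S}|}$). For $k=1,\dots,K$: 1. $A_k=(I-\gamma P^{\pi_k})^\top$, $b_k=U^\top\mathrm{diag}(\pi_k)\nabla_\pi f(x_k,\pi_k)$; 2. $V_k(s)=\tau\log\sum_a\exp(Q_k(s,a)/\tau)$ for all $s\in\mathcal{S}$; 3. $w_k=w_{k-1}-\eta(A_k^\top A_kw_{k-1}-A_k^\top b_k)$; 4. $x_{k+1}=x_k-\beta\widehat\nabla\phi(x_k,\pi_k,V_k,w_k)$, where $\widehat\nabla\phi(x,\pi,V,w)=\nabla_xf(x,\pi)+\frac1\tau\nabla r(x)^\top\mathrm{diag}(\pi)\nabla_\pi f(x,\pi)-\frac1\tau\nabla_x\varphi(x,V)^\top w$; 5. $Q_{k+1}=\mathcal{T}_{x_{k+1}}^N(Q_k)$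 ($N$-fold iteration), $\pi_{k+1}=\mathrm{softmax}(Q_{k+1}/\tau)$.
   Formalization: The formal theorem additionally assumes that φ is bounded below on R^n; without this the claim fails, e.g. for f(x,π)=x_1, where ‖∇φ‖=1 everywhere and the average is 1 for every K. *)

theory Defs
  imports "HOL-Probability.Probability" "HOL-Library.Landau_Symbols"
begin

section \<open>Gradients and matrices\<close>

text \<open>
  \<^const>\<open>gderiv\<close> is the library's relational gradient; the value below is meaningful only at points
  where the function is differentiable.
\<close>

definition gradient :: "('v::real_inner \<Rightarrow> real) \<Rightarrow> 'v \<Rightarrow> 'v"
  where "gradient g x = (THE D. GDERIV g x :> D)"

definition gradient_fst :: "('v::real_inner \<times> 'w::real_inner \<Rightarrow> real) \<Rightarrow> 'v \<times> 'w \<Rightarrow> 'v"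
  where "gradient_fst g = (\<lambda>(x, p). gradient (\<lambda>y. g (y, p)) x)"

definition gradient_snd :: "('v::real_inner \<times> 'w::real_inner \<Rightarrow> real) \<Rightarrow> 'v \<times> 'w \<Rightarrow> 'w"
  where "gradient_snd g = (\<lambda>(x, p). gradient (\<lambda>q. g (x, q)) p)"

definition diag :: "real ^ 'k \<Rightarrow> real ^ 'k ^ 'k"
  where "diag v = (\<chi> i j. if i = j then v $ i else 0)"


section \<open>Policies and the soft value function\<close>

text \<open>
  States and actions are finite types \<open>'s\<close> and \<open>'a\<close>.  The transition kernel is
  \<open>P :: 's \<Rightarrow> 'a \<Rightarrow> 's pmf\<close>, with entries \<open>pmf (P s a) s'\<close>.  Policies, rewards and Q-functions are
  vectors indexed by state-action pairs.
\<close>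

definition is_policy :: "real ^ ('s::finite \<times> 'a::finite) \<Rightarrow> bool"
  where "is_policy \<pi> \<longleftrightarrow> (\<forall>s a. 0 \<le> \<pi> $ (s, a)) \<and> (\<forall>s. (\<Sum>a\<in>UNIV. \<pi> $ (s, a)) = 1)"

text \<open>The distribution \<open>\<pi>(\<cdot>|s)\<close>; meaningful when \<^prop>\<open>is_policy \<pi>\<close>.\<close>

definition policy_pmf :: "real ^ ('s::finite \<times> 'a::finite) \<Rightarrow> 's \<Rightarrow> 'a pmf"
  where "policy_pmf \<pi> s = embed_pmf (\<lambda>a. \<pi> $ (s, a))"

text \<open>The usual convention \<open>0 log 0 = 0\<close> holds automatically.\<close>

definition policy_entropy :: "real ^ ('s::finite \<times> 'a::finite) \<Rightarrow> 's \<Rightarrow> real"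
  where "policy_entropy \<pi> s = - (\<Sum>a\<in>UNIV. \<pi> $ (s, a) * ln (\<pi> $ (s, a)))"

text \<open>
  Conditional law of \<open>(s\<^sub>t, a\<^sub>t)\<close> given the trajectory \<open>\<omega>\<close> of state-action pairs before time \<open>t\<close>, for
  the process started in state \<open>s\<^sub>0\<close>.
\<close>

primrec traj_kernel ::
  "('s::finite \<Rightarrow> 'a::finite \<Rightarrow> 's pmf) \<Rightarrow> real ^ ('s \<times> 'a) \<Rightarrow> 's \<Rightarrow>
     nat \<Rightarrow> (nat \<Rightarrow> 's \<times> 'a) \<Rightarrow> ('s \<times> 'a) pmf"
  where
    "traj_kernel P \<pi> s\<^sub>0 0 \<omega> = map_pmf (Pair s\<^sub>0) (policy_pmf \<pi> s\<^sub>0)"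
  | "traj_kernel P \<pi> s\<^sub>0 (Suc t) \<omega> =
       bind_pmf (P (fst (\<omega> t)) (snd (\<omega> t))) (\<lambda>s'. map_pmf (Pair s') (policy_pmf \<pi> s'))"

lemma Ionescu_Tulcea_traj_kernel:
  "Ionescu_Tulcea (\<lambda>t \<omega>. measure_pmf (traj_kernel P \<pi> s\<^sub>0 t \<omega>)) (\<lambda>_. count_space UNIV)"
proof
  fix t :: nat
  show "(\<lambda>\<omega>. measure_pmf (traj_kernel P \<pi> s\<^sub>0 t \<omega>))
          \<in> measurable (PiM {0..<t} (\<lambda>_. count_space UNIV)) (subprob_algebra (count_space UNIV))"
  proof (cases t)
    case 0
    then show ?thesis by (simp add: measure_pmf_in_subprob_algebra)
  next
    case (Suc u)
    let ?g = "\<lambda>z. measure_pmf (bind_pmf (P (fst z) (snd z)) (\<lambda>s'. map_pmf (Pair s') (policy_pmf \<pi> s')))"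
    have "(\<lambda>\<omega>. \<omega> u) \<in> measurable (PiM {0..<t} (\<lambda>_. count_space UNIV)) (count_space UNIV)"
      using Suc by (intro measurable_component_singleton) auto
    moreover have "?g \<in> measurable (count_space UNIV) (subprob_algebra (count_space UNIV))"
      by (simp add: measure_pmf_in_subprob_algebra)
    ultimately show ?thesis
      using measurable_compose Suc by fastforce
  qed
qed

text \<open>
  The law of the infinite trajectory \<open>(s\<^sub>t, a\<^sub>t)\<^sub>t\<close>: the Ionescu-Tulcea limit of the kernels above.
\<close>

definition traj_measure ::
  "('s::finite \<Rightarrow> 'a::finite \<Rightarrow> 's pmf) \<Rightarrow> real ^ ('s \<times> 'a) \<Rightarrow> 's \<Rightarrow> (nat \<Rightarrow> 's \<times> 'a) measure"
  where "traj_measure P \<pi> s\<^sub>0 =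
    projective_family.lim UNIV
      (Ionescu_Tulcea.CI (\<lambda>t \<omega>. measure_pmf (traj_kernel P \<pi> s\<^sub>0 t \<omega>)) (\<lambda>_. count_space UNIV))
      (\<lambda>_. count_space UNIV)"

definition soft_value ::
  "('s::finite \<Rightarrow> 'a::finite \<Rightarrow> 's pmf) \<Rightarrow> real \<Rightarrow> real \<Rightarrow> (real ^ 'n \<Rightarrow> real ^ ('s \<times> 'a)) \<Rightarrow>
     real ^ ('s \<times> 'a) \<Rightarrow> real ^ 'n \<Rightarrow> 's \<Rightarrow> real"
  where "soft_value P \<gamma> \<tau> r \<pi> x s =
    (LINT \<omega>|traj_measure P \<pi> s.
       (\<Sum>t. \<gamma> ^ t * (r x $ \<omega> t + \<tau> * policy_entropy \<pi> (fst (\<omega> t)))))"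

definition opt_policy ::
  "('s::finite \<Rightarrow> 'a::finite \<Rightarrow> 's pmf) \<Rightarrow> real \<Rightarrow> real \<Rightarrow> 's pmf \<Rightarrow>
     (real ^ 'n \<Rightarrow> real ^ ('s \<times> 'a)) \<Rightarrow> real ^ 'n \<Rightarrow> real ^ ('s \<times> 'a)"
  where "opt_policy P \<gamma> \<tau> \<rho> r x =
    (THE \<pi>. is_arg_min (\<lambda>\<pi>. - (\<Sum>s\<in>UNIV. pmf \<rho> s * soft_value P \<gamma> \<tau> r \<pi> x s)) is_policy \<pi>)"

definition hyper_objective ::
  "('s::finite \<Rightarrow> 'a::finite \<Rightarrow> 's pmf) \<Rightarrow> real \<Rightarrow> real \<Rightarrow> 's pmf \<Rightarrow>
     (real ^ 'n \<Rightarrow> real ^ ('s \<times> 'a)) \<Rightarrow> ((real ^ 'n) \<times> (real ^ ('s \<times> 'a)) \<Rightarrow> real) \<Rightarrow>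
     real ^ 'n \<Rightarrow> real"
  where "hyper_objective P \<gamma> \<tau> \<rho> r f x = f (x, opt_policy P \<gamma> \<tau> \<rho> r x)"


section \<open>Ingredients of the algorithm\<close>

definition policy_trans ::
  "('s::finite \<Rightarrow> 'a::finite \<Rightarrow> 's pmf) \<Rightarrow> real ^ ('s \<times> 'a) \<Rightarrow> real ^ 's ^ 's"
  where "policy_trans P \<pi> = (\<chi> s s'. \<Sum>a\<in>UNIV. \<pi> $ (s, a) * pmf (P s a) s')"

definition U_mat ::
  "('s::finite \<Rightarrow> 'a::finite \<Rightarrow> 's pmf) \<Rightarrow> real \<Rightarrow> real ^ 's ^ ('s \<times> 'a)"
  where "U_mat P \<gamma> =
    (\<chi> sa s'. if s' = fst sa then 1 - \<gamma> * pmf (P (fst sa) (snd sa)) s'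
              else - \<gamma> * pmf (P (fst sa) (snd sa)) s')"

definition soft_backup ::
  "('s::finite \<Rightarrow> 'a::finite \<Rightarrow> 's pmf) \<Rightarrow> real \<Rightarrow> real \<Rightarrow> (real ^ 'n \<Rightarrow> real ^ ('s \<times> 'a)) \<Rightarrow>
     real ^ 'n \<Rightarrow> real ^ 's \<Rightarrow> real ^ 's"
  where "soft_backup P \<gamma> \<tau> r x v =
    (\<chi> s. \<tau> * ln (\<Sum>a\<in>UNIV. exp (inverse \<tau> * (r x $ (s, a) + \<gamma> * (\<Sum>s'\<in>UNIV. pmf (P s a) s' * v $ s')))))"

definition softmax :: "real ^ ('s::finite \<times> 'a::finite) \<Rightarrow> real ^ ('s \<times> 'a)"
  where "softmax \<theta> = (\<chi> sa. exp (\<theta> $ sa) / (\<Sum>a'\<in>UNIV. exp (\<theta> $ (fst sa, a'))))"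

definition soft_max_value :: "real \<Rightarrow> real ^ ('s::finite \<times> 'a::finite) \<Rightarrow> real ^ 's"
  where "soft_max_value \<tau> Q = (\<chi> s. \<tau> * ln (\<Sum>a\<in>UNIV. exp (Q $ (s, a) / \<tau>)))"

definition soft_bellman ::
  "('s::finite \<Rightarrow> 'a::finite \<Rightarrow> 's pmf) \<Rightarrow> real \<Rightarrow> real \<Rightarrow> (real ^ 'n \<Rightarrow> real ^ ('s \<times> 'a)) \<Rightarrow>
     real ^ 'n \<Rightarrow> real ^ ('s \<times> 'a) \<Rightarrow> real ^ ('s \<times> 'a)"
  where "soft_bellman P \<gamma> \<tau> r x Q =
    (\<chi> sa. r x $ sa
       + \<gamma> * (\<Sum>s'\<in>UNIV. pmf (P (fst sa) (snd sa)) s' * (\<tau> * ln (\<Sum>a'\<in>UNIV. exp (Q $ (s', a') / \<tau>)))))"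

definition hyper_gradient_est ::
  "('s::finite \<Rightarrow> 'a::finite \<Rightarrow> 's pmf) \<Rightarrow> real \<Rightarrow> real \<Rightarrow> (real ^ 'n \<Rightarrow> real ^ ('s \<times> 'a)) \<Rightarrow>
     ((real ^ 'n) \<times> (real ^ ('s \<times> 'a)) \<Rightarrow> real) \<Rightarrow>
     real ^ 'n \<Rightarrow> real ^ ('s \<times> 'a) \<Rightarrow> real ^ 's \<Rightarrow> real ^ 's \<Rightarrow> real ^ 'n"
  where "hyper_gradient_est P \<gamma> \<tau> r f x \<pi> V w =
    gradient_fst f (x, \<pi>)
    + (1 / \<tau>) *\<^sub>R (transpose (jacobian r (at x)) *v (diag \<pi> *v gradient_snd f (x, \<pi>)))
    - (1 / \<tau>) *\<^sub>R (transpose (jacobian (\<lambda>y. soft_backup P \<gamma> \<tau> r y V) (at x)) *v w)"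

text \<open>
  The outer loop of M-SoBiRL, started from \<open>x 1\<close>, \<open>\<pi> 1\<close>, \<open>Q 1\<close> and \<open>w 0\<close>.  The iterates do not depend
  on the number of outer iterations, so a run of \<open>K\<close> iterations is the prefix \<open>k = 1, \<dots>, K\<close> of the
  infinite recursion.  The values \<open>x 0\<close>, \<open>\<pi> 0\<close> and \<open>Q 0\<close> are irrelevant.
\<close>

definition msobirl_run ::
  "('s::finite \<Rightarrow> 'a::finite \<Rightarrow> 's pmf) \<Rightarrow> real \<Rightarrow> real \<Rightarrow> (real ^ 'n \<Rightarrow> real ^ ('s \<times> 'a)) \<Rightarrow>
     ((real ^ 'n) \<times> (real ^ ('s \<times> 'a)) \<Rightarrow> real) \<Rightarrow> real \<Rightarrow> real \<Rightarrow> nat \<Rightarrow>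
     (nat \<Rightarrow> real ^ 'n) \<Rightarrow> (nat \<Rightarrow> real ^ ('s \<times> 'a)) \<Rightarrow> (nat \<Rightarrow> real ^ ('s \<times> 'a)) \<Rightarrow>
     (nat \<Rightarrow> real ^ 's) \<Rightarrow> bool"
  where "msobirl_run P \<gamma> \<tau> r f \<beta> \<eta> N x \<pi> Q w \<longleftrightarrow>
    is_policy (\<pi> 1) \<and>
    (\<forall>k\<ge>1.
      let A = transpose (mat 1 - \<gamma> *\<^sub>R policy_trans P (\<pi> k));
          b = transpose (U_mat P \<gamma>) *v (diag (\<pi> k) *v gradient_snd f (x k, \<pi> k));
          V = soft_max_value \<tau> (Q k)
      in w k = w (k - 1) - \<eta> *\<^sub>R (transpose A *v (A *v w (k - 1)) - transpose A *v b) \<and>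
         x (k + 1) = x k - \<beta> *\<^sub>R hyper_gradient_est P \<gamma> \<tau> r f (x k) (\<pi> k) V (w k) \<and>
         Q (k + 1) = (soft_bellman P \<gamma> \<tau> r (x (k + 1)) ^^ N) (Q k) \<and>
         \<pi> (k + 1) = softmax ((1 / \<tau>) *\<^sub>R Q (k + 1)))"

end

theory Submission
  imports Defs
begin

text \<open>
  The optimal regularised policy is the softmax of the fixed point \<open>Q*(x)\<close> of the soft Bellman operator,
  and this fixed point depends smoothly and Lipschitz continuously on the reward.  Differentiating the
  fixed point equation and eliminating the derivative of the value function by an adjoint linear system
  shows that the hyper-gradient is the estimator of the algorithm evaluated at the exact
  \<open>\<pi>*\<close>, \<open>V*\<close> and adjoint solution \<open>w*\<close>, and that it is Lipschitz.

  The errors \<open>q\<^sub>k = \<parallel>Q\<^sub>k - Q*(x\<^sub>k)\<parallel>\<close> and \<open>e\<^sub>k = \<parallel>w\<^sub>k - w*(x\<^sub>k, \<pi>\<^sub>k)\<parallel>\<close> contract at each outer iteration up to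
  a drift of order \<open>\<parallel>x\<^sub>k\<^sub>+\<^sub>1 - x\<^sub>k\<parallel>\<close>, already for \<open>N = 1\<close>.  Hence a suitable combination \<open>\<Delta>\<^sub>k = e\<^sub>k + M q\<^sub>k\<close> is
  contracted too, and \<open>\<phi>(x\<^sub>k) + c \<beta> \<Delta>\<^sub>k\<^sup>2\<close> is a Lyapunov function for small \<open>\<beta>\<close>: it decreases by at
  least \<open>\<beta>/2 \<parallel>\<nabla>\<phi>(x\<^sub>k)\<parallel>\<^sup>2\<close> per step.
\<close>

section \<open>Marginal laws of the trajectory\<close>

text \<open>Three obstacles shape the proof. The optimal policy is a definite description over an
  integral on trajectory space: the loss of a policy is a discounted sum of expected relative
  entropies to a softmax, so only the laws of the pairs at single times enter, and zero loss
  identifies the minimiser. The gradient of \<open>f\<close> is controlled only on policies, and its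
  policy part is bounded only at optimal ones; the Lipschitz condition and the bounded diameter of
  the policy set spread this bound to all policies. The vectors \<open>w k\<close> have no a priori
  bound, so the estimator is compared in two moves: in \<open>w\<close> at a fixed point, then along
  the exact adjoint solution. Bellman updates contract in the sup norm and adjoint steps in the
  Euclidean norm, whence the cardinalities in the constants. The choice of constants is not
  circular: \<eta> comes from a conditioning of the adjoint matrices that is uniform in the policy,
  the recursions measure drift by the step in \<open>x\<close> and so do not see \<beta>, and
  \<beta> is chosen last.\<close>

primrec state_action_law ::
  "('s::finite \<Rightarrow> 'a::finite \<Rightarrow> 's pmf) \<Rightarrow> real ^ ('s \<times> 'a) \<Rightarrow> 's \<Rightarrow> nat \<Rightarrow> ('s \<times> 'a) pmf"
  where
    "state_action_law P \<pi> s\<^sub>0 0 = map_pmf (Pair s\<^sub>0) (policy_pmf \<pi> s\<^sub>0)"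
  | "state_action_law P \<pi> s\<^sub>0 (Suc t) =
       bind_pmf (state_action_law P \<pi> s\<^sub>0 t)
         (\<lambda>z. bind_pmf (P (fst z) (snd z)) (\<lambda>s'. map_pmf (Pair s') (policy_pmf \<pi> s')))"

lemma sets_traj_measure:
  fixes P :: "'s::finite \<Rightarrow> 'a::finite \<Rightarrow> 's pmf"
  shows "sets (traj_measure P \<pi> s) = sets (PiM UNIV (\<lambda>_. count_space UNIV))"
proof -
  interpret IT: Ionescu_Tulcea "\<lambda>t \<omega>. measure_pmf (traj_kernel P \<pi> s t \<omega>)" "\<lambda>_. count_space UNIV"
    by (rule Ionescu_Tulcea_traj_kernel)
  show ?thesis
    by (simp add: traj_measure_def IT.PF.sets_lim)
qed

lemma prob_space_traj_measure:
  fixes P :: "'s::finite \<Rightarrow> 'a::finite \<Rightarrow> 's pmf"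
  shows "prob_space (traj_measure P \<pi> s)"
proof -
  interpret IT: Ionescu_Tulcea "\<lambda>t \<omega>. measure_pmf (traj_kernel P \<pi> s t \<omega>)" "\<lambda>_. count_space UNIV"
    by (rule Ionescu_Tulcea_traj_kernel)
  \<comment> \<open>Push-forward preserves total mass, so it suffices that the marginal on no
    coordinates is a probability measure.\<close>
  have "prob_space (IT.CI {})"
    by (rule IT.PF.prob_space_P) auto
  then have "prob_space (distr IT.PF.lim (PiM {} (\<lambda>_. count_space UNIV)) (\<lambda>x. restrict x {}))"
    by (subst IT.distr_lim) auto
  then show ?thesis
    unfolding traj_measure_def
    by (rule prob_space_distrD[rotated]) (auto intro!: measurable_restrict)
qed

text \<open>The kernel at time \<open>Suc n\<close> reads only coordinate \<open>n\<close> of the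
  history, so the recursion closes on single-time marginals and the joint law is never
  computed.\<close>

lemma distr_traj_measure:
  fixes P :: "'s::finite \<Rightarrow> 'a::finite \<Rightarrow> 's pmf"
  shows "distr (traj_measure P \<pi> s) (count_space UNIV) (\<lambda>\<omega>. \<omega> t)
    = measure_pmf (state_action_law P \<pi> s t)"
proof -
  interpret IT: Ionescu_Tulcea "\<lambda>t \<omega>. measure_pmf (traj_kernel P \<pi> s t \<omega>)" "\<lambda>_. count_space UNIV"
    by (rule Ionescu_Tulcea_traj_kernel)
  let ?M = "\<lambda>_::nat. count_space (UNIV :: ('s \<times> 'a) set)"
  \<comment> \<open>The empty history: the only element of the product over no coordinates.\<close>
  let ?u = "\<lambda>_::nat. undefined :: 's \<times> 'a"
  have u: "?u \<in> space (PiM {0..<0} ?M)"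
    by (simp add: space_PiM)
  have C_Suc: "distr (IT.C 0 (Suc n) ?u) (count_space UNIV) (\<lambda>\<omega>. \<omega> n)
      = IT.C 0 n ?u \<bind> (\<lambda>\<omega>. measure_pmf (traj_kernel P \<pi> s n \<omega>))" for n
  proof -
    have "distr (IT.C 0 n ?u \<bind> IT.eP n) (count_space UNIV) (\<lambda>\<omega>. \<omega> n)
      = IT.C 0 n ?u \<bind> (\<lambda>\<omega>. distr (IT.eP n \<omega>) (count_space UNIV) (\<lambda>\<omega>. \<omega> n))"
    proof (rule distr_bind)
      show "IT.eP n \<in> IT.C 0 n ?u \<rightarrow>\<^sub>M subprob_algebra (PiM {0..<Suc n} ?M)"
        using IT.measurable_eP[of n] by (subst measurable_cong_sets[OF IT.sets_C[OF u] refl]) simp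
      show "space (IT.C 0 n ?u) \<noteq> {}"
        using IT.prob_space_C[OF u] by (rule prob_space.not_empty)
    qed (auto intro!: measurable_component_singleton)
    also have "\<dots> = IT.C 0 n ?u \<bind> (\<lambda>\<omega>. measure_pmf (traj_kernel P \<pi> s n \<omega>))"
    proof (rule bind_cong[OF refl])
      fix \<omega> assume "\<omega> \<in> space (IT.C 0 n ?u)"
      then have w: "\<omega> \<in> space (PiM {0..<n} ?M)"
        using IT.space_C[OF u] by simp
      have "distr (IT.eP n \<omega>) (count_space UNIV) (\<lambda>\<omega>. \<omega> n)
        = distr (measure_pmf (traj_kernel P \<pi> s n \<omega>)) (count_space UNIV) ((\<lambda>\<omega>. \<omega> n) \<circ> fun_upd \<omega> n)"
        unfolding IT.eP_def
      proof (rule distr_distr)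
        show "(\<lambda>\<omega>. \<omega> n) \<in> PiM {0..<Suc n} ?M \<rightarrow>\<^sub>M count_space UNIV"
          by (intro measurable_component_singleton) auto
        show "fun_upd \<omega> n \<in> measure_pmf (traj_kernel P \<pi> s n \<omega>) \<rightarrow>\<^sub>M PiM {0..<Suc n} ?M"
          using w by (auto simp: space_PiM PiE_iff extensional_def)
      qed
      also have "\<dots> = measure_pmf (traj_kernel P \<pi> s n \<omega>)"
        by (simp add: comp_def) (rule distr_id2, simp)
      finally show "distr (IT.eP n \<omega>) (count_space UNIV) (\<lambda>\<omega>. \<omega> n) = \<dots>" .
    qed
    finally show ?thesis by simp
  qed
  have eq1: "distr (traj_measure P \<pi> s) (count_space UNIV) (\<lambda>\<omega>. \<omega> n)
      = distr (IT.C 0 (Suc n) ?u) (count_space UNIV) (\<lambda>\<omega>. \<omega> n)" for n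
  proof -
    have m: "(\<lambda>\<omega>. \<omega> i) \<in> IT.PF.lim \<rightarrow>\<^sub>M count_space UNIV" for i
      by (subst measurable_cong_sets[OF IT.PF.sets_lim refl]) (rule measurable_component_singleton, simp)
    \<comment> \<open>\<open>IT.CI J\<close> runs the chain for \<open>IT.up_to J\<close> steps and
      then restricts to \<open>J\<close>; for the first \<open>Suc n\<close> coordinates nothing
      beyond them is run.\<close>
    have up: "IT.up_to {0..<Suc n} = Suc n"
      by (rule antisym) (auto simp: IT.up_to_iff intro!: IT.up_to_less[of "{0..<Suc n}" n, THEN Suc_leI])
    have "distr (traj_measure P \<pi> s) (count_space UNIV) (\<lambda>\<omega>. \<omega> n)
      = distr (distr IT.PF.lim (PiM {0..<Suc n} ?M) (\<lambda>x. restrict x {0..<Suc n})) (count_space UNIV) (\<lambda>\<omega>. \<omega> n)"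
      unfolding traj_measure_def
      by (subst distr_distr) (auto intro!: measurable_restrict m measurable_component_singleton simp: comp_def)
    also have "\<dots> = distr (IT.CI {0..<Suc n}) (count_space UNIV) (\<lambda>\<omega>. \<omega> n)"
      by (subst IT.distr_lim) auto
    also have "\<dots> = distr (IT.C 0 (Suc n) ?u) (count_space UNIV) (\<lambda>\<omega>. \<omega> n)"
      unfolding IT.CI_def up
      using measurable_cong_sets[OF IT.sets_C[OF u, of "Suc n"] refl]
      by (subst distr_distr) (auto intro!: measurable_restrict measurable_component_singleton simp: comp_def simp del: IT.C.simps)
    finally show ?thesis .
  qed
  show ?thesis
  proof (induction t)
    case 0
    show ?case
      unfolding eq1 C_Suc by (simp add: bind_return[where N="count_space UNIV"] u space_PiM measure_pmf_in_subprob_algebra)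
  next
    case (Suc n)
    let ?g = "\<lambda>z. bind_pmf (P (fst z) (snd z)) (\<lambda>s'. map_pmf (Pair s') (policy_pmf \<pi> s'))"
    have "distr (traj_measure P \<pi> s) (count_space UNIV) (\<lambda>\<omega>. \<omega> (Suc n))
      = IT.C 0 (Suc n) ?u \<bind> (\<lambda>\<omega>. measure_pmf (?g (\<omega> n)))"
      unfolding eq1 C_Suc by simp
    also have "\<dots> = distr (IT.C 0 (Suc n) ?u) (count_space UNIV) (\<lambda>\<omega>. \<omega> n) \<bind> (\<lambda>z. measure_pmf (?g z))"
    proof (rule bind_distr[where K="count_space UNIV", symmetric])
      show "(\<lambda>\<omega>. \<omega> n) \<in> IT.C 0 (Suc n) ?u \<rightarrow>\<^sub>M count_space UNIV"
        using measurable_cong_sets[OF IT.sets_C[OF u, of "Suc n"] refl]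
        by (auto intro!: measurable_component_singleton simp del: IT.C.simps)
      show "space (IT.C 0 (Suc n) ?u) \<noteq> {}"
        using IT.prob_space_C[OF u] by (rule prob_space.not_empty)
    qed (simp add: measure_pmf_in_subprob_algebra)
    also have "\<dots> = measure_pmf (state_action_law P \<pi> s n) \<bind> (\<lambda>z. measure_pmf (?g z))"
      using Suc.IH unfolding eq1 by simp
    also have "\<dots> = measure_pmf (state_action_law P \<pi> s (Suc n))"
      by (simp add: measure_pmf_bind)
    finally show ?case .
  qed
qed

lemma integral_traj_measure:
  fixes P :: "'s::finite \<Rightarrow> 'a::finite \<Rightarrow> 's pmf" and g :: "'s \<times> 'a \<Rightarrow> real"
  shows "(LINT \<omega>|traj_measure P \<pi> s. g (\<omega> t)) = measure_pmf.expectation (state_action_law P \<pi> s t) g"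
    and "integrable (traj_measure P \<pi> s) (\<lambda>\<omega>. g (\<omega> t))"
proof -
  have m: "(\<lambda>\<omega>. \<omega> t) \<in> traj_measure P \<pi> s \<rightarrow>\<^sub>M count_space UNIV"
    by (subst measurable_cong_sets[OF sets_traj_measure refl]) (rule measurable_component_singleton, simp)
  show "(LINT \<omega>|traj_measure P \<pi> s. g (\<omega> t)) = measure_pmf.expectation (state_action_law P \<pi> s t) g"
    unfolding distr_traj_measure[symmetric] by (rule integral_distr[symmetric, OF m]) simp
  show "integrable (traj_measure P \<pi> s) (\<lambda>\<omega>. g (\<omega> t))"
  proof (rule integrable_distr[OF m])
    show "integrable (distr (traj_measure P \<pi> s) (count_space UNIV) (\<lambda>\<omega>. \<omega> t)) g"
      unfolding distr_traj_measure by (rule integrable_measure_pmf_finite) simp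
  qed
qed

text \<open>Functions on a finite type are bounded, so a geometric series dominates and the
  expectation may be taken term by term.\<close>

lemma discounted_traj_sums:
  fixes P :: "'s::finite \<Rightarrow> 'a::finite \<Rightarrow> 's pmf" and g :: "'s \<times> 'a \<Rightarrow> real"
  assumes "0 < \<gamma>" "\<gamma> < 1"
  shows "(\<lambda>t. \<gamma> ^ t * measure_pmf.expectation (state_action_law P \<pi> s t) g) sums
      (LINT \<omega>|traj_measure P \<pi> s. (\<Sum>t. \<gamma> ^ t * g (\<omega> t)))"
proof -
  define B where "B = (\<Sum>z\<in>UNIV. \<bar>g z\<bar>)"
  have B: "\<bar>g z\<bar> \<le> B" for z
    unfolding B_def by (rule member_le_sum) auto
  interpret prob_space "traj_measure P \<pi> s"
    by (rule prob_space_traj_measure)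
  have geo: "summable (\<lambda>t. \<gamma> ^ t * B)"
    using assms by (intro summable_mult2 summable_geometric) auto
  have b1: "norm (\<gamma> ^ t * g z) \<le> \<gamma> ^ t * B" for t z
    using assms B[of z] by (simp add: abs_mult mult_left_mono)
  have int: "integrable (traj_measure P \<pi> s) (\<lambda>\<omega>. \<gamma> ^ t * g (\<omega> t))" for t
    using integral_traj_measure(2)[of P \<pi> s "\<lambda>z. \<gamma> ^ t * g z"] .
  have "(\<lambda>t. LINT \<omega>|traj_measure P \<pi> s. \<gamma> ^ t * g (\<omega> t)) sums
      (LINT \<omega>|traj_measure P \<pi> s. (\<Sum>t. \<gamma> ^ t * g (\<omega> t)))"
  proof (rule sums_integral)
    show "AE \<omega> in traj_measure P \<pi> s. summable (\<lambda>t. norm (\<gamma> ^ t * g (\<omega> t)))"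
      by (rule AE_I2, rule summable_comparison_test'[OF geo, of 0]) (use b1 in auto)
    show "summable (\<lambda>t. LINT \<omega>|traj_measure P \<pi> s. norm (\<gamma> ^ t * g (\<omega> t)))"
    proof (rule summable_comparison_test'[OF geo, of 0])
      fix t :: nat
      have "(LINT \<omega>|traj_measure P \<pi> s. norm (\<gamma> ^ t * g (\<omega> t))) \<le> (LINT \<omega>|traj_measure P \<pi> s. \<gamma> ^ t * B)"
        using b1 int by (intro integral_mono) auto
      then show "norm (LINT \<omega>|traj_measure P \<pi> s. norm (\<gamma> ^ t * g (\<omega> t))) \<le> \<gamma> ^ t * B"
        by (simp add: prob_space)
    qed
  qed (rule int)
  then show ?thesis
    by (simp add: integral_traj_measure(1))
qed

section \<open>Log-sum-exp and softmax\<close>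

lemma exp_sum_pos:
  fixes g :: "'a::finite \<Rightarrow> real"
  shows "0 < (\<Sum>a\<in>UNIV. exp (g a))"
  by (rule sum_pos) auto

text \<open>Raising every entry by \<delta> multiplies each exponential by
  \<open>exp (\<delta> / \<tau>)\<close>, which the scaled logarithm turns back into \<delta>. Used
  in both directions, this makes log-sum-exp nonexpansive in the sup norm.\<close>

lemma soft_max_value_le:
  fixes Q Q' :: "real ^ ('s::finite \<times> 'a::finite)"
  assumes \<tau>: "0 < \<tau>" and le: "\<And>a. Q $ (s, a) \<le> Q' $ (s, a) + \<delta>"
  shows "soft_max_value \<tau> Q $ s \<le> soft_max_value \<tau> Q' $ s + \<delta>"
proof -
  let ?Z = "\<lambda>Q. \<Sum>a\<in>UNIV. exp (Q $ (s, a) / \<tau>)"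
  have "?Z Q \<le> (\<Sum>a\<in>UNIV. exp (Q' $ (s, a) / \<tau>) * exp (\<delta> / \<tau>))"
    using \<tau> le by (intro sum_mono) (simp add: exp_add[symmetric] add_divide_distrib[symmetric] divide_right_mono)
  then have "?Z Q \<le> exp (\<delta> / \<tau>) * ?Z Q'"
    by (simp add: sum_distrib_left mult.commute)
  then have "ln (?Z Q) \<le> ln (exp (\<delta> / \<tau>) * ?Z Q')"
    by (subst ln_le_cancel_iff) (auto intro!: mult_pos_pos exp_sum_pos)
  also have "\<dots> = \<delta> / \<tau> + ln (?Z Q')"
    using exp_sum_pos[of "\<lambda>a. Q' $ (s, a) / \<tau>"] by (simp add: ln_mult)
  finally have "\<tau> * ln (?Z Q) \<le> \<tau> * (\<delta> / \<tau> + ln (?Z Q'))"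
    using \<tau> by simp
  then show ?thesis
    using \<tau> by (simp add: soft_max_value_def distrib_left)
qed

lemma soft_max_value_nonexpansive:
  fixes Q Q' :: "real ^ ('s::finite \<times> 'a::finite)"
  assumes \<tau>: "0 < \<tau>" and le: "\<And>i. \<bar>Q $ i - Q' $ i\<bar> \<le> \<delta>"
  shows "\<bar>soft_max_value \<tau> Q $ s - soft_max_value \<tau> Q' $ s\<bar> \<le> \<delta>"
proof -
  have "Q $ i \<le> Q' $ i + \<delta>" "Q' $ i \<le> Q $ i + \<delta>" for i
    using le[of i] by auto
  then show ?thesis
    using soft_max_value_le[OF \<tau>, of Q s Q' \<delta>] soft_max_value_le[OF \<tau>, of Q' s Q \<delta>] by force
qed

lemma softmax_pos: "0 < softmax \<theta> $ i"
  by (auto simp: softmax_def exp_sum_pos)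

lemma softmax_is_policy: "is_policy (softmax \<theta>)"
proof -
  have "(\<Sum>a\<in>UNIV. softmax \<theta> $ (s, a)) = 1" for s
    using exp_sum_pos[of "\<lambda>a. \<theta> $ (s, a)"]
    by (simp add: softmax_def sum_divide_distrib[symmetric])
  then show ?thesis
    using softmax_pos[of \<theta>] by (auto simp: is_policy_def less_imp_le)
qed

lemma is_policy_le_1:
  assumes "is_policy \<pi>"
  shows "\<pi> $ i \<le> 1"
proof -
  obtain s a where i: "i = (s, a)" by fastforce
  have "\<pi> $ (s, a) \<le> (\<Sum>a\<in>UNIV. \<pi> $ (s, a))"
    using assms by (intro member_le_sum) (auto simp: is_policy_def)
  then show ?thesis
    using assms by (simp add: i is_policy_def)
qed

lemma is_policy_nonneg: "is_policy \<pi> \<Longrightarrow> 0 \<le> \<pi> $ i"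
  by (cases i) (simp add: is_policy_def)

text \<open>An exponential and its normaliser each change by a factor of at most
  \<open>exp \<delta>\<close>, so a probability changes by a factor of at most
  \<open>exp (2 * \<delta>)\<close>. As probabilities are at most 1, the factor becomes an additive
  bound.\<close>

lemma softmax_Lipschitz:
  fixes \<theta> \<theta>' :: "real ^ ('s::finite \<times> 'a::finite)"
  assumes le: "\<And>i. \<bar>\<theta> $ i - \<theta>' $ i\<bar> \<le> \<delta>"
  shows "\<bar>softmax \<theta> $ i - softmax \<theta>' $ i\<bar> \<le> 2 * \<delta>"
proof -
  obtain s a where i: "i = (s, a)" by fastforce
  have one_sided: "softmax \<theta> $ i - softmax \<theta>' $ i \<le> 2 * \<delta>"
    if le: "\<And>i. \<bar>\<theta> $ i - \<theta>' $ i\<bar> \<le> \<delta>" for \<theta> \<theta>' :: "real ^ ('s \<times> 'a)"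
  proof -
    let ?Z = "\<lambda>\<theta>. \<Sum>a\<in>UNIV. exp (\<theta> $ (s, a))"
    have Z: "0 < ?Z \<theta>" "0 < ?Z \<theta>'"
      by (rule exp_sum_pos)+
    have e: "exp (\<theta> $ j) \<le> exp \<delta> * exp (\<theta>' $ j)" "exp (\<theta>' $ j) \<le> exp \<delta> * exp (\<theta> $ j)" for j
      using le[of j] by (auto simp: exp_add[symmetric])
    have "?Z \<theta>' \<le> exp \<delta> * ?Z \<theta>"
      unfolding sum_distrib_left by (intro sum_mono e)
    then have "inverse (?Z \<theta>) \<le> exp \<delta> * inverse (?Z \<theta>')"
      using Z by (simp add: field_simps)
    then have "exp (\<theta> $ i) * inverse (?Z \<theta>) \<le> (exp \<delta> * exp (\<theta>' $ i)) * (exp \<delta> * inverse (?Z \<theta>'))"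
      using Z by (intro mult_mono e) auto
    then have "softmax \<theta> $ i \<le> (exp \<delta> * exp \<delta>) * softmax \<theta>' $ i"
      unfolding softmax_def i vec_lambda_beta fst_conv divide_inverse by (simp only: mult_ac)
    then have "softmax \<theta> $ i * exp (- (2 * \<delta>)) \<le> (exp (2 * \<delta>) * softmax \<theta>' $ i) * exp (- (2 * \<delta>))"
      by (intro mult_right_mono) (auto simp: mult_exp_exp)
    also have "\<dots> = softmax \<theta>' $ i"
      by (simp add: exp_minus)
    finally have "softmax \<theta> $ i * exp (- (2 * \<delta>)) \<le> softmax \<theta>' $ i" .
    then have "softmax \<theta> $ i - softmax \<theta>' $ i \<le> softmax \<theta> $ i * (1 - exp (- (2 * \<delta>)))"
      by (simp add: algebra_simps)
    also have "\<dots> \<le> 1 * (2 * \<delta>)"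
    proof (rule mult_mono)
      show "1 - exp (- (2 * \<delta>)) \<le> 2 * \<delta>"
        using exp_ge_add_one_self[of "- (2 * \<delta>)"] by simp
      show "0 \<le> 1 - exp (- (2 * \<delta>))"
        using le[of i] by simp
    qed (auto simp del: split_paired_All intro: is_policy_le_1[OF softmax_is_policy])
    finally show ?thesis by simp
  qed
  show ?thesis
    using one_sided[OF le] one_sided[of \<theta>' \<theta>] le by (simp add: abs_le_iff abs_minus_commute)
qed

text \<open>One summand of a relative entropy, with the correction \<open>- p + q\<close> that makes
  each summand nonnegative by itself; between distributions the corrections cancel. The source is
  \<open>ln t \<le> t - 1\<close>, with equality only at 1.\<close>

lemma kl_term_nonneg:
  fixes p q :: real
  assumes "0 \<le> p" "0 < q"
  shows "0 \<le> p * ln (p / q) - p + q"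
    and "p * ln (p / q) - p + q = 0 \<Longrightarrow> p = q"
proof -
  have "0 \<le> p * ln (p / q) - p + q \<and> (p * ln (p / q) - p + q = 0 \<longrightarrow> p = q)"
  proof (cases "p = 0")
    case False
    with assms have p: "0 < p" by simp
    have ln: "ln (q / p) \<le> q / p - 1"
      using assms p by (intro ln_le_minus_one) auto
    have eq: "p * ln (p / q) - p + q = p * (q / p - 1 - ln (q / p))"
      using assms p by (simp add: ln_div algebra_simps)
    have "q / p = 1" if "ln (q / p) = q / p - 1"
      using ln_eq_minus_one[OF _ that] assms p by simp
    then show ?thesis
      unfolding eq using p ln by auto
  qed (use assms in auto)
  then show "0 \<le> p * ln (p / q) - p + q" "p * ln (p / q) - p + q = 0 \<Longrightarrow> p = q" by auto
qed

text \<open>The regret of one decision in state \<open>s\<close>: log-sum-exp is the maximum of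
  expected \<open>Q\<close> plus scaled entropy over all action distributions, and the subtracted
  term is what \<pi> achieves.\<close>

definition policy_gap :: "real \<Rightarrow> real ^ ('s::finite \<times> 'a::finite) \<Rightarrow> real ^ ('s \<times> 'a) \<Rightarrow> 's \<Rightarrow> real"
  where "policy_gap \<tau> Q \<pi> s = soft_max_value \<tau> Q $ s
    - ((\<Sum>a\<in>UNIV. \<pi> $ (s, a) * Q $ (s, a)) + \<tau> * policy_entropy \<pi> s)"

text \<open>The Gibbs variational principle. The logarithm of a softmax probability is
  \<open>Q / \<tau>\<close> minus the logarithm of the normaliser, so the regret is \<tau> times the
  relative entropy to the softmax.\<close>

lemma policy_gap_eq:
  fixes Q \<pi> :: "real ^ ('s::finite \<times> 'a::finite)"
  assumes \<tau>: "0 < \<tau>" and \<pi>: "is_policy \<pi>"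
  defines "p \<equiv> softmax ((1 / \<tau>) *\<^sub>R Q)"
  shows "policy_gap \<tau> Q \<pi> s =
    \<tau> * (\<Sum>a\<in>UNIV. \<pi> $ (s, a) * ln (\<pi> $ (s, a) / p $ (s, a)) - \<pi> $ (s, a) + p $ (s, a))"
proof -
  define Z where "Z = (\<Sum>a\<in>UNIV. exp (Q $ (s, a) / \<tau>))"
  have Z: "0 < Z"
    unfolding Z_def by (rule exp_sum_pos)
  have p: "is_policy p"
    unfolding p_def by (rule softmax_is_policy)
  have "\<pi> $ (s, a) * ln (\<pi> $ (s, a) / p $ (s, a))
      = \<pi> $ (s, a) * ln (\<pi> $ (s, a)) - \<pi> $ (s, a) * Q $ (s, a) / \<tau> + \<pi> $ (s, a) * ln Z" for a
  proof (cases "\<pi> $ (s, a) = 0")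
    case False
    then have "0 < \<pi> $ (s, a)"
      using is_policy_nonneg[OF \<pi>, of "(s, a)"] by simp
    then show ?thesis
      using Z by (simp add: p_def softmax_def Z_def[symmetric] ln_div ln_mult algebra_simps)
  qed simp
  then have "(\<Sum>a\<in>UNIV. \<pi> $ (s, a) * ln (\<pi> $ (s, a) / p $ (s, a)) - \<pi> $ (s, a) + p $ (s, a))
    = (\<Sum>a\<in>UNIV. \<pi> $ (s, a) * ln (\<pi> $ (s, a))) - (\<Sum>a\<in>UNIV. \<pi> $ (s, a) * Q $ (s, a)) / \<tau> + ln Z"
    using \<pi> p by (simp add: sum.distrib sum_subtractf is_policy_def sum_divide_distrib sum_distrib_right[symmetric])
  then show ?thesis
    using \<tau> by (simp only: policy_gap_def policy_entropy_def soft_max_value_def vec_lambda_beta Z_def[symmetric])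
      (simp add: field_simps)
qed

lemma policy_gap_nonneg:
  assumes "0 < \<tau>" "is_policy \<pi>"
  shows "0 \<le> policy_gap \<tau> Q \<pi> s"
  unfolding policy_gap_eq[OF assms]
  using assms(1) by (intro mult_nonneg_nonneg sum_nonneg kl_term_nonneg(1) is_policy_nonneg[OF assms(2)] softmax_pos) auto

lemma policy_gap_eq_0_iff:
  assumes \<tau>: "0 < \<tau>" and \<pi>: "is_policy \<pi>"
  shows "(\<forall>s. policy_gap \<tau> Q \<pi> s = 0) \<longleftrightarrow> \<pi> = softmax ((1 / \<tau>) *\<^sub>R Q)"
proof
  define p where "p = softmax ((1 / \<tau>) *\<^sub>R Q)"
  assume 0: "\<forall>s. policy_gap \<tau> Q \<pi> s = 0"
  have "\<pi> $ (s, a) = p $ (s, a)" for s a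
  proof -
    have "(\<Sum>a\<in>UNIV. \<pi> $ (s, a) * ln (\<pi> $ (s, a) / p $ (s, a)) - \<pi> $ (s, a) + p $ (s, a)) = 0"
      using 0 \<tau> policy_gap_eq[OF \<tau> \<pi>, of Q s] unfolding p_def by simp
    then have "\<forall>a\<in>UNIV. \<pi> $ (s, a) * ln (\<pi> $ (s, a) / p $ (s, a)) - \<pi> $ (s, a) + p $ (s, a) = 0"
      by (subst (asm) sum_nonneg_eq_0_iff)
        (auto intro!: kl_term_nonneg(1) is_policy_nonneg[OF \<pi>] simp: p_def softmax_pos)
    then show ?thesis
      by (intro kl_term_nonneg(2)[OF is_policy_nonneg[OF \<pi>]]) (auto simp: p_def softmax_pos)
  qed
  then show "\<pi> = p" by (simp add: vec_eq_iff)
next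
  assume eq: "\<pi> = softmax ((1 / \<tau>) *\<^sub>R Q)"
  show "\<forall>s. policy_gap \<tau> Q \<pi> s = 0"
  proof
    fix s
    have "\<pi> $ (s, a) / \<pi> $ (s, a) = 1" for a
      using softmax_pos[of "(1 / \<tau>) *\<^sub>R Q" "(s, a)"] unfolding eq by simp
    then show "policy_gap \<tau> Q \<pi> s = 0"
      unfolding policy_gap_eq[OF \<tau> \<pi>] eq[symmetric] by simp
  qed
qed

section \<open>The soft Bellman fixed point\<close>

lemma infnorm_le_iff:
  fixes x :: "real ^ 'k"
  shows "infnorm x \<le> d \<longleftrightarrow> (\<forall>i. \<bar>x $ i\<bar> \<le> d)"
proof
  assume "infnorm x \<le> d"
  then show "\<forall>i. \<bar>x $ i\<bar> \<le> d"
    using component_le_infnorm_cart[of x] by (meson order_trans)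
next
  assume "\<forall>i. \<bar>x $ i\<bar> \<le> d"
  then show "infnorm x \<le> d"
    unfolding infnorm_cart by (intro cSup_least) auto
qed

lemma has_derivative_cart:
  fixes f :: "'v::real_normed_vector \<Rightarrow> real ^ 'k"
  assumes "\<And>i. ((\<lambda>x. f x $ i) has_derivative (\<lambda>h. f' h $ i)) (at x within S)"
  shows "(f has_derivative f') (at x within S)"
  unfolding has_derivative_componentwise_within[of f]
  using assms by (auto simp: Basis_vec_def inner_axis)

lemma has_derivative_vec_nth:
  assumes "(f has_derivative f') F"
  shows "((\<lambda>x. f x $ i) has_derivative (\<lambda>h. f' h $ i)) F"
  using bounded_linear.has_derivative[OF bounded_linear_vec_nth assms] .

lemma soft_max_value_has_derivative:
  fixes Q :: "real ^ ('s::finite \<times> 'a::finite)"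
  assumes \<tau>: "0 < \<tau>"
  shows "((\<lambda>Q. soft_max_value \<tau> Q $ s) has_derivative
    (\<lambda>h. \<Sum>a\<in>UNIV. softmax ((1 / \<tau>) *\<^sub>R Q) $ (s, a) * h $ (s, a))) (at Q)"
proof -
  have d: "((\<lambda>Q::real ^ ('s \<times> 'a). Q $ i) has_derivative (\<lambda>h. h $ i)) (at Q)" for i
    by (rule has_derivative_vec_nth[OF has_derivative_ident])
  define Z where "Z = (\<Sum>a\<in>UNIV. exp (Q $ (s, a) / \<tau>))"
  have Z: "0 < Z"
    unfolding Z_def by (rule exp_sum_pos)
  have p: "softmax ((1 / \<tau>) *\<^sub>R Q) $ (s, a) = exp (Q $ (s, a) / \<tau>) / Z" for a
    by (simp add: softmax_def Z_def)
  have "((\<lambda>Q. \<Sum>a\<in>UNIV. exp (Q $ (s, a) / \<tau>)) has_derivative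
      (\<lambda>h. \<Sum>a\<in>UNIV. h $ (s, a) / \<tau> * exp (Q $ (s, a) / \<tau>))) (at Q)"
    by (intro has_derivative_sum has_derivative_exp bounded_linear.has_derivative[OF bounded_linear_divide] d)
  from has_derivative_mult_right[OF has_derivative_ln[OF _ this], of \<tau>] Z
  have "((\<lambda>Q. soft_max_value \<tau> Q $ s) has_derivative
      (\<lambda>h. \<tau> * ((\<Sum>a\<in>UNIV. h $ (s, a) / \<tau> * exp (Q $ (s, a) / \<tau>)) * inverse Z))) (at Q)"
    by (simp add: soft_max_value_def Z_def divide_inverse)
  then show ?thesis
    by (rule has_derivative_eq_rhs)
      (use \<tau> in \<open>simp add: fun_eq_iff p sum_distrib_left sum_distrib_right field_simps\<close>)
qed

text \<open>The part of the soft Bellman operator that does not involve the reward. Splitting it off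
  makes the fixed point a function of the reward vector alone, so its dependence on the parameter is
  a composition with \<open>r\<close>.\<close>

definition soft_lookahead ::
  "('s::finite \<Rightarrow> 'a::finite \<Rightarrow> 's pmf) \<Rightarrow> real \<Rightarrow> real \<Rightarrow> real ^ ('s \<times> 'a) \<Rightarrow> real ^ ('s \<times> 'a)"
  where "soft_lookahead P \<gamma> \<tau> Q =
    (\<chi> i. \<gamma> * (\<Sum>s'\<in>UNIV. pmf (P (fst i) (snd i)) s' * soft_max_value \<tau> Q $ s'))"

lemma soft_bellman_eq: "soft_bellman P \<gamma> \<tau> r x Q = r x + soft_lookahead P \<gamma> \<tau> Q"
  by (simp add: vec_eq_iff soft_bellman_def soft_lookahead_def soft_max_value_def)

lemma pmf_average_le:
  fixes p :: "'s::finite pmf"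
  assumes "\<And>s. \<bar>v s\<bar> \<le> d"
  shows "\<bar>\<Sum>s\<in>UNIV. pmf p s * v s\<bar> \<le> d"
proof -
  have "\<bar>\<Sum>s\<in>UNIV. pmf p s * v s\<bar> \<le> (\<Sum>s\<in>UNIV. pmf p s * d)"
    using assms by (intro order_trans[OF sum_abs] sum_mono) (simp add: abs_mult mult_left_mono)
  also have "\<dots> = d"
    by (simp add: sum_distrib_right[symmetric] sum_pmf_eq_1)
  finally show ?thesis .
qed

lemma soft_lookahead_contraction:
  fixes Q Q' :: "real ^ ('s::finite \<times> 'a::finite)"
  assumes "0 < \<gamma>" "0 < \<tau>"
  shows "infnorm (soft_lookahead P \<gamma> \<tau> Q - soft_lookahead P \<gamma> \<tau> Q') \<le> \<gamma> * infnorm (Q - Q')"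
proof -
  have "\<bar>soft_max_value \<tau> Q $ s - soft_max_value \<tau> Q' $ s\<bar> \<le> infnorm (Q - Q')" for s
    using component_le_infnorm_cart[of "Q - Q'"]
    by (intro soft_max_value_nonexpansive assms) simp
  then have "\<bar>\<Sum>s\<in>UNIV. pmf p s * (soft_max_value \<tau> Q $ s - soft_max_value \<tau> Q' $ s)\<bar> \<le> infnorm (Q - Q')"
    for p :: "'s pmf"
    by (rule pmf_average_le)
  then show ?thesis
    using assms unfolding infnorm_le_iff
    by (auto simp: soft_lookahead_def right_diff_distrib[symmetric] sum_subtractf[symmetric] abs_mult mult_left_mono)
qed

lemma soft_lookahead_has_derivative:
  fixes Q :: "real ^ ('s::finite \<times> 'a::finite)"
  assumes \<tau>: "0 < \<tau>"
  shows "(soft_lookahead P \<gamma> \<tau> has_derivative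
    (\<lambda>h. \<chi> i. \<gamma> * (\<Sum>s'\<in>UNIV. pmf (P (fst i) (snd i)) s' *
       (\<Sum>a\<in>UNIV. softmax ((1 / \<tau>) *\<^sub>R Q) $ (s', a) * h $ (s', a))))) (at Q)"
  unfolding soft_lookahead_def
  by (rule has_derivative_cart, simp only: vec_lambda_beta)
    (intro has_derivative_mult_right has_derivative_sum soft_max_value_has_derivative \<tau>)

text \<open>The contracted part of the difference is absorbed on the left. With equal rewards this
  is uniqueness of the fixed point, otherwise Lipschitz dependence on the reward.\<close>

lemma soft_fixpoint_perturbation:
  fixes Q Q' R R' :: "real ^ ('s::finite \<times> 'a::finite)"
  assumes \<gamma>: "0 < \<gamma>" "\<gamma> < 1" and \<tau>: "0 < \<tau>"
    and "Q = R + soft_lookahead P \<gamma> \<tau> Q" "Q' = R' + soft_lookahead P \<gamma> \<tau> Q'"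
  shows "infnorm (Q - Q') \<le> infnorm (R - R') / (1 - \<gamma>)"
proof -
  have "Q - Q' = (R - R') + (soft_lookahead P \<gamma> \<tau> Q - soft_lookahead P \<gamma> \<tau> Q')"
    by (subst assms(4), subst assms(5)) simp
  then have "infnorm (Q - Q') \<le> infnorm (R - R') + infnorm (soft_lookahead P \<gamma> \<tau> Q - soft_lookahead P \<gamma> \<tau> Q')"
    using infnorm_triangle[of "R - R'"] by simp
  then have "infnorm (Q - Q') \<le> infnorm (R - R') + \<gamma> * infnorm (Q - Q')"
    using soft_lookahead_contraction[OF \<gamma>(1) \<tau>, of P Q Q'] by simp
  then show ?thesis
    using \<gamma> by (simp add: field_simps)
qed

text \<open>The operator contracts the sup norm, whereas the metric of the vector type is Euclidean.
  Existence therefore comes from Brouwer's theorem on an invariant sup-norm ball, and only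
  uniqueness uses the contraction property directly.\<close>

lemma ex1_soft_fixpoint:
  fixes R :: "real ^ ('s::finite \<times> 'a::finite)"
  assumes \<gamma>: "0 < \<gamma>" "\<gamma> < 1" and \<tau>: "0 < \<tau>"
  shows "\<exists>!Q. Q = R + soft_lookahead P \<gamma> \<tau> Q"
proof (rule ex_ex1I)
  let ?B = "soft_lookahead P \<gamma> \<tau>"
  \<comment> \<open>The radius solves \<open>infnorm R + \<gamma> * M + infnorm (?B 0) = M\<close>,
    so the ball is mapped into itself.\<close>
  define M where "M = (infnorm R + infnorm (?B 0)) / (1 - \<gamma>)"
  have M0: "0 \<le> M"
    using \<gamma> by (simp add: M_def infnorm_pos_le)
  let ?S = "{Q :: real ^ ('s \<times> 'a). infnorm Q \<le> M}"
  have S: "?S = cbox (\<chi> i. - M) (\<chi> i. M)"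
  proof -
    have "\<bar>t\<bar> \<le> M \<longleftrightarrow> - M \<le> t \<and> t \<le> M" for t by linarith
    then show ?thesis
      by (simp only: set_eq_iff mem_Collect_eq infnorm_le_iff mem_box_cart vec_lambda_beta) blast
  qed
  have "\<exists>Q\<in>?S. R + ?B Q = Q"
  proof -
    have 1: "compact ?S" "convex ?S"
      by (simp_all add: S convex_box)
    have 2: "?S \<noteq> {}"
      using M0 by (auto simp: infnorm_0 intro!: exI[of _ 0])
    have 3: "continuous_on ?S (\<lambda>Q. R + ?B Q)"
      by (intro continuous_intros has_derivative_continuous_on[OF
          has_derivative_at_withinI[OF soft_lookahead_has_derivative[OF \<tau>]]])
    have 4: "(\<lambda>Q. R + ?B Q) \<in> ?S \<rightarrow> ?S"
    proof safe
      fix Q :: "real ^ ('s \<times> 'a)"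
      assume Q: "infnorm Q \<le> M"
      have "infnorm (R + ?B Q) \<le> infnorm R + (infnorm (?B Q - ?B 0) + infnorm (?B 0))"
        using infnorm_triangle[of R "?B Q"] infnorm_triangle[of "?B Q - ?B 0" "?B 0"] by simp
      also have "infnorm (?B Q - ?B 0) \<le> \<gamma> * M"
        using soft_lookahead_contraction[OF \<gamma>(1) \<tau>, of P Q 0] Q \<gamma>
        by (auto intro: order_trans mult_left_mono)
      also have "infnorm R + (\<gamma> * M + infnorm (?B 0)) = M"
        using \<gamma> by (simp add: M_def field_simps)
      finally show "infnorm (R + ?B Q) \<le> M" by simp
    qed
    show ?thesis
      using brouwer[OF 1 2 3 4] by blast
  qed
  then show "\<exists>Q. Q = R + ?B Q" by metis
next
  fix Q Q' assume "Q = R + soft_lookahead P \<gamma> \<tau> Q" "Q' = R + soft_lookahead P \<gamma> \<tau> Q'"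
  from soft_fixpoint_perturbation[OF \<gamma> \<tau> this] have "infnorm (Q - Q') \<le> 0"
    by (simp add: infnorm_0)
  then show "Q = Q'"
    using infnorm_pos_le[of "Q - Q'"] by (simp add: infnorm_eq_0)
qed

definition soft_Q ::
  "('s::finite \<Rightarrow> 'a::finite \<Rightarrow> 's pmf) \<Rightarrow> real \<Rightarrow> real \<Rightarrow> real ^ ('s \<times> 'a) \<Rightarrow> real ^ ('s \<times> 'a)"
  where "soft_Q P \<gamma> \<tau> R = (THE Q. Q = R + soft_lookahead P \<gamma> \<tau> Q)"

lemma soft_Q_fixpoint:
  assumes "0 < \<gamma>" "\<gamma> < 1" "0 < \<tau>"
  shows "soft_Q P \<gamma> \<tau> R = R + soft_lookahead P \<gamma> \<tau> (soft_Q P \<gamma> \<tau> R)"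
  unfolding soft_Q_def by (rule theI'[OF ex1_soft_fixpoint[OF assms]])

lemma soft_Q_Lipschitz:
  assumes "0 < \<gamma>" "\<gamma> < 1" "0 < \<tau>"
  shows "infnorm (soft_Q P \<gamma> \<tau> R - soft_Q P \<gamma> \<tau> R') \<le> infnorm (R - R') / (1 - \<gamma>)"
  using soft_fixpoint_perturbation[OF assms soft_Q_fixpoint[OF assms] soft_Q_fixpoint[OF assms]] .

lemma norm_le_card_infnorm: "norm (x :: real ^ 'k) \<le> real CARD('k) * infnorm x"
proof -
  have "norm x \<le> (\<Sum>i\<in>UNIV. \<bar>x $ i\<bar>)"
    by (rule norm_le_l1_cart)
  also have "\<dots> \<le> (\<Sum>i\<in>(UNIV :: 'k set). infnorm x)"
    by (intro sum_mono component_le_infnorm_cart)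
  finally show ?thesis by simp
qed

text \<open>The map \<open>Q \<mapsto> Q - soft_lookahead Q\<close> is invertible with Lipschitz inverse \<^const>\<open>soft_Q\<close>, and
  its derivative is injective because it is the identity minus a contraction.\<close>

lemma soft_Q_differentiable:
  fixes R :: "real ^ ('s::finite \<times> 'a::finite)"
  assumes \<gamma>: "0 < \<gamma>" "\<gamma> < 1" and \<tau>: "0 < \<tau>"
  shows "soft_Q P \<gamma> \<tau> differentiable (at R)"
proof -
  let ?g = "soft_Q P \<gamma> \<tau>"
  define p where "p = softmax ((1 / \<tau>) *\<^sub>R ?g R)"
  have p: "is_policy p"
    unfolding p_def by (rule softmax_is_policy)
  define D :: "real ^ ('s \<times> 'a) \<Rightarrow> real ^ ('s \<times> 'a)" where "D h =
    (\<chi> i. \<gamma> * (\<Sum>s'\<in>UNIV. pmf (P (fst i) (snd i)) s' * (\<Sum>a\<in>UNIV. p $ (s', a) * h $ (s', a))))" for h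
  have D: "((\<lambda>Q. Q - soft_lookahead P \<gamma> \<tau> Q) has_derivative (\<lambda>h. h - D h)) (at (?g R))"
    unfolding D_def p_def
    by (intro has_derivative_diff has_derivative_ident soft_lookahead_has_derivative \<tau>)
  have "infnorm (D h) \<le> \<gamma> * infnorm h" for h
  proof -
    have "\<bar>\<Sum>a\<in>UNIV. p $ (s, a) * h $ (s, a)\<bar> \<le> infnorm h" for s
    proof -
      have "\<bar>\<Sum>a\<in>UNIV. p $ (s, a) * h $ (s, a)\<bar> \<le> (\<Sum>a\<in>UNIV. p $ (s, a) * infnorm h)"
        using p component_le_infnorm_cart[of h]
        by (intro order_trans[OF sum_abs] sum_mono) (simp add: abs_mult mult_left_mono is_policy_def)
      also have "\<dots> = infnorm h"
        using p by (simp add: sum_distrib_right[symmetric] is_policy_def)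
      finally show ?thesis .
    qed
    then have "\<bar>\<Sum>s'\<in>UNIV. pmf q s' * (\<Sum>a\<in>UNIV. p $ (s', a) * h $ (s', a))\<bar> \<le> infnorm h" for q :: "'s pmf"
      by (rule pmf_average_le)
    then show ?thesis
      using \<gamma> unfolding infnorm_le_iff D_def by (auto simp: abs_mult mult_left_mono)
  qed
  then have inj0: "h = 0" if "h - D h = 0" for h
  proof -
    have "infnorm h \<le> \<gamma> * infnorm h"
      using that \<open>infnorm (D h) \<le> \<gamma> * infnorm h\<close> by simp
    then have "(1 - \<gamma>) * infnorm h \<le> 0"
      by (simp add: algebra_simps)
    then have "infnorm h = 0"
      using \<gamma> infnorm_pos_le[of h] by (simp add: mult_le_0_iff)
    then show ?thesis by (simp add: infnorm_eq_0)
  qed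
  have lin: "linear (\<lambda>h. h - D h)"
    using D has_derivative_linear by blast
  then have "inj (\<lambda>h. h - D h)"
    using inj0 linear_injective_0 by blast
  then obtain g' where g': "linear g'" "g' \<circ> (\<lambda>h. h - D h) = id"
    using linear_injective_left_inverse[OF lin] by blast
  have "(?g has_derivative g') (at R)"
  proof (rule has_derivative_inverse_basic[where g = ?g, OF D])
    show "g' \<circ> (\<lambda>h. h - D h) = id"
      by (rule g'(2))
    show "open UNIV" "R \<in> UNIV" by auto
    show "bounded_linear g'"
      using g'(1) by (simp add: linear_conv_bounded_linear)
    have "(CARD('s \<times> 'a) / (1 - \<gamma>))-lipschitz_on UNIV ?g"
    proof (rule lipschitz_onI)
      fix R R' :: "real ^ ('s \<times> 'a)"
      have "infnorm (?g R - ?g R') \<le> norm (R - R') / (1 - \<gamma>)"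
        using soft_Q_Lipschitz[OF \<gamma> \<tau>, of P R R'] infnorm_le_norm[of "R - R'"] \<gamma>
        by (meson diff_gt_0_iff_gt divide_right_mono less_imp_le order_trans)
      from order_trans[OF norm_le_card_infnorm mult_left_mono[OF this]]
      show "dist (?g R) (?g R') \<le> CARD('s \<times> 'a) / (1 - \<gamma>) * dist R R'"
        by (simp add: dist_norm)
    qed (use \<gamma> in auto)
    then show "continuous (at R) ?g"
      using lipschitz_on_continuous_on continuous_on_eq_continuous_at open_UNIV by blast
  next
    fix R' show "?g R' - soft_lookahead P \<gamma> \<tau> (?g R') = R'"
      using soft_Q_fixpoint[OF \<gamma> \<tau>, of P R'] by (simp add: algebra_simps)
  qed
  then show ?thesis
    by (rule differentiableI)
qed

section \<open>The optimal policy\<close>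

lemma pmf_policy_pmf:
  assumes "is_policy \<pi>"
  shows "pmf (policy_pmf \<pi> s) a = \<pi> $ (s, a)"
  unfolding policy_pmf_def
proof (rule pmf_embed_pmf)
  show "0 \<le> \<pi> $ (s, a)" for a
    using assms by (simp add: is_policy_def)
  have "(\<integral>\<^sup>+ a. ennreal (\<pi> $ (s, a)) \<partial>count_space UNIV) = (\<Sum>a\<in>UNIV. ennreal (\<pi> $ (s, a)))"
    by (rule nn_integral_count_space_finite) simp
  also have "\<dots> = ennreal 1"
    using assms by (subst sum_ennreal) (auto simp: is_policy_def)
  finally show "(\<integral>\<^sup>+ a. ennreal (\<pi> $ (s, a)) \<partial>count_space UNIV) = 1" by simp
qed

lemma expectation_finite_type:
  fixes p :: "'b::finite pmf" and g :: "'b \<Rightarrow> real"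
  shows "measure_pmf.expectation p g = (\<Sum>z\<in>UNIV. pmf p z * g z)"
  by (subst integral_measure_pmf[of UNIV]) auto

lemma expectation_bind_finite_type:
  fixes p :: "'b::finite pmf" and f :: "'b \<Rightarrow> 'c::finite pmf" and g :: "'c \<Rightarrow> real"
  shows "measure_pmf.expectation (bind_pmf p f) g
    = measure_pmf.expectation p (\<lambda>z. measure_pmf.expectation (f z) g)"
  by (subst pmf_expectation_bind[of UNIV]) (auto simp: expectation_finite_type)

lemma expectation_policy:
  fixes g :: "'s::finite \<times> 'a::finite \<Rightarrow> real"
  assumes "is_policy \<pi>"
  shows "measure_pmf.expectation (map_pmf (Pair s) (policy_pmf \<pi> s)) g = (\<Sum>a\<in>UNIV. \<pi> $ (s, a) * g (s, a))"
  unfolding integral_map_pmf by (simp add: expectation_finite_type pmf_policy_pmf[OF assms])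

text \<open>At every time the action is a fresh draw from the policy given the state, so
  \<open>g\<close> may be replaced by its conditional mean given the state.\<close>

lemma expectation_state_action_law:
  fixes P :: "'s::finite \<Rightarrow> 'a::finite \<Rightarrow> 's pmf" and g :: "'s \<times> 'a \<Rightarrow> real"
  assumes \<pi>: "is_policy \<pi>"
  shows "measure_pmf.expectation (state_action_law P \<pi> s t) g =
    measure_pmf.expectation (state_action_law P \<pi> s t) (\<lambda>z. \<Sum>a\<in>UNIV. \<pi> $ (fst z, a) * g (fst z, a))"
proof -
  have const: "(\<Sum>a\<in>UNIV. \<pi> $ (s', a) * c) = c" for s' c
    using \<pi> by (simp add: sum_distrib_right[symmetric] is_policy_def)
  show ?thesis
    by (cases t) (simp_all add: expectation_bind_finite_type expectation_policy[OF \<pi>] const del: integral_map_pmf)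
qed

lemma expectation_state_action_law_Suc:
  fixes P :: "'s::finite \<Rightarrow> 'a::finite \<Rightarrow> 's pmf" and v :: "'s \<Rightarrow> real"
  assumes \<pi>: "is_policy \<pi>"
  shows "measure_pmf.expectation (state_action_law P \<pi> s (Suc t)) (\<lambda>z. v (fst z)) =
    measure_pmf.expectation (state_action_law P \<pi> s t) (\<lambda>z. \<Sum>s'\<in>UNIV. pmf (P (fst z) (snd z)) s' * v s')"
proof -
  have const: "(\<Sum>a\<in>UNIV. \<pi> $ (s', a) * c) = c" for s' c
    using \<pi> by (simp add: sum_distrib_right[symmetric] is_policy_def)
  show ?thesis
    by (simp add: expectation_bind_finite_type expectation_policy[OF \<pi>] const del: integral_map_pmf)
      (simp add: expectation_finite_type)
qed

text \<open>The performance difference identity, a telescoping sum along the trajectory because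
  \<open>V(s) - gap(s) = E\<^sub>a [r(s, a) + \<tau> h(\<pi>\<^sub>s) + \<gamma> E V(s')]\<close>.\<close>

lemma soft_value_gap_sums:
  fixes P :: "'s::finite \<Rightarrow> 'a::finite \<Rightarrow> 's pmf" and r :: "real ^ 'n \<Rightarrow> real ^ ('s \<times> 'a)" and x :: "real ^ 'n"
  assumes \<gamma>: "0 < \<gamma>" "\<gamma> < 1" and \<tau>: "0 < \<tau>" and \<pi>: "is_policy \<pi>"
  defines "Q \<equiv> soft_Q P \<gamma> \<tau> (r x)"
  shows "(\<lambda>t. \<gamma> ^ t * measure_pmf.expectation (state_action_law P \<pi> s t) (\<lambda>z. policy_gap \<tau> Q \<pi> (fst z)))
    sums (soft_max_value \<tau> Q $ s - soft_value P \<gamma> \<tau> r \<pi> x s)"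
proof -
  let ?E = "\<lambda>t. measure_pmf.expectation (state_action_law P \<pi> s t)"
  let ?V = "\<lambda>s. soft_max_value \<tau> Q $ s"
  have int: "integrable (measure_pmf p) g" for p :: "('s \<times> 'a) pmf" and g :: "'s \<times> 'a \<Rightarrow> real"
    by (rule integrable_measure_pmf_finite) simp
  have Q: "Q $ z = r x $ z + \<gamma> * (\<Sum>s'\<in>UNIV. pmf (P (fst z) (snd z)) s' * ?V s')" for z
    unfolding Q_def by (subst soft_Q_fixpoint[OF \<gamma> \<tau>]) (simp add: soft_lookahead_def)
  have step: "?E t (\<lambda>z. policy_gap \<tau> Q \<pi> (fst z)) = ?E t (\<lambda>z. ?V (fst z)) - \<gamma> * ?E (Suc t) (\<lambda>z. ?V (fst z))
      - ?E t (\<lambda>z. r x $ z + \<tau> * policy_entropy \<pi> (fst z))" for t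
  proof -
    have "?E t (\<lambda>z. policy_gap \<tau> Q \<pi> (fst z)) =
      ?E t (\<lambda>z. ?V (fst z)) - (?E t (\<lambda>z. \<Sum>a\<in>UNIV. \<pi> $ (fst z, a) * Q $ (fst z, a)) + ?E t (\<lambda>z. \<tau> * policy_entropy \<pi> (fst z)))"
      by (simp add: policy_gap_def int del: integral_mult_right_zero)
    also have "?E t (\<lambda>z. \<Sum>a\<in>UNIV. \<pi> $ (fst z, a) * Q $ (fst z, a)) = ?E t (\<lambda>z. Q $ z)"
      by (rule expectation_state_action_law[OF \<pi>, symmetric])
    also have "\<dots> = ?E t (\<lambda>z. r x $ z) + \<gamma> * ?E (Suc t) (\<lambda>z. ?V (fst z))"
      unfolding expectation_state_action_law_Suc[OF \<pi>] Q
      by (simp add: int)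
    finally show ?thesis
      by (simp add: int)
  qed
  define v where "v t = \<gamma> ^ t * ?E t (\<lambda>z. ?V (fst z))" for t
  have "v \<longlonglongrightarrow> 0"
  proof (rule Lim_null_comparison)
    define B where "B = (\<Sum>s\<in>UNIV. \<bar>?V s\<bar>)"
    have B: "\<bar>?V s\<bar> \<le> B" for s
      unfolding B_def by (rule member_le_sum) auto
    have "\<bar>?E t (\<lambda>z. ?V (fst z))\<bar> \<le> B" for t
      unfolding expectation_finite_type by (rule pmf_average_le) (rule B)
    then show "\<forall>\<^sub>F t in sequentially. norm (v t) \<le> \<gamma> ^ t * B"
      using \<gamma> by (intro always_eventually allI) (simp add: v_def abs_mult mult_left_mono)
    show "(\<lambda>t. \<gamma> ^ t * B) \<longlonglongrightarrow> 0"
      using \<gamma> by (intro tendsto_mult_left_zero LIMSEQ_power_zero) auto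
  qed
  from telescope_sums'[OF this] have "(\<lambda>t. v t - v (Suc t)) sums v 0"
    by simp
  moreover have "(\<lambda>t. \<gamma> ^ t * ?E t (\<lambda>z. r x $ z + \<tau> * policy_entropy \<pi> (fst z)))
      sums soft_value P \<gamma> \<tau> r \<pi> x s"
    unfolding soft_value_def by (rule discounted_traj_sums[OF \<gamma>])
  ultimately have "(\<lambda>t. v t - v (Suc t) - \<gamma> ^ t * ?E t (\<lambda>z. r x $ z + \<tau> * policy_entropy \<pi> (fst z)))
      sums (v 0 - soft_value P \<gamma> \<tau> r \<pi> x s)"
    by (rule sums_diff)
  moreover have "v 0 = ?V s"
    by (simp add: v_def)
  ultimately show ?thesis
    unfolding step by (simp add: v_def algebra_simps)
qed

text \<open>Keeps only the time 0 term of a series of nonnegative gaps. At time 0 the trajectory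
  sits in \<open>s\<close> itself, so the regret in each state bounds the loss from that state,
  whatever the transition kernel.\<close>

lemma soft_value_le:
  fixes P :: "'s::finite \<Rightarrow> 'a::finite \<Rightarrow> 's pmf" and r :: "real ^ 'n \<Rightarrow> real ^ ('s \<times> 'a)" and x :: "real ^ 'n"
  assumes \<gamma>: "0 < \<gamma>" "\<gamma> < 1" and \<tau>: "0 < \<tau>" and \<pi>: "is_policy \<pi>"
  defines "Q \<equiv> soft_Q P \<gamma> \<tau> (r x)"
  shows "policy_gap \<tau> Q \<pi> s \<le> soft_max_value \<tau> Q $ s - soft_value P \<gamma> \<tau> r \<pi> x s"
proof -
  let ?g = "\<lambda>t. \<gamma> ^ t * measure_pmf.expectation (state_action_law P \<pi> s t) (\<lambda>z. policy_gap \<tau> Q \<pi> (fst z))"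
  have sums: "?g sums (soft_max_value \<tau> Q $ s - soft_value P \<gamma> \<tau> r \<pi> x s)"
    unfolding Q_def by (rule soft_value_gap_sums[OF \<gamma> \<tau> \<pi>])
  have "0 \<le> ?g t" for t
    using \<gamma> policy_gap_nonneg[OF \<tau> \<pi>] by (intro mult_nonneg_nonneg integral_nonneg_AE) auto
  then have "sum ?g {0} \<le> suminf ?g"
    using sums by (intro sum_le_suminf) (auto simp: sums_iff)
  then show ?thesis
    using sums by (simp add: sums_iff)
qed

lemma soft_value_softmax:
  fixes P :: "'s::finite \<Rightarrow> 'a::finite \<Rightarrow> 's pmf" and r :: "real ^ 'n \<Rightarrow> real ^ ('s \<times> 'a)" and x :: "real ^ 'n"
  assumes \<gamma>: "0 < \<gamma>" "\<gamma> < 1" and \<tau>: "0 < \<tau>"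
  defines "Q \<equiv> soft_Q P \<gamma> \<tau> (r x)"
  shows "soft_value P \<gamma> \<tau> r (softmax ((1 / \<tau>) *\<^sub>R Q)) x s = soft_max_value \<tau> Q $ s"
proof -
  have "policy_gap \<tau> Q (softmax ((1 / \<tau>) *\<^sub>R Q)) s = 0" for s
    using policy_gap_eq_0_iff[OF \<tau> softmax_is_policy] by blast
  moreover have "(\<lambda>t. \<gamma> ^ t * measure_pmf.expectation (state_action_law P (softmax ((1 / \<tau>) *\<^sub>R Q)) s t)
        (\<lambda>z. policy_gap \<tau> Q (softmax ((1 / \<tau>) *\<^sub>R Q)) (fst z)))
      sums (soft_max_value \<tau> Q $ s - soft_value P \<gamma> \<tau> r (softmax ((1 / \<tau>) *\<^sub>R Q)) x s)"
    unfolding Q_def by (rule soft_value_gap_sums[OF \<gamma> \<tau> softmax_is_policy])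
  ultimately show ?thesis
    by (simp add: sums_iff)
qed

text \<open>The softmax policy attains the largest value in all states at once. Since \<rho> charges
  every state, another minimiser loses nothing in any state; its regret then vanishes everywhere,
  and this happens only for the softmax.\<close>

lemma opt_policy_eq_softmax:
  fixes P :: "'s::finite \<Rightarrow> 'a::finite \<Rightarrow> 's pmf" and r :: "real ^ 'n \<Rightarrow> real ^ ('s \<times> 'a)" and x :: "real ^ 'n"
  assumes \<gamma>: "0 < \<gamma>" "\<gamma> < 1" and \<tau>: "0 < \<tau>" and \<rho>: "\<And>s. 0 < pmf \<rho> s"
  shows "opt_policy P \<gamma> \<tau> \<rho> r x = softmax ((1 / \<tau>) *\<^sub>R soft_Q P \<gamma> \<tau> (r x))"
proof -
  define Q where "Q = soft_Q P \<gamma> \<tau> (r x)"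
  define p where "p = softmax ((1 / \<tau>) *\<^sub>R Q)"
  let ?V = "\<lambda>\<pi> s. soft_value P \<gamma> \<tau> r \<pi> x s"
  let ?J = "\<lambda>\<pi>. - (\<Sum>s\<in>UNIV. pmf \<rho> s * ?V \<pi> s)"
  have p: "is_policy p"
    unfolding p_def by (rule softmax_is_policy)
  have gap: "policy_gap \<tau> Q \<pi> s \<le> ?V p s - ?V \<pi> s" if "is_policy \<pi>" for \<pi> s
    using soft_value_le[OF \<gamma> \<tau> that, of P r x s] soft_value_softmax[OF \<gamma> \<tau>, of P r x s]
    unfolding p_def Q_def by simp
  have le: "?V \<pi> s \<le> ?V p s" if "is_policy \<pi>" for \<pi> s
    using gap[OF that, of s] policy_gap_nonneg[OF \<tau> that, of Q s] by simp
  show ?thesis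
    unfolding opt_policy_def p_def[symmetric] Q_def[symmetric]
  proof (rule the_equality)
    show "is_arg_min ?J is_policy p"
      using p \<rho> le by (auto simp: is_arg_min_def not_less intro!: sum_mono mult_left_mono less_imp_le[OF \<rho>])
  next
    fix \<pi> assume arg_min: "is_arg_min ?J is_policy \<pi>"
    then have \<pi>: "is_policy \<pi>" and "(\<Sum>s\<in>UNIV. pmf \<rho> s * ?V p s) \<le> (\<Sum>s\<in>UNIV. pmf \<rho> s * ?V \<pi> s)"
      using p by (auto simp: is_arg_min_def not_less)
    then have "(\<Sum>s\<in>UNIV. pmf \<rho> s * (?V p s - ?V \<pi> s)) \<le> 0"
      by (simp add: right_diff_distrib sum_subtractf)
    moreover have nonneg: "0 \<le> pmf \<rho> s * (?V p s - ?V \<pi> s)" for s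
      using le[OF \<pi>, of s] by simp
    ultimately have "(\<Sum>s\<in>UNIV. pmf \<rho> s * (?V p s - ?V \<pi> s)) = 0"
      by (intro antisym sum_nonneg) auto
    then have "\<forall>s\<in>UNIV. pmf \<rho> s * (?V p s - ?V \<pi> s) = 0"
      using nonneg by (subst (asm) sum_nonneg_eq_0_iff) auto
    then have "?V p s - ?V \<pi> s = 0" for s
      using \<rho>[of s] by (metis UNIV_I less_irrefl mult_eq_0_iff)
    then have "policy_gap \<tau> Q \<pi> s = 0" for s
      using gap[OF \<pi>, of s] policy_gap_nonneg[OF \<tau> \<pi>, of Q s] by simp
    then show "\<pi> = p"
      using policy_gap_eq_0_iff[OF \<tau> \<pi>, of Q] by (simp add: p_def)
  qed
qed

section \<open>The adjoint system\<close>

definition adjoint_mat ::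
  "('s::finite \<Rightarrow> 'a::finite \<Rightarrow> 's pmf) \<Rightarrow> real \<Rightarrow> real ^ ('s \<times> 'a) \<Rightarrow> real ^ 's ^ 's"
  where "adjoint_mat P \<gamma> \<pi> = transpose (mat 1 - \<gamma> *\<^sub>R policy_trans P \<pi>)"

lemma policy_trans_nonneg: "is_policy \<pi> \<Longrightarrow> 0 \<le> policy_trans P \<pi> $ s $ s'"
  by (auto simp: policy_trans_def intro!: sum_nonneg mult_nonneg_nonneg is_policy_nonneg)

lemma policy_trans_row_sum:
  assumes "is_policy \<pi>"
  shows "(\<Sum>s'\<in>UNIV. policy_trans P \<pi> $ s $ s') = 1"
proof -
  have "(\<Sum>s'\<in>UNIV. policy_trans P \<pi> $ s $ s') = (\<Sum>a\<in>UNIV. \<Sum>s'\<in>UNIV. \<pi> $ (s, a) * pmf (P s a) s')"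
    unfolding policy_trans_def vec_lambda_beta by (rule sum.swap)
  also have "\<dots> = 1"
    using assms by (simp add: sum_distrib_left[symmetric] sum_pmf_eq_1 is_policy_def)
  finally show ?thesis .
qed

lemma mat_1_mult_component:
  fixes v :: "real ^ 's"
  shows "(\<Sum>j\<in>UNIV. mat 1 $ i $ j * v $ j) = v $ i" "(\<Sum>j\<in>UNIV. mat 1 $ j $ i * v $ j) = v $ i"
  by (simp_all add: mat_def if_distrib[of "\<lambda>x. x * _"] cong: if_cong)

lemma adjoint_mat_mult_component:
  "(adjoint_mat P \<gamma> \<pi> *v w) $ s' = w $ s' - \<gamma> * (\<Sum>s\<in>UNIV. policy_trans P \<pi> $ s $ s' * w $ s)"
  by (simp add: adjoint_mat_def matrix_vector_mult_def transpose_def left_diff_distrib sum_subtractf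
      mat_1_mult_component sum_distrib_left mult.assoc)

lemma transpose_adjoint_mat_mult_component:
  "(transpose (adjoint_mat P \<gamma> \<pi>) *v v) $ s = v $ s - \<gamma> * (\<Sum>s'\<in>UNIV. policy_trans P \<pi> $ s $ s' * v $ s')"
  by (simp add: adjoint_mat_def matrix_vector_mult_def transpose_def left_diff_distrib sum_subtractf
      mat_1_mult_component sum_distrib_left mult.assoc)

text \<open>The rows of the transition matrix sum to 1, so its transpose is nonexpansive for the 1-norm.\<close>

lemma adjoint_mat_l1_lower_bound:
  fixes w :: "real ^ 's::finite"
  assumes \<gamma>: "0 < \<gamma>" and \<pi>: "is_policy \<pi>"
  shows "(1 - \<gamma>) * (\<Sum>s\<in>UNIV. \<bar>w $ s\<bar>) \<le> (\<Sum>s\<in>UNIV. \<bar>(adjoint_mat P \<gamma> \<pi> *v w) $ s\<bar>)"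
proof -
  let ?T = "policy_trans P \<pi>"
  have "(\<Sum>s'\<in>UNIV. \<bar>w $ s'\<bar>) \<le>
    (\<Sum>s'\<in>UNIV. \<bar>(adjoint_mat P \<gamma> \<pi> *v w) $ s'\<bar> + \<gamma> * (\<Sum>s\<in>UNIV. ?T $ s $ s' * \<bar>w $ s\<bar>))"
  proof (rule sum_mono)
    fix s'
    have "\<bar>\<Sum>s\<in>UNIV. ?T $ s $ s' * w $ s\<bar> \<le> (\<Sum>s\<in>UNIV. ?T $ s $ s' * \<bar>w $ s\<bar>)"
      using policy_trans_nonneg[OF \<pi>] by (intro order_trans[OF sum_abs]) (auto simp: abs_mult)
    then have "\<bar>\<gamma> * (\<Sum>s\<in>UNIV. ?T $ s $ s' * w $ s)\<bar> \<le> \<gamma> * (\<Sum>s\<in>UNIV. ?T $ s $ s' * \<bar>w $ s\<bar>)"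
      using \<gamma> by (simp add: abs_mult)
    then show "\<bar>w $ s'\<bar> \<le> \<bar>(adjoint_mat P \<gamma> \<pi> *v w) $ s'\<bar> + \<gamma> * (\<Sum>s\<in>UNIV. ?T $ s $ s' * \<bar>w $ s\<bar>)"
      unfolding adjoint_mat_mult_component by linarith
  qed
  also have "\<dots> = (\<Sum>s'\<in>UNIV. \<bar>(adjoint_mat P \<gamma> \<pi> *v w) $ s'\<bar>) + \<gamma> * (\<Sum>s\<in>UNIV. \<Sum>s'\<in>UNIV. ?T $ s $ s' * \<bar>w $ s\<bar>)"
    unfolding sum.distrib sum_distrib_left[symmetric] by (subst (2) sum.swap) (rule refl)
  also have "(\<Sum>s\<in>UNIV. \<Sum>s'\<in>UNIV. ?T $ s $ s' * \<bar>w $ s\<bar>) = (\<Sum>s\<in>UNIV. \<bar>w $ s\<bar>)"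
    unfolding sum_distrib_right[symmetric] policy_trans_row_sum[OF \<pi>] by simp
  finally show ?thesis
    by (simp add: algebra_simps)
qed

lemma sum_abs_le_card_norm: "(\<Sum>i\<in>UNIV. \<bar>v $ i\<bar>) \<le> real CARD('k) * norm (v :: real ^ 'k)"
proof -
  have "(\<Sum>i\<in>UNIV. \<bar>v $ i\<bar>) \<le> (\<Sum>i\<in>(UNIV :: 'k set). norm v)"
    by (intro sum_mono component_le_norm_cart)
  then show ?thesis by simp
qed

text \<open>The constant is uniform in the policy, which is what allows one step size and one
  contraction factor for all iterations. The cardinality pays for passing from the 1-norm to the
  Euclidean norm.\<close>

lemma adjoint_mat_lower_bound:
  fixes w :: "real ^ 's::finite"
  assumes \<gamma>: "0 < \<gamma>" "\<gamma> < 1" and \<pi>: "is_policy \<pi>"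
  shows "norm w \<le> real CARD('s) / (1 - \<gamma>) * norm (adjoint_mat P \<gamma> \<pi> *v w)"
proof -
  have "(1 - \<gamma>) * norm w \<le> (1 - \<gamma>) * (\<Sum>s\<in>UNIV. \<bar>w $ s\<bar>)"
    using \<gamma> by (intro mult_left_mono norm_le_l1_cart) auto
  also have "\<dots> \<le> (\<Sum>s\<in>UNIV. \<bar>(adjoint_mat P \<gamma> \<pi> *v w) $ s\<bar>)"
    by (rule adjoint_mat_l1_lower_bound[OF \<gamma>(1) \<pi>])
  also have "\<dots> \<le> real CARD('s) * norm (adjoint_mat P \<gamma> \<pi> *v w)"
    by (rule sum_abs_le_card_norm)
  finally show ?thesis
    using \<gamma> by (simp add: field_simps)
qed

text \<open>The transposed adjoint matrix is the identity minus \<gamma> times a row-stochastic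
  matrix, so it at most doubles the sup norm.\<close>

lemma transpose_adjoint_mat_bound:
  fixes v :: "real ^ 's::finite"
  assumes \<gamma>: "0 < \<gamma>" "\<gamma> < 1" and \<pi>: "is_policy \<pi>"
  shows "norm (transpose (adjoint_mat P \<gamma> \<pi>) *v v) \<le> real CARD('s) * 2 * norm v"
proof -
  have "infnorm (transpose (adjoint_mat P \<gamma> \<pi>) *v v) \<le> 2 * norm v"
    unfolding infnorm_le_iff
  proof
    fix s
    have "\<bar>\<Sum>s'\<in>UNIV. policy_trans P \<pi> $ s $ s' * v $ s'\<bar> \<le> (\<Sum>s'\<in>UNIV. policy_trans P \<pi> $ s $ s' * norm v)"
      using policy_trans_nonneg[OF \<pi>] component_le_norm_cart[of v]
      by (intro order_trans[OF sum_abs] sum_mono) (auto simp: abs_mult mult_left_mono)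
    also have "\<dots> = norm v"
      unfolding sum_distrib_right[symmetric] policy_trans_row_sum[OF \<pi>] by simp
    finally have "\<bar>\<gamma> * (\<Sum>s'\<in>UNIV. policy_trans P \<pi> $ s $ s' * v $ s')\<bar> \<le> 1 * norm v"
      unfolding abs_mult using \<gamma> by (intro mult_mono) auto
    then show "\<bar>(transpose (adjoint_mat P \<gamma> \<pi>) *v v) $ s\<bar> \<le> 2 * norm v"
      unfolding transpose_adjoint_mat_mult_component using component_le_norm_cart[of v s] by linarith
  qed
  then show ?thesis
    using order_trans[OF norm_le_card_infnorm mult_left_mono] by fastforce
qed

text \<open>For a policy the solution exists and is unique, because the square matrix is injective
  by the lower bound. Later estimates use only the equation and that bound.\<close>

definition adjoint_solve ::
  "('s::finite \<Rightarrow> 'a::finite \<Rightarrow> 's pmf) \<Rightarrow> real \<Rightarrow> real ^ ('s \<times> 'a) \<Rightarrow> real ^ 's \<Rightarrow> real ^ 's"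
  where "adjoint_solve P \<gamma> \<pi> b = (SOME w. adjoint_mat P \<gamma> \<pi> *v w = b)"

lemma adjoint_solve:
  assumes \<gamma>: "0 < \<gamma>" "\<gamma> < 1" and \<pi>: "is_policy \<pi>"
  shows "adjoint_mat P \<gamma> \<pi> *v adjoint_solve P \<gamma> \<pi> b = b"
proof -
  have "inj ((*v) (adjoint_mat P \<gamma> \<pi>))"
  proof (rule injI)
    fix x y assume "adjoint_mat P \<gamma> \<pi> *v x = adjoint_mat P \<gamma> \<pi> *v y"
    then have "norm (x - y) \<le> 0"
      using adjoint_mat_lower_bound[OF \<gamma> \<pi>, of "x - y" P] by (simp add: matrix_vector_mult_diff_distrib)
    then show "x = y" by simp
  qed
  then have "surj ((*v) (adjoint_mat P \<gamma> \<pi>))"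
    by (rule linear_injective_imp_surjective[OF matrix_vector_mul_linear _ refl])
  then have "\<exists>w. adjoint_mat P \<gamma> \<pi> *v w = b"
    unfolding surj_def by metis
  then show ?thesis
    unfolding adjoint_solve_def by (rule someI_ex)
qed

text \<open>A gradient step for half the squared residual. With \<open>u\<close> the error, the
  cross term contributes \<open>- 2 * \<eta>\<close> times the squared norm of
  \<open>A *v u\<close>; the quadratic term gives back at most half of it since
  \<open>\<eta> * B\<^sup>2 \<le> 1\<close>, and the lower bound turns the rest into a multiple of
  the squared error.\<close>

lemma least_squares_step_contraction:
  fixes A :: "real ^ 'n ^ 'm"
  assumes low: "\<And>v. norm v \<le> \<kappa> * norm (A *v v)" and up: "\<And>v. norm (transpose A *v v) \<le> B * norm v"
    and \<kappa>: "0 < \<kappa>" and \<eta>: "0 < \<eta>" "\<eta> * B\<^sup>2 \<le> 1" "\<eta> \<le> \<kappa>\<^sup>2" and b: "A *v w\<^sub>0 = b"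
  shows "norm (w - \<eta> *\<^sub>R (transpose A *v (A *v w) - transpose A *v b) - w\<^sub>0) \<le> sqrt (1 - \<eta> / \<kappa>\<^sup>2) * norm (w - w\<^sub>0)"
proof -
  define u where "u = w - w\<^sub>0"
  let ?y = "A *v u"
  have eq: "w - \<eta> *\<^sub>R (transpose A *v (A *v w) - transpose A *v b) - w\<^sub>0 = u - \<eta> *\<^sub>R (transpose A *v ?y)"
    by (simp add: u_def b[symmetric] matrix_vector_mult_diff_distrib)
  have "(norm (u - \<eta> *\<^sub>R (transpose A *v ?y)))\<^sup>2
      = (norm u)\<^sup>2 - 2 * \<eta> * (u \<bullet> (transpose A *v ?y)) + \<eta>\<^sup>2 * (norm (transpose A *v ?y))\<^sup>2"
    unfolding power2_norm_eq_inner
    by (simp only: inner_diff inner_scaleR_left inner_scaleR_right inner_commute[of "transpose A *v ?y" u])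
      (simp add: algebra_simps power2_eq_square)
  also have "u \<bullet> (transpose A *v ?y) = (norm ?y)\<^sup>2"
    using dot_lmul_matrix[of ?y A u] by (simp add: inner_commute[of u] power2_norm_eq_inner)
  also have "(norm u)\<^sup>2 - 2 * \<eta> * (norm ?y)\<^sup>2 + \<eta>\<^sup>2 * (norm (transpose A *v ?y))\<^sup>2
      \<le> (norm u)\<^sup>2 - 2 * \<eta> * (norm ?y)\<^sup>2 + \<eta> * (norm ?y)\<^sup>2"
  proof -
    have "(norm (transpose A *v ?y))\<^sup>2 \<le> (B * norm ?y)\<^sup>2"
      by (intro power_mono up) auto
    then have "\<eta>\<^sup>2 * (norm (transpose A *v ?y))\<^sup>2 \<le> \<eta> * ((\<eta> * B\<^sup>2) * (norm ?y)\<^sup>2)"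
      using \<eta> by (simp add: power2_eq_square algebra_simps mult_left_mono)
    also have "\<dots> \<le> \<eta> * (1 * (norm ?y)\<^sup>2)"
      using \<eta> by (intro mult_left_mono mult_right_mono) auto
    finally show ?thesis by simp
  qed
  also have "(norm u)\<^sup>2 - 2 * \<eta> * (norm ?y)\<^sup>2 + \<eta> * (norm ?y)\<^sup>2 = (norm u)\<^sup>2 - \<eta> * (norm ?y)\<^sup>2"
    by simp
  also have "\<dots> \<le> (1 - \<eta> / \<kappa>\<^sup>2) * (norm u)\<^sup>2"
  proof -
    have "(norm u)\<^sup>2 \<le> (\<kappa> * norm ?y)\<^sup>2"
      by (intro power_mono low) auto
    then have "(norm u)\<^sup>2 / \<kappa>\<^sup>2 \<le> (norm ?y)\<^sup>2"
      using \<kappa> by (simp add: field_simps)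
    then have "\<eta> * ((norm u)\<^sup>2 / \<kappa>\<^sup>2) \<le> \<eta> * (norm ?y)\<^sup>2"
      using \<eta> by (intro mult_left_mono) auto
    then show ?thesis
      by (simp add: algebra_simps)
  qed
  finally have "sqrt ((norm (u - \<eta> *\<^sub>R (transpose A *v ?y)))\<^sup>2) \<le> sqrt ((1 - \<eta> / \<kappa>\<^sup>2) * (norm u)\<^sup>2)"
    by (rule real_sqrt_le_mono)
  then show ?thesis
    unfolding eq by (simp add: real_sqrt_mult u_def)
qed

section \<open>The hyper-gradient\<close>

lemma gradient_unique:
  assumes "GDERIV g x :> D"
  shows "gradient g x = D"
  unfolding gradient_def
proof (rule the_equality)
  show "GDERIV g x :> D" by (rule assms)
next
  fix D' assume "GDERIV g x :> D'"
  then have "(\<lambda>h. h \<bullet> D') = (\<lambda>h. h \<bullet> D)"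
    using assms has_derivative_unique unfolding gderiv_def by blast
  then have "(D' - D) \<bullet> (D' - D) = 0"
    by (simp add: fun_eq_iff inner_diff_right)
  then show "D' = D" by simp
qed

lemma GDERIV_gradient:
  fixes g :: "'v::euclidean_space \<Rightarrow> real"
  assumes "g differentiable (at x)"
  shows "GDERIV g x :> gradient g x"
proof -
  obtain g' where g': "(g has_derivative g') (at x)"
    using assms by (auto simp: differentiable_def)
  then have "g' h = h \<bullet> adjoint g' 1" for h
    using adjoint_works[OF has_derivative_linear[OF g'], of h 1] by simp
  then have "GDERIV g x :> adjoint g' 1"
    unfolding gderiv_def using g' by (simp add: has_derivative_eq_rhs fun_eq_iff)
  then show ?thesis
    by (simp add: gradient_unique)
qed

lemma gradient_fst_eq:
  fixes g :: "'v::euclidean_space \<times> 'w::euclidean_space \<Rightarrow> real"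
  assumes "g differentiable (at (x, p))"
  shows "gradient_fst g (x, p) = fst (gradient g (x, p))"
proof -
  have "((\<lambda>y. (y, p)) has_derivative (\<lambda>h. (h, 0))) (at x)"
    by (auto intro!: derivative_eq_intros)
  from has_derivative_compose[OF this] GDERIV_gradient[OF assms]
  have "GDERIV (\<lambda>y. g (y, p)) x :> fst (gradient g (x, p))"
    by (fastforce simp: gderiv_def inner_prod_def)
  then show ?thesis
    by (simp add: gradient_fst_def gradient_unique)
qed

lemma gradient_snd_eq:
  fixes g :: "'v::euclidean_space \<times> 'w::euclidean_space \<Rightarrow> real"
  assumes "g differentiable (at (x, p))"
  shows "gradient_snd g (x, p) = snd (gradient g (x, p))"
proof -
  have "((\<lambda>q. (x, q)) has_derivative (\<lambda>h. (0, h))) (at p)"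
    by (auto intro!: derivative_eq_intros)
  from has_derivative_compose[OF this] GDERIV_gradient[OF assms]
  have "GDERIV (\<lambda>q. g (x, q)) p :> snd (gradient g (x, p))"
    by (fastforce simp: gderiv_def inner_prod_def)
  then show ?thesis
    by (simp add: gradient_snd_def gradient_unique)
qed

lemma GDERIV_component:
  fixes r :: "'v::euclidean_space \<Rightarrow> real ^ 'k"
  assumes "r differentiable (at x)"
  shows "GDERIV (\<lambda>y. r y $ i) x :> gradient (\<lambda>y. r y $ i) x"
  using assms by (intro GDERIV_gradient) (auto simp: differentiable_def intro: has_derivative_vec_nth)

lemma jacobian_eqI:
  fixes g :: "real ^ 'n \<Rightarrow> real ^ 'k"
  assumes "\<And>i. GDERIV (\<lambda>y. g y $ i) x :> D i"
  shows "jacobian g (at x) = (\<chi> i. D i)"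
proof -
  have "(g has_derivative (\<lambda>h. (\<chi> i. D i) *v h)) (at x)"
    using assms by (intro has_derivative_cart) (simp add: gderiv_def matrix_vector_mul_component inner_commute)
  then show ?thesis
    unfolding jacobian_def by (metis frechet_derivative_at matrix_of_matrix_vector_mul)
qed

section \<open>The estimator as a sum over state-action pairs\<close>

lemma transpose_rows_mult:
  fixes D :: "'k::finite \<Rightarrow> real ^ 'n"
  shows "transpose (\<chi> i. D i) *v u = (\<Sum>i\<in>UNIV. u $ i *\<^sub>R D i)"
  by (simp add: vec_eq_iff matrix_vector_mult_def transpose_def mult.commute)

lemma diag_mult: "diag v *v u = (\<chi> i. v $ i * u $ i)"
  by (simp add: vec_eq_iff diag_def matrix_vector_mult_def if_distrib[of "\<lambda>x. x * _"] cong: if_cong)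

lemma sum_over_pairs:
  "(\<Sum>s\<in>UNIV. \<Sum>a\<in>UNIV. g (s, a)) = (\<Sum>i\<in>(UNIV :: ('s::finite \<times> 'a::finite) set). g i)"
  by (simp add: sum.cartesian_product UNIV_Times_UNIV[symmetric] del: UNIV_Times_UNIV)

text \<open>When \<open>V\<close> is the log-sum-exp of \<open>Q\<close>, the backup is the
  log-sum-exp of the Bellman update of \<open>Q\<close>. Its parameter gradient therefore carries
  the softmax weights of the updated Q-function, not those of \<open>Q\<close>.\<close>

lemma soft_backup_eq:
  "soft_backup P \<gamma> \<tau> r y (soft_max_value \<tau> Q) = soft_max_value \<tau> (r y + soft_lookahead P \<gamma> \<tau> Q)"
  by (simp add: vec_eq_iff soft_backup_def soft_max_value_def soft_lookahead_def divide_inverse mult.commute)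

definition reward_grad :: "(real ^ 'n \<Rightarrow> real ^ 'k) \<Rightarrow> real ^ 'n \<Rightarrow> 'k \<Rightarrow> real ^ 'n"
  where "reward_grad r x i = gradient (\<lambda>y. r y $ i) x"

text \<open>In this form the estimator is affine in \<open>w\<close>, and its coefficients are
  products of factors that can be bounded one by one. It serves both the identification with the
  exact gradient and the Lipschitz estimates.\<close>

lemma hyper_gradient_est_eq:
  fixes P :: "'s::finite \<Rightarrow> 'a::finite \<Rightarrow> 's pmf" and r :: "real ^ 'n \<Rightarrow> real ^ ('s \<times> 'a)"
  assumes \<tau>: "0 < \<tau>" and r: "\<And>x. r differentiable (at x)" and f: "\<And>z. f differentiable (at z)"
  shows "hyper_gradient_est P \<gamma> \<tau> r f x \<pi> (soft_max_value \<tau> Q) w = fst (gradient f (x, \<pi>)) +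
    (1 / \<tau>) *\<^sub>R (\<Sum>i\<in>UNIV. (\<pi> $ i * snd (gradient f (x, \<pi>)) $ i
      - w $ fst i * softmax ((1 / \<tau>) *\<^sub>R (r x + soft_lookahead P \<gamma> \<tau> Q)) $ i) *\<^sub>R reward_grad r x i)"
proof -
  let ?p = "softmax ((1 / \<tau>) *\<^sub>R (r x + soft_lookahead P \<gamma> \<tau> Q))"
  have J: "jacobian r (at x) = (\<chi> i. reward_grad r x i)"
    unfolding reward_grad_def by (intro jacobian_eqI GDERIV_component r)
  have "GDERIV (\<lambda>y. soft_backup P \<gamma> \<tau> r y (soft_max_value \<tau> Q) $ s) x
      :> (\<Sum>a\<in>UNIV. ?p $ (s, a) *\<^sub>R reward_grad r x (s, a))" for s
  proof -
    have "(r has_derivative (\<lambda>h. jacobian r (at x) *v h)) (at x)"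
      using r jacobian_works by blast
    then have "((\<lambda>y. r y + soft_lookahead P \<gamma> \<tau> Q) has_derivative (\<lambda>h. jacobian r (at x) *v h)) (at x)"
      by (auto intro!: derivative_eq_intros)
    from has_derivative_compose[OF this soft_max_value_has_derivative[OF \<tau>]]
    show ?thesis
      unfolding soft_backup_eq gderiv_def J
      by (rule has_derivative_eq_rhs) (simp add: fun_eq_iff matrix_vector_mul_component inner_sum_right inner_commute)
  qed
  from jacobian_eqI[OF this]
  have "transpose (jacobian (\<lambda>y. soft_backup P \<gamma> \<tau> r y (soft_max_value \<tau> Q)) (at x)) *v w
      = (\<Sum>s\<in>UNIV. \<Sum>a\<in>UNIV. (w $ s * ?p $ (s, a)) *\<^sub>R reward_grad r x (s, a))"
    by (simp add: transpose_rows_mult scaleR_sum_right del: transpose_matrix_vector)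
  also have "\<dots> = (\<Sum>i\<in>UNIV. (w $ fst i * ?p $ i) *\<^sub>R reward_grad r x i)"
    using sum_over_pairs[of "\<lambda>i. (w $ fst i * ?p $ i) *\<^sub>R reward_grad r x i"] by simp
  finally show ?thesis
    by (simp add: hyper_gradient_est_def J transpose_rows_mult diag_mult gradient_fst_eq[OF f] gradient_snd_eq[OF f]
        scaleR_diff_left sum_subtractf scaleR_diff_right del: transpose_matrix_vector)
qed

text \<open>With the normaliser moved into the exponent, the derivative of softmax follows from that
  of log-sum-exp by the chain rule.\<close>

lemma softmax_eq_exp:
  assumes "0 < \<tau>"
  shows "softmax ((1 / \<tau>) *\<^sub>R Q) $ i = exp ((Q $ i - soft_max_value \<tau> Q $ fst i) / \<tau>)"
  using assms exp_sum_pos[of "\<lambda>a. Q $ (fst i, a) / \<tau>"]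
  by (simp add: softmax_def soft_max_value_def diff_divide_distrib exp_diff)

lemma softmax_has_derivative:
  fixes Q :: "real ^ ('s::finite \<times> 'a::finite)"
  assumes \<tau>: "0 < \<tau>"
  defines "p \<equiv> softmax ((1 / \<tau>) *\<^sub>R Q)"
  shows "((\<lambda>Q. softmax ((1 / \<tau>) *\<^sub>R Q)) has_derivative
    (\<lambda>h. \<chi> i. p $ i / \<tau> * (h $ i - (\<Sum>a\<in>UNIV. p $ (fst i, a) * h $ (fst i, a))))) (at Q)"
proof (rule has_derivative_cart)
  fix i :: "'s \<times> 'a"
  have "((\<lambda>Q. (Q $ i - soft_max_value \<tau> Q $ fst i) / \<tau>) has_derivative
      (\<lambda>h. (h $ i - (\<Sum>a\<in>UNIV. p $ (fst i, a) * h $ (fst i, a))) / \<tau>)) (at Q)"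
    unfolding p_def
    by (intro bounded_linear.has_derivative[OF bounded_linear_divide] has_derivative_diff
        has_derivative_vec_nth[OF has_derivative_ident] soft_max_value_has_derivative \<tau>)
  from has_derivative_exp[OF this]
  show "((\<lambda>Q. softmax ((1 / \<tau>) *\<^sub>R Q) $ i) has_derivative
      (\<lambda>h. (\<chi> i. p $ i / \<tau> * (h $ i - (\<Sum>a\<in>UNIV. p $ (fst i, a) * h $ (fst i, a)))) $ i)) (at Q)"
    by (simp add: softmax_eq_exp[OF \<tau>] p_def mult.commute)
qed

definition adjoint_rhs ::
  "('s::finite \<Rightarrow> 'a::finite \<Rightarrow> 's pmf) \<Rightarrow> real \<Rightarrow> real ^ ('s \<times> 'a) \<Rightarrow> real ^ ('s \<times> 'a) \<Rightarrow> real ^ 's"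
  where "adjoint_rhs P \<gamma> \<pi> m = transpose (U_mat P \<gamma>) *v (diag \<pi> *v m)"

text \<open>With V' and Q' the derivatives of the optimal value and Q-function, this formula makes
  Q' - V' equal to the reward derivative minus U V'; this is how \<open>U\<close> enters the
  hyper-gradient.\<close>

lemma U_mat_mult_component:
  "(U_mat P \<gamma> *v v) $ i = v $ fst i - \<gamma> * (\<Sum>s'\<in>UNIV. pmf (P (fst i) (snd i)) s' * v $ s')"
proof -
  have "U_mat P \<gamma> $ i $ s' * v $ s' = (if s' = fst i then v $ s' else 0) - \<gamma> * (pmf (P (fst i) (snd i)) s' * v $ s')" for s'
    by (simp add: U_mat_def algebra_simps)
  then show ?thesis
    by (simp add: matrix_vector_mult_def sum_subtractf sum_distrib_left)
qed

lemma inner_transpose_mult: "(transpose A *v u) \<bullet> v = u \<bullet> (A *v v)"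
  for A :: "real ^ 'n ^ 'm"
  using dot_lmul_matrix[of u A v] by simp

text \<open>The adjoint equation \<open>A w = U\<^sup>T diag(\<pi>) m\<close> eliminates the derivative of the optimal value
  function.\<close>

lemma hyper_objective_GDERIV:
  fixes P :: "'s::finite \<Rightarrow> 'a::finite \<Rightarrow> 's pmf" and r :: "real ^ 'n \<Rightarrow> real ^ ('s \<times> 'a)"
  assumes \<gamma>: "0 < \<gamma>" "\<gamma> < 1" and \<tau>: "0 < \<tau>"
    and r: "\<And>x. r differentiable (at x)" and f: "\<And>z. f differentiable (at z)"
  defines "Qs \<equiv> \<lambda>x. soft_Q P \<gamma> \<tau> (r x)"
  defines "pol \<equiv> \<lambda>x. softmax ((1 / \<tau>) *\<^sub>R Qs x)"
  shows "GDERIV (\<lambda>x. f (x, pol x)) x :> hyper_gradient_est P \<gamma> \<tau> r f x (pol x) (soft_max_value \<tau> (Qs x))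
    (adjoint_solve P \<gamma> (pol x) (adjoint_rhs P \<gamma> (pol x) (snd (gradient f (x, pol x)))))"
proof -
  define \<pi> where "\<pi> = pol x"
  define m where "m = snd (gradient f (x, \<pi>))"
  define w where "w = adjoint_solve P \<gamma> \<pi> (adjoint_rhs P \<gamma> \<pi> m)"
  let ?J = "\<lambda>h i. h \<bullet> reward_grad r x i"
  have \<pi>: "is_policy \<pi>"
    unfolding \<pi>_def pol_def by (rule softmax_is_policy)
  have fixp: "Qs y = r y + soft_lookahead P \<gamma> \<tau> (Qs y)" for y
    unfolding Qs_def by (rule soft_Q_fixpoint[OF \<gamma> \<tau>])
  have "Qs differentiable (at x)"
    unfolding Qs_def using differentiable_chain_at[OF r soft_Q_differentiable[OF \<gamma> \<tau>]] by (simp add: comp_def)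
  then obtain Q' where Q': "(Qs has_derivative Q') (at x)"
    by (auto simp: differentiable_def)
  \<comment> \<open>The gradient of log-sum-exp is the softmax, so the derivative of the optimal
    value is the policy mean of that of the optimal Q-function.\<close>
  define V' where "V' h = (\<chi> s. \<Sum>a\<in>UNIV. \<pi> $ (s, a) * Q' h $ (s, a))" for h
  have V': "((\<lambda>y. soft_max_value \<tau> (Qs y) $ s) has_derivative (\<lambda>h. V' h $ s)) (at x)" for s
    using has_derivative_compose[OF Q' soft_max_value_has_derivative[OF \<tau>, where Q = "Qs x" and s = s]]
    by (simp add: V'_def \<pi>_def pol_def)
  have Q'_eq: "Q' h $ i = ?J h i + \<gamma> * (\<Sum>s'\<in>UNIV. pmf (P (fst i) (snd i)) s' * V' h $ s')" for h i
  proof -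
    have "((\<lambda>y. r y $ i) has_derivative (\<lambda>h. ?J h i)) (at x)"
      using GDERIV_component[OF r] by (simp add: gderiv_def reward_grad_def)
    then have "((\<lambda>y. r y $ i + \<gamma> * (\<Sum>s'\<in>UNIV. pmf (P (fst i) (snd i)) s' * soft_max_value \<tau> (Qs y) $ s'))
        has_derivative (\<lambda>h. ?J h i + \<gamma> * (\<Sum>s'\<in>UNIV. pmf (P (fst i) (snd i)) s' * V' h $ s'))) (at x)"
      by (intro has_derivative_add has_derivative_mult_right has_derivative_sum V')
    moreover have "(\<lambda>y. r y $ i + \<gamma> * (\<Sum>s'\<in>UNIV. pmf (P (fst i) (snd i)) s' * soft_max_value \<tau> (Qs y) $ s')) = (\<lambda>y. Qs y $ i)"
      by (subst fixp) (simp add: soft_lookahead_def)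
    ultimately show ?thesis
      using has_derivative_unique[OF has_derivative_vec_nth[OF Q', of i]] by (auto simp: fun_eq_iff)
  qed
  have pol': "(pol has_derivative (\<lambda>h. \<chi> i. \<pi> $ i / \<tau> * (Q' h $ i - V' h $ fst i))) (at x)"
    unfolding pol_def using has_derivative_compose[OF Q' softmax_has_derivative[OF \<tau>, where Q = "Qs x"]]
    by (simp add: V'_def \<pi>_def pol_def)
  have pair: "((\<lambda>y. (y, pol y)) has_derivative (\<lambda>h. (h, \<chi> i. \<pi> $ i / \<tau> * (Q' h $ i - V' h $ fst i)))) (at x)"
    by (intro has_derivative_Pair has_derivative_ident pol')
  have "(f has_derivative (\<lambda>h. fst h \<bullet> fst (gradient f (x, \<pi>)) + snd h \<bullet> m)) (at (x, pol x))"
    using GDERIV_gradient[OF f, of "(x, \<pi>)"] by (simp add: gderiv_def \<pi>_def m_def inner_prod_def)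
  from has_derivative_compose[OF pair this] have f': "((\<lambda>y. f (y, pol y)) has_derivative
      (\<lambda>h. h \<bullet> fst (gradient f (x, \<pi>)) + (\<chi> i. \<pi> $ i / \<tau> * (Q' h $ i - V' h $ fst i)) \<bullet> m)) (at x)"
    by simp
  have adj: "(diag \<pi> *v m) \<bullet> (U_mat P \<gamma> *v V' h) = (\<Sum>i\<in>UNIV. w $ fst i * \<pi> $ i * ?J h i)" for h
  proof -
    have "(diag \<pi> *v m) \<bullet> (U_mat P \<gamma> *v V' h) = (adjoint_mat P \<gamma> \<pi> *v w) \<bullet> V' h"
      unfolding w_def adjoint_solve[OF \<gamma> \<pi>] adjoint_rhs_def inner_transpose_mult ..
    also have "\<dots> = w \<bullet> (transpose (adjoint_mat P \<gamma> \<pi>) *v V' h)"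
      using inner_transpose_mult[of "transpose (adjoint_mat P \<gamma> \<pi>)" w "V' h"] by (simp only: transpose_transpose)
    \<comment> \<open>Averaging \<open>Q'_eq\<close> over the actions in \<open>s\<close> gives a
      linear Bellman equation for \<open>V'\<close>, whose matrix is the transposed adjoint
      matrix.\<close>
    also have "(transpose (adjoint_mat P \<gamma> \<pi>) *v V' h) $ s = (\<Sum>a\<in>UNIV. \<pi> $ (s, a) * ?J h (s, a))" for s
    proof -
      have "V' h $ s = (\<Sum>a\<in>UNIV. \<pi> $ (s, a) * ?J h (s, a)) + (\<Sum>a\<in>UNIV. \<Sum>s'\<in>UNIV. \<gamma> * (\<pi> $ (s, a) * pmf (P s a) s' * V' h $ s'))"
        by (subst V'_def) (simp add: Q'_eq distrib_left sum.distrib sum_distrib_left mult_ac)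
      also have "(\<Sum>a\<in>UNIV. \<Sum>s'\<in>UNIV. \<gamma> * (\<pi> $ (s, a) * pmf (P s a) s' * V' h $ s'))
          = \<gamma> * (\<Sum>s'\<in>UNIV. policy_trans P \<pi> $ s $ s' * V' h $ s')"
        by (subst sum.swap) (simp add: policy_trans_def sum_distrib_left sum_distrib_right)
      finally show ?thesis
        unfolding transpose_adjoint_mat_mult_component by simp
    qed
    then have "w \<bullet> (transpose (adjoint_mat P \<gamma> \<pi>) *v V' h) = (\<Sum>s\<in>UNIV. \<Sum>a\<in>UNIV. w $ s * \<pi> $ (s, a) * ?J h (s, a))"
      unfolding inner_vec_def by (simp add: sum_distrib_left mult.assoc)
    finally show ?thesis
      using sum_over_pairs[of "\<lambda>i. w $ fst i * \<pi> $ i * ?J h i"] by simp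
  qed
  \<comment> \<open>By the fixed point equation the softmax weights of the updated Q-function are
    the policy itself.\<close>
  have est: "hyper_gradient_est P \<gamma> \<tau> r f x \<pi> (soft_max_value \<tau> (Qs x)) w = fst (gradient f (x, \<pi>)) +
    (1 / \<tau>) *\<^sub>R (\<Sum>i\<in>UNIV. (\<pi> $ i * m $ i - w $ fst i * \<pi> $ i) *\<^sub>R reward_grad r x i)"
    unfolding hyper_gradient_est_eq[OF \<tau> r f] fixp[symmetric] m_def by (simp add: \<pi>_def pol_def)
  have "(\<chi> i. \<pi> $ i / \<tau> * (Q' h $ i - V' h $ fst i)) \<bullet> m
      = (1 / \<tau>) * (\<Sum>i\<in>UNIV. (\<pi> $ i * m $ i - w $ fst i * \<pi> $ i) * ?J h i)" for h
  proof -
    have "(\<chi> i. \<pi> $ i / \<tau> * (Q' h $ i - V' h $ fst i)) \<bullet> m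
        = (\<Sum>i\<in>UNIV. (1 / \<tau>) * (\<pi> $ i * m $ i * ?J h i - (diag \<pi> *v m) $ i * (U_mat P \<gamma> *v V' h) $ i))"
      unfolding inner_vec_def[where y = m] by (intro sum.cong refl) (simp add: Q'_eq U_mat_mult_component diag_mult algebra_simps)
    also have "\<dots> = (1 / \<tau>) * ((\<Sum>i\<in>UNIV. \<pi> $ i * m $ i * ?J h i) - (diag \<pi> *v m) \<bullet> (U_mat P \<gamma> *v V' h))"
      by (simp only: sum_distrib_left[symmetric] sum_subtractf inner_vec_def[where x = "diag \<pi> *v m"] inner_real_def)
    finally show ?thesis
      by (simp add: adj left_diff_distrib sum_subtractf)
  qed
  then have "h \<bullet> fst (gradient f (x, \<pi>)) + (\<chi> i. \<pi> $ i / \<tau> * (Q' h $ i - V' h $ fst i)) \<bullet> m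
      = h \<bullet> hyper_gradient_est P \<gamma> \<tau> r f x \<pi> (soft_max_value \<tau> (Qs x)) w" for h
    by (simp add: est inner_add_right inner_sum_right)
  then show ?thesis
    using f' unfolding gderiv_def by (simp add: \<pi>_def m_def w_def)
qed

section \<open>Inexact gradient descent\<close>

text \<open>The mean value theorem evaluates the gradient at a single point of the segment, no
  farther from \<open>x\<close> than \<open>y\<close> is; this gives the constant \<open>L\<close>
  in place of half of it.\<close>

lemma descent_lemma:
  fixes F :: "'v::euclidean_space \<Rightarrow> real"
  assumes grad: "\<And>x. GDERIV F x :> G x"
    and Lip: "\<And>x y. norm (G x - G y) \<le> L * norm (x - y)"
  shows "F y \<le> F x + G x \<bullet> (y - x) + L * (norm (y - x))\<^sup>2"
proof -
  have "\<exists>t\<in>{0<..<1}. F (x + 1 *\<^sub>R (y - x)) - F (x + 0 *\<^sub>R (y - x)) = ((1 - 0) *\<^sub>R (y - x)) \<bullet> G (x + t *\<^sub>R (y - x))"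
  proof (rule mvt_simple)
    fix t :: real
    have "((\<lambda>t. x + t *\<^sub>R (y - x)) has_derivative (\<lambda>h. h *\<^sub>R (y - x))) (at t within {0..1})"
      by (auto intro!: derivative_eq_intros)
    from has_derivative_in_compose[OF this, of F "\<lambda>h. h \<bullet> G (x + t *\<^sub>R (y - x))"]
    show "((\<lambda>t. F (x + t *\<^sub>R (y - x))) has_derivative (\<lambda>h. (h *\<^sub>R (y - x)) \<bullet> G (x + t *\<^sub>R (y - x)))) (at t within {0..1})"
      using grad[of "x + t *\<^sub>R (y - x)"] has_derivative_at_withinI by (auto simp: gderiv_def)
  qed simp
  then obtain t where t: "0 < t" "t < 1" and eq: "F y - F x = (y - x) \<bullet> G (x + t *\<^sub>R (y - x))"
    by auto
  have "F y - F x - G x \<bullet> (y - x) = (y - x) \<bullet> (G (x + t *\<^sub>R (y - x)) - G x)"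
    by (simp add: eq inner_diff_right inner_commute)
  also have "\<dots> \<le> norm (y - x) * norm (G (x + t *\<^sub>R (y - x)) - G x)"
    by (rule norm_cauchy_schwarz)
  also have "\<dots> \<le> norm (y - x) * (L * norm (y - x))"
  proof (rule mult_left_mono)
    have "0 \<le> L * norm (y - x)"
      using Lip[of y x] norm_ge_zero order_trans by blast
    then have "t * (L * norm (y - x)) \<le> 1 * (L * norm (y - x))"
      using t by (intro mult_right_mono) auto
    then show "norm (G (x + t *\<^sub>R (y - x)) - G x) \<le> L * norm (y - x)"
      using Lip[of "x + t *\<^sub>R (y - x)" x] t by (simp add: mult.left_commute)
  qed simp
  finally show ?thesis
    by (simp add: power2_eq_square algebra_simps)
qed

text \<open>\<open>c\<close> is chosen so that the gain \<open>c * (1 - \<theta>)\<close> from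
  contracting the squared error equals \<open>C\<^sup>2 / 2\<close>, the weight with which the
  squared error spoils the inner product of \<open>v\<close> and \<open>g\<close>.\<close>

lemma inexact_descent_step:
  fixes v g :: "'v::real_inner"
  assumes \<beta>: "0 < \<beta>" "\<beta> \<le> 1" and L: "0 \<le> L" and \<theta>: "0 \<le> \<theta>" "\<theta> < 1" and D: "0 \<le> D" and \<Delta>: "0 \<le> \<Delta>" "0 \<le> \<Delta>'"
    and F: "F' \<le> F - \<beta> * (v \<bullet> g) + L * \<beta>\<^sup>2 * (norm g)\<^sup>2"
    and err: "norm (v - g) \<le> C * \<Delta>"
    and rec: "\<Delta>' \<le> \<theta> * \<Delta> + D * \<beta> * norm g"
  defines "c \<equiv> C\<^sup>2 / (2 * (1 - \<theta>))"
  assumes small: "\<beta> * (L + c * D\<^sup>2 / (1 - \<theta>)) \<le> 1 / 2"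
  shows "\<beta> / 2 * (norm v)\<^sup>2 \<le> (F + c * \<beta> * \<Delta>\<^sup>2) - (F' + c * \<beta> * \<Delta>'\<^sup>2)"
proof -
  have c: "0 \<le> c" "c * (1 - \<theta>) = C\<^sup>2 / 2"
    using \<theta> by (auto simp: c_def field_simps)
  define Y where "Y = c * D\<^sup>2 / (1 - \<theta>)"
  have Y: "0 \<le> Y"
    using c \<theta> by (simp add: Y_def)
  let ?b = "D * \<beta> * norm g"
  have "\<Delta>'\<^sup>2 \<le> (\<theta> * \<Delta> + ?b)\<^sup>2"
    using rec \<Delta> by (intro power_mono) auto
  \<comment> \<open>Convexity of the square with weights \<theta> and \<open>1 - \<theta>\<close>,
    applied to \<Delta> and the drift divided by \<open>1 - \<theta>\<close>.\<close>
  also have "\<dots> \<le> \<theta> * \<Delta>\<^sup>2 + ?b\<^sup>2 / (1 - \<theta>)"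
  proof -
    have "(1 - \<theta>) * (\<theta> * \<Delta>\<^sup>2) + ?b\<^sup>2 - (1 - \<theta>) * (\<theta> * \<Delta> + ?b)\<^sup>2 = \<theta> * ((1 - \<theta>) * \<Delta> - ?b)\<^sup>2"
      by (simp add: power2_eq_square algebra_simps)
    moreover have "0 \<le> \<theta> * ((1 - \<theta>) * \<Delta> - ?b)\<^sup>2"
      using \<theta> by simp
    ultimately have "(1 - \<theta>) * (\<theta> * \<Delta> + ?b)\<^sup>2 \<le> (1 - \<theta>) * (\<theta> * \<Delta>\<^sup>2) + ?b\<^sup>2" by linarith
    then show ?thesis
      using \<theta> by (simp add: field_simps)
  qed
  finally have "c * \<beta> * \<Delta>'\<^sup>2 \<le> c * \<beta> * (\<theta> * \<Delta>\<^sup>2 + ?b\<^sup>2 / (1 - \<theta>))"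
    using c \<beta> by (intro mult_left_mono) auto
  then have \<Delta>2: "c * \<beta> * \<Delta>'\<^sup>2 \<le> c * \<beta> * \<Delta>\<^sup>2 - \<beta> * (C\<^sup>2 / 2) * \<Delta>\<^sup>2 + \<beta>\<^sup>2 * (\<beta> * Y) * (norm g)\<^sup>2"
    unfolding c(2)[symmetric] by (simp add: Y_def power2_eq_square algebra_simps)
  \<comment> \<open>Expanding the square bounds the inner product from below and leaves \<beta>/2
    times the squared norm of \<open>g\<close> to spare.\<close>
  have "(norm (v - g))\<^sup>2 \<le> (C * \<Delta>)\<^sup>2"
    using err by (intro power_mono) auto
  then have "(norm v)\<^sup>2 + (norm g)\<^sup>2 - 2 * (v \<bullet> g) \<le> C\<^sup>2 * \<Delta>\<^sup>2"
    by (simp add: power2_norm_eq_inner inner_diff inner_commute power_mult_distrib algebra_simps)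
  then have "\<beta> / 2 * ((norm v)\<^sup>2 + (norm g)\<^sup>2 - 2 * (v \<bullet> g)) \<le> \<beta> / 2 * (C\<^sup>2 * \<Delta>\<^sup>2)"
    using \<beta> by (intro mult_left_mono) auto
  then have inner: "\<beta> / 2 * (norm v)\<^sup>2 + \<beta> / 2 * (norm g)\<^sup>2 - \<beta> * (C\<^sup>2 / 2) * \<Delta>\<^sup>2 \<le> \<beta> * (v \<bullet> g)"
    by (simp add: algebra_simps)
  \<comment> \<open>The spare term must pay for curvature and drift together;
    \<open>\<beta> \<le> 1\<close> reduces the cubic drift term to a quadratic one.\<close>
  have "L * \<beta>\<^sup>2 + \<beta>\<^sup>2 * (\<beta> * y) \<le> \<beta> / 2" if y: "0 \<le> y" "\<beta> * (L + y) \<le> 1 / 2" for y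
  proof -
    have "\<beta>\<^sup>2 * (\<beta> * y) \<le> \<beta>\<^sup>2 * (1 * y)"
      using \<beta> y by (intro mult_left_mono mult_right_mono) auto
    moreover have "\<beta> * (\<beta> * (L + y)) \<le> \<beta> * (1 / 2)"
      using y \<beta> by (intro mult_left_mono) auto
    ultimately show ?thesis
      by (simp add: power2_eq_square algebra_simps)
  qed
  from this[OF Y] small have "L * \<beta>\<^sup>2 + \<beta>\<^sup>2 * (\<beta> * Y) \<le> \<beta> / 2"
    by (simp add: Y_def)
  then have "(L * \<beta>\<^sup>2 + \<beta>\<^sup>2 * (\<beta> * Y)) * (norm g)\<^sup>2 \<le> \<beta> / 2 * (norm g)\<^sup>2"
    by (intro mult_right_mono) auto
  with F \<Delta>2 inner show ?thesis
    by (simp only: distrib_right)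
qed

text \<open>\<beta> is produced before the sequences, so one step size serves every run. Only the
  bound \<open>S\<close> depends on the run, through its Lyapunov value at time
  \<open>m\<close>.\<close>

lemma inexact_gradient_descent:
  fixes F :: "'v::euclidean_space \<Rightarrow> real"
  assumes grad: "\<And>x. GDERIV F x :> G x"
    and Lip: "\<And>x y. norm (G x - G y) \<le> L * norm (x - y)"
    and bdd: "bdd_below (range F)"
    and L: "0 \<le> L" and \<theta>: "0 \<le> \<theta>" "\<theta> < 1" and D: "0 \<le> D"
  obtains \<beta> where "0 < \<beta>"
    and "\<And>x g \<Delta> m. \<lbrakk>\<And>k. k \<ge> m \<Longrightarrow> x (Suc k) = x k - \<beta> *\<^sub>R g k;
        \<And>k. k \<ge> m \<Longrightarrow> norm (G (x k) - g k) \<le> C * \<Delta> k;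
        \<And>k. k \<ge> m \<Longrightarrow> \<Delta> (Suc k) \<le> \<theta> * \<Delta> k + D * norm (x (Suc k) - x k);
        \<And>k. 0 \<le> \<Delta> k\<rbrakk>
      \<Longrightarrow> \<exists>S. \<forall>n. (\<Sum>k=m..<n. (norm (G (x k)))\<^sup>2) \<le> S"
proof -
  define c where "c = C\<^sup>2 / (2 * (1 - \<theta>))"
  define Z where "Z = L + c * D\<^sup>2 / (1 - \<theta>)"
  \<comment> \<open>The summand 1 keeps \<beta> below 1, and the factor 2 gives
    \<open>\<beta> * Z \<le> 1 / 2\<close>.\<close>
  define \<beta> where "\<beta> = 1 / (2 * (1 + Z))"
  have c: "0 \<le> c" and Z: "0 \<le> Z"
    using \<theta> L by (auto simp: c_def Z_def)
  have \<beta>: "0 < \<beta>" "\<beta> \<le> 1" "\<beta> * Z \<le> 1 / 2"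
    using Z by (auto simp: \<beta>_def divide_simps)
  obtain B where B: "\<And>x. B \<le> F x"
    using bdd by (auto simp: bdd_below_def)
  show thesis
  proof (rule that[OF \<beta>(1)])
    fix x g :: "nat \<Rightarrow> 'v" and \<Delta> :: "nat \<Rightarrow> real" and m :: nat
    assume step: "\<And>k. k \<ge> m \<Longrightarrow> x (Suc k) = x k - \<beta> *\<^sub>R g k"
      and err: "\<And>k. k \<ge> m \<Longrightarrow> norm (G (x k) - g k) \<le> C * \<Delta> k"
      and rec: "\<And>k. k \<ge> m \<Longrightarrow> \<Delta> (Suc k) \<le> \<theta> * \<Delta> k + D * norm (x (Suc k) - x k)"
      and \<Delta>: "\<And>k. 0 \<le> \<Delta> k"
    define W where "W k = F (x k) + c * \<beta> * (\<Delta> k)\<^sup>2" for k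
    have decr: "\<beta> / 2 * (norm (G (x k)))\<^sup>2 \<le> W k - W (Suc k)" if k: "k \<ge> m" for k
      unfolding W_def c_def
    proof (rule inexact_descent_step[OF \<beta>(1,2) L \<theta> D \<Delta> \<Delta> _ err[OF k]])
      show "F (x (Suc k)) \<le> F (x k) - \<beta> * (G (x k) \<bullet> g k) + L * \<beta>\<^sup>2 * (norm (g k))\<^sup>2"
        using descent_lemma[OF grad Lip, of "x (Suc k)" "x k"] \<beta>
        by (simp add: step[OF k] power_mult_distrib)
      show "\<Delta> (Suc k) \<le> \<theta> * \<Delta> k + D * \<beta> * norm (g k)"
        using rec[OF k] \<beta> by (simp add: step[OF k])
      show "\<beta> * (L + C\<^sup>2 / (2 * (1 - \<theta>)) * D\<^sup>2 / (1 - \<theta>)) \<le> 1 / 2"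
        using \<beta>(3) by (simp add: Z_def c_def)
    qed
    have tel: "\<beta> / 2 * (\<Sum>k=m..<n. (norm (G (x k)))\<^sup>2) \<le> W m - W n" if "m \<le> n" for n
      using that
    proof (induction n rule: dec_induct)
      case (step n)
      then show ?case
        using decr[of n] by (simp add: distrib_left)
    qed simp
    have "(\<Sum>k=m..<n. (norm (G (x k)))\<^sup>2) \<le> (W m - B) * 2 / \<beta>" for n
    proof (cases "m \<le> n")
      case True
      have "B \<le> W n"
        using B[of "x n"] c \<beta> by (simp add: W_def add_increasing2)
      then have "\<beta> / 2 * (\<Sum>k=m..<n. (norm (G (x k)))\<^sup>2) \<le> W m - B"
        using tel[OF True] by simp
      then show ?thesis
        using \<beta> by (simp add: field_simps)
    next
      case False
      have "B \<le> W m"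
        using B[of "x m"] c \<beta> by (simp add: W_def add_increasing2)
      then show ?thesis
        using False \<beta> by simp
    qed
    then show "\<exists>S. \<forall>n. (\<Sum>k=m..<n. (norm (G (x k)))\<^sup>2) \<le> S" by blast
  qed
qed

text \<open>The weight \<open>M\<close> absorbs the forcing of \<open>e\<close> by \<open>q\<close> into the slack \<open>1 - \<gamma>\<close> of the recursion for \<open>q\<close>.\<close>

lemma coupled_contraction:
  fixes \<gamma> \<sigma> C :: real
  assumes \<gamma>: "0 \<le> \<gamma>" "\<gamma> < 1" and \<sigma>: "0 \<le> \<sigma>" "\<sigma> < 1" and C: "0 \<le> C"
  obtains \<theta> M D where "0 \<le> \<theta>" "\<theta> < 1" "1 \<le> M" "0 \<le> D"
    and "\<And>e q e' q' d. \<lbrakk>0 \<le> e; 0 \<le> q; 0 \<le> d; e' \<le> \<sigma> * e + C * (q + d); q' \<le> \<gamma> * q + C * d\<rbrakk>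
      \<Longrightarrow> e' + M * q' \<le> \<theta> * (e + M * q) + D * d"
proof -
  define M where "M = 1 + 2 * C / (1 - \<gamma>)"
  \<comment> \<open>Half of the slack \<open>1 - \<gamma>\<close> pays for the forcing of
    \<open>e\<close> by \<open>q\<close>; the other half remains as contraction of
    \<open>q\<close>.\<close>
  define \<theta> where "\<theta> = max \<sigma> ((1 + \<gamma>) / 2)"
  define D where "D = C + M * C"
  have M: "1 \<le> M" "C + M * \<gamma> \<le> M * ((1 + \<gamma>) / 2)"
  proof -
    have "M * ((1 - \<gamma>) / 2) = (1 - \<gamma>) / 2 + C"
      using \<gamma> by (simp add: M_def field_simps)
    then have "C \<le> M * ((1 - \<gamma>) / 2)"
      using \<gamma> by simp
    then show "C + M * \<gamma> \<le> M * ((1 + \<gamma>) / 2)"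
      by (simp add: field_simps)
  qed (use \<gamma> C in \<open>auto simp: M_def\<close>)
  show thesis
  proof (rule that)
    show "0 \<le> \<theta>" "\<theta> < 1" "1 \<le> M" "0 \<le> D"
      using \<gamma> \<sigma> M C by (auto simp: \<theta>_def D_def)
    fix e q e' q' d :: real
    assume *: "0 \<le> e" "0 \<le> q" "0 \<le> d" "e' \<le> \<sigma> * e + C * (q + d)" "q' \<le> \<gamma> * q + C * d"
    have "M * q' \<le> M * (\<gamma> * q + C * d)"
      using * M by (intro mult_left_mono) auto
    moreover have "\<sigma> * e \<le> \<theta> * e"
      using * by (intro mult_right_mono) (auto simp: \<theta>_def)
    moreover have "(C + M * \<gamma>) * q \<le> (M * \<theta>) * q"
      using * M by (intro mult_right_mono order_trans[OF M(2)] mult_left_mono) (auto simp: \<theta>_def)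
    ultimately show "e' + M * q' \<le> \<theta> * (e + M * q) + D * d"
      using *(4) by (simp add: D_def algebra_simps)
  qed
qed

section \<open>Lipschitz estimates\<close>

definition lip :: "'m::metric_space set \<Rightarrow> ('m \<Rightarrow> 'v::real_normed_vector) \<Rightarrow> bool"
  where "lip S g \<longleftrightarrow> (\<exists>C. \<forall>y\<in>S. \<forall>z\<in>S. norm (g y - g z) \<le> C * dist y z)"

text \<open>Bounded Lipschitz maps are closed under products, Lipschitz maps are not. The parameter
  gradient of \<open>f\<close> has no assumed bound and enters the estimator only as a summand, so
  plain \<open>lip\<close> suffices for it.\<close>

definition blip :: "'m::metric_space set \<Rightarrow> ('m \<Rightarrow> 'v::real_normed_vector) \<Rightarrow> bool"
  where "blip S g \<longleftrightarrow> lip S g \<and> (\<exists>C. \<forall>z\<in>S. norm (g z) \<le> C)"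

lemma lipI: "(\<And>y z. y \<in> S \<Longrightarrow> z \<in> S \<Longrightarrow> norm (g y - g z) \<le> C * dist y z) \<Longrightarrow> lip S g"
  unfolding lip_def by blast

lemma lipE:
  assumes "lip S g"
  obtains C where "0 \<le> C" "\<And>y z. y \<in> S \<Longrightarrow> z \<in> S \<Longrightarrow> norm (g y - g z) \<le> C * dist y z"
proof -
  obtain C where C: "\<And>y z. y \<in> S \<Longrightarrow> z \<in> S \<Longrightarrow> norm (g y - g z) \<le> C * dist y z"
    using assms unfolding lip_def by blast
  have "norm (g y - g z) \<le> \<bar>C\<bar> * dist y z" if "y \<in> S" "z \<in> S" for y z
    using C[OF that] by (rule order_trans) (intro mult_right_mono, auto)
  then show thesis
    by (intro that[of "\<bar>C\<bar>"]) auto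
qed

lemma blipI:
  "lip S g \<Longrightarrow> (\<And>z. z \<in> S \<Longrightarrow> norm (g z) \<le> C) \<Longrightarrow> blip S g"
  unfolding blip_def by blast

lemma blipE:
  assumes "blip S g"
  obtains C where "0 \<le> C" "\<And>z. z \<in> S \<Longrightarrow> norm (g z) \<le> C"
    "\<And>y z. y \<in> S \<Longrightarrow> z \<in> S \<Longrightarrow> norm (g y - g z) \<le> C * dist y z"
proof -
  obtain B where B: "\<And>z. z \<in> S \<Longrightarrow> norm (g z) \<le> B"
    using assms unfolding blip_def by blast
  obtain C where C: "0 \<le> C" "\<And>y z. y \<in> S \<Longrightarrow> z \<in> S \<Longrightarrow> norm (g y - g z) \<le> C * dist y z"
    using assms lipE unfolding blip_def by blast
  have "norm (g y - g z) \<le> max B C * dist y z" if "y \<in> S" "z \<in> S" for y z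
    using C(2)[OF that] by (rule order_trans) (intro mult_right_mono, auto)
  then show thesis
    using B C(1) by (intro that[of "max B C"]) (auto simp: le_max_iff_disj)
qed

lemma blip_imp_lip: "blip S g \<Longrightarrow> lip S g"
  by (simp add: blip_def)

lemma lip_add:
  assumes "lip S g" "lip S h"
  shows "lip S (\<lambda>z. g z + h z)"
proof -
  obtain C D where "\<And>y z. y \<in> S \<Longrightarrow> z \<in> S \<Longrightarrow> norm (g y - g z) \<le> C * dist y z"
    "\<And>y z. y \<in> S \<Longrightarrow> z \<in> S \<Longrightarrow> norm (h y - h z) \<le> D * dist y z"
    using assms unfolding lip_def by blast
  then show ?thesis
    by (intro lipI[of S _ "C + D"]) (simp add: add_diff_add distrib_right norm_triangle_mono)
qed

lemma blip_add:
  assumes "blip S g" "blip S h"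
  shows "blip S (\<lambda>z. g z + h z)"
proof -
  obtain C D where "\<And>z. z \<in> S \<Longrightarrow> norm (g z) \<le> C" "\<And>z. z \<in> S \<Longrightarrow> norm (h z) \<le> D"
    using assms unfolding blip_def by blast
  then show ?thesis
    using assms by (intro blipI[of S _ "C + D"] lip_add) (auto simp: blip_def norm_triangle_mono)
qed

lemma blip_const: "blip S (\<lambda>_. c)"
  by (intro blipI[of S _ "norm c"] lipI[of S _ 0]) auto

lemma blip_sum:
  assumes "\<And>i. i \<in> I \<Longrightarrow> blip S (g i)"
  shows "blip S (\<lambda>z. \<Sum>i\<in>I. g i z)"
  using assms by (induction I rule: infinite_finite_induct) (auto intro: blip_const blip_add)

lemma blip_scaleR:
  assumes "blip S c" "blip S g"
  shows "blip S (\<lambda>z. c z *\<^sub>R g z)"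
proof -
  obtain C where C: "0 \<le> C" "\<And>z. z \<in> S \<Longrightarrow> norm (c z) \<le> C"
    "\<And>y z. y \<in> S \<Longrightarrow> z \<in> S \<Longrightarrow> norm (c y - c z) \<le> C * dist y z"
    using assms(1) by (rule blipE) blast
  obtain D where D: "0 \<le> D" "\<And>z. z \<in> S \<Longrightarrow> norm (g z) \<le> D"
    "\<And>y z. y \<in> S \<Longrightarrow> z \<in> S \<Longrightarrow> norm (g y - g z) \<le> D * dist y z"
    using assms(2) by (rule blipE) blast
  show ?thesis
  proof (rule blipI[OF lipI])
    fix y z assume yz: "y \<in> S" "z \<in> S"
    have "c y *\<^sub>R g y - c z *\<^sub>R g z = c y *\<^sub>R (g y - g z) + (c y - c z) *\<^sub>R g z"
      by (simp add: algebra_simps)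
    then have "norm (c y *\<^sub>R g y - c z *\<^sub>R g z) \<le> norm (c y) * norm (g y - g z) + norm (c y - c z) * norm (g z)"
      using norm_triangle_ineq[of "c y *\<^sub>R (g y - g z)" "(c y - c z) *\<^sub>R g z"] by simp
    also have "\<dots> \<le> C * (D * dist y z) + C * dist y z * D"
      using C D yz by (intro add_mono mult_mono) auto
    finally show "norm (c y *\<^sub>R g y - c z *\<^sub>R g z) \<le> (2 * C * D) * dist y z"
      by (simp add: algebra_simps)
  next
    fix z assume "z \<in> S"
    then show "norm (c z *\<^sub>R g z) \<le> C * D"
      using C D by (auto intro!: mult_mono)
  qed
qed

lemma blip_mult: "blip S g \<Longrightarrow> blip S h \<Longrightarrow> blip S (\<lambda>z. g z * h z)" for h :: "_ \<Rightarrow> real"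
  using blip_scaleR[of S g h] by simp

lemma blip_diff:
  assumes "blip S g" "blip S h"
  shows "blip S (\<lambda>z. g z - h z)"
  using blip_add[OF assms(1) blip_scaleR[OF blip_const[of S "- 1"] assms(2)]] by simp

lemma blip_component:
  fixes g :: "_ \<Rightarrow> real ^ 'k"
  assumes "blip S g"
  shows "blip S (\<lambda>z. g z $ i)"
proof -
  obtain C where C: "\<And>z. z \<in> S \<Longrightarrow> norm (g z) \<le> C"
    "\<And>y z. y \<in> S \<Longrightarrow> z \<in> S \<Longrightarrow> norm (g y - g z) \<le> C * dist y z"
    using assms by (rule blipE) blast
  show ?thesis
  proof (rule blipI[OF lipI])
    show "norm (g z $ i) \<le> C" if "z \<in> S" for z
      using order_trans[OF component_le_norm_cart C(1)[OF that]] by simp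
    show "norm (g y $ i - g z $ i) \<le> C * dist y z" if "y \<in> S" "z \<in> S" for y z
      using order_trans[OF component_le_norm_cart C(2)[OF that], of i] by simp
  qed
qed

lemma blip_cart:
  fixes g :: "_ \<Rightarrow> real ^ 'k"
  assumes "\<And>i. blip S (\<lambda>z. g z $ i)"
  shows "blip S g"
proof -
  have "g = (\<lambda>z. \<Sum>i\<in>UNIV. (g z $ i) *\<^sub>R axis i 1)"
  proof
    show "g z = (\<Sum>i\<in>UNIV. (g z $ i) *\<^sub>R axis i 1)" for z
      using basis_expansion[of "g z"] by (simp add: scalar_mult_eq_scaleR)
  qed
  moreover have "blip S (\<lambda>z. \<Sum>i\<in>UNIV. (g z $ i) *\<^sub>R axis i (1 :: real))"
    by (intro blip_sum blip_scaleR assms blip_const)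
  ultimately show ?thesis by simp
qed

section \<open>Distances between triples of parameter, policy and Q-function\<close>

lemma dist_Pair_le: "dist (a, b) (c, d) \<le> dist a c + dist b d"
  unfolding dist_Pair_Pair using sqrt_sum_squares_le_sum[of "dist a c" "dist b d"] by simp

lemma norm_fst_le_norm: "norm (fst z) \<le> norm z"
  by (metis norm_fst_le prod.collapse)

lemma norm_snd_le_norm: "norm (snd z) \<le> norm z"
  by (metis norm_snd_le prod.collapse)

lemma dist_triple_le: "dist ((x, p), q) ((x', p'), q') \<le> dist x x' + dist p p' + dist q q'"
  using dist_Pair_le[of "(x, p)" q "(x', p')" q'] dist_Pair_le[of x p x' p'] by linarith

lemma dist_triple_ge:
  "dist x x' \<le> dist ((x, p), q) ((x', p'), q')"
  "dist p p' \<le> dist ((x, p), q) ((x', p'), q')"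
  "dist q q' \<le> dist ((x, p), q) ((x', p'), q')"
  using dist_fst_le[of "((x, p), q)" "((x', p'), q')"] dist_snd_le[of "((x, p), q)" "((x', p'), q')"]
    dist_fst_le[of "(x, p)" "(x', p')"] dist_snd_le[of "(x, p)" "(x', p')"]
  by simp_all

text \<open>The trajectory measure and the initial distribution no longer appear: the bound at
  optimal policies is stated for their softmax form.\<close>

locale soft_bilevel =
  fixes P :: "'s::finite \<Rightarrow> 'a::finite \<Rightarrow> 's pmf"
    and \<gamma> \<tau> :: real
    and r :: "real ^ 'n \<Rightarrow> real ^ ('s \<times> 'a)"
    and f :: "(real ^ 'n) \<times> (real ^ ('s \<times> 'a)) \<Rightarrow> real"
    and Lf Cf Crx Lr :: real
  assumes \<gamma>: "0 < \<gamma>" "\<gamma> < 1" and \<tau>: "0 < \<tau>"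
    and r: "\<And>x. r differentiable (at x)"
    and f: "\<And>z. f differentiable (at z)"
    and f_Lipschitz: "\<And>x y \<pi> \<mu>. is_policy \<pi> \<Longrightarrow> is_policy \<mu> \<Longrightarrow>
        norm (gradient f (x, \<pi>) - gradient f (y, \<mu>)) \<le> Lf * (norm (x - y) + infnorm (\<pi> - \<mu>))"
    and f_bound: "\<And>x. norm (snd (gradient f (x, softmax ((1 / \<tau>) *\<^sub>R soft_Q P \<gamma> \<tau> (r x))))) \<le> Cf"
    and r_gradient_bound: "\<And>x i. norm (reward_grad r x i) \<le> Crx"
    and r_gradient_Lipschitz: "\<And>x y i. norm (reward_grad r x i - reward_grad r y i) \<le> Lr * norm (x - y)"
begin

definition Qstar :: "real ^ 'n \<Rightarrow> real ^ ('s \<times> 'a)"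
  where "Qstar x = soft_Q P \<gamma> \<tau> (r x)"

definition pol :: "real ^ 'n \<Rightarrow> real ^ ('s \<times> 'a)"
  where "pol x = softmax ((1 / \<tau>) *\<^sub>R Qstar x)"

text \<open>The restriction to policies is forced by the Lipschitz assumption on \<open>f\<close>.
  Policy and Q-function are independent coordinates, so one set of estimates covers optimal points
  and iterates.\<close>

definition policy_points :: "(((real ^ 'n) \<times> (real ^ ('s \<times> 'a))) \<times> (real ^ ('s \<times> 'a))) set"
  where "policy_points = {z. is_policy (snd (fst z))}"

definition adjoint_target :: "((real ^ 'n) \<times> (real ^ ('s \<times> 'a))) \<times> (real ^ ('s \<times> 'a)) \<Rightarrow> real ^ 's"
  where "adjoint_target z = adjoint_rhs P \<gamma> (snd (fst z)) (snd (gradient f (fst z)))"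

definition adjoint_sol :: "((real ^ 'n) \<times> (real ^ ('s \<times> 'a))) \<times> (real ^ ('s \<times> 'a)) \<Rightarrow> real ^ 's"
  where "adjoint_sol z = adjoint_solve P \<gamma> (snd (fst z)) (adjoint_target z)"

definition est :: "((real ^ 'n) \<times> (real ^ ('s \<times> 'a))) \<times> (real ^ ('s \<times> 'a)) \<Rightarrow> real ^ 's \<Rightarrow> real ^ 'n"
  where "est z w = hyper_gradient_est P \<gamma> \<tau> r f (fst (fst z)) (snd (fst z)) (soft_max_value \<tau> (snd z)) w"

text \<open>The softmax weights from the parameter gradient of the backup; at an optimal point they
  agree with the policy coordinate.\<close>

definition next_pol :: "((real ^ 'n) \<times> (real ^ ('s \<times> 'a))) \<times> (real ^ ('s \<times> 'a)) \<Rightarrow> real ^ ('s \<times> 'a)"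
  where "next_pol z = softmax ((1 / \<tau>) *\<^sub>R (r (fst (fst z)) + soft_lookahead P \<gamma> \<tau> (snd z)))"

definition opt :: "real ^ 'n \<Rightarrow> ((real ^ 'n) \<times> (real ^ ('s \<times> 'a))) \<times> (real ^ ('s \<times> 'a))"
  where "opt x = ((x, pol x), Qstar x)"

definition grad :: "real ^ 'n \<Rightarrow> real ^ 'n"
  where "grad x = est (opt x) (adjoint_sol (opt x))"

lemma grad: "GDERIV (\<lambda>x. f (x, pol x)) x :> grad x"
  using hyper_objective_GDERIV[OF \<gamma> \<tau> r f, of P x]
  by (simp add: grad_def est_def opt_def adjoint_sol_def adjoint_target_def pol_def Qstar_def)

lemma est_eq: "est z w = fst (gradient f (fst z)) +
    (1 / \<tau>) *\<^sub>R (\<Sum>i\<in>UNIV. (snd (fst z) $ i * snd (gradient f (fst z)) $ i - w $ fst i * next_pol z $ i)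
      *\<^sub>R reward_grad r (fst (fst z)) i)"
  unfolding est_def hyper_gradient_est_eq[OF \<tau> r f] by (simp add: next_pol_def)

lemma policy_pointsD: "z \<in> policy_points \<Longrightarrow> is_policy (snd (fst z))"
  by (simp add: policy_points_def)

lemma pol_policy: "is_policy (pol x)"
  by (simp add: pol_def softmax_is_policy)

lemma opt_policy_points: "opt x \<in> policy_points"
  by (simp add: opt_def policy_points_def pol_policy)

lemma Lr_abs: "norm (reward_grad r x i - reward_grad r y i) \<le> \<bar>Lr\<bar> * norm (x - y)"
  using r_gradient_Lipschitz by (rule order_trans) (intro mult_right_mono, auto)

lemma Crx_nonneg: "0 \<le> Crx"
  using r_gradient_bound norm_ge_zero order_trans by blast

section \<open>Bounded Lipschitz ingredients of the estimator\<close>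

lemma blip_policy: "blip policy_points (\<lambda>z. snd (fst z) $ i)"
proof (rule blipI[OF lipI])
  show "norm (snd (fst z) $ i) \<le> 1" if "z \<in> policy_points" for z
    using is_policy_nonneg[OF policy_pointsD[OF that], of i] is_policy_le_1[OF policy_pointsD[OF that], of i] by simp
  show "norm (snd (fst y) $ i - snd (fst z) $ i) \<le> 1 * dist y z"
    if "y \<in> policy_points" "z \<in> policy_points" for y z
  proof -
    have "norm (snd (fst y) $ i - snd (fst z) $ i) \<le> norm (snd (fst y) - snd (fst z))"
      using component_le_norm_cart[of "snd (fst y) - snd (fst z)" i] by simp
    also have "\<dots> \<le> 1 * dist y z"
      using dist_triple_ge(2)[of "snd (fst y)" "snd (fst z)" "fst (fst y)" "snd y" "fst (fst z)" "snd z"]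
      by (simp add: dist_norm)
    finally show ?thesis .
  qed
qed

lemma blip_reward_grad: "blip policy_points (\<lambda>z. reward_grad r (fst (fst z)) i)"
proof (rule blipI[OF lipI])
  show "norm (reward_grad r (fst (fst z)) i) \<le> Crx" for z
    by (rule r_gradient_bound)
  show "norm (reward_grad r (fst (fst y)) i - reward_grad r (fst (fst z)) i) \<le> \<bar>Lr\<bar> * dist y z"
    if "y \<in> policy_points" "z \<in> policy_points" for y z
    using dist_triple_ge(1)[of "fst (fst y)" "fst (fst z)" "snd (fst y)" "snd y" "snd (fst z)" "snd z"]
    by (intro order_trans[OF Lr_abs] mult_left_mono) (auto simp: dist_norm)
qed

lemma f_Lipschitz_policy_points:
  assumes "y \<in> policy_points" "z \<in> policy_points"
  shows "norm (gradient f (fst y) - gradient f (fst z)) \<le> (2 * \<bar>Lf\<bar>) * dist y z"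
proof -
  have "norm (gradient f (fst y) - gradient f (fst z))
      \<le> Lf * (norm (fst (fst y) - fst (fst z)) + infnorm (snd (fst y) - snd (fst z)))"
    using f_Lipschitz[OF policy_pointsD[OF assms(1)] policy_pointsD[OF assms(2)], of "fst (fst y)" "fst (fst z)"] by simp
  also have "\<dots> \<le> \<bar>Lf\<bar> * (dist y z + dist y z)"
  proof (intro mult_mono add_mono)
    show "norm (fst (fst y) - fst (fst z)) \<le> dist y z"
      using dist_triple_ge(1)[of "fst (fst y)" "fst (fst z)" "snd (fst y)" "snd y" "snd (fst z)" "snd z"]
      by (simp add: dist_norm)
    show "infnorm (snd (fst y) - snd (fst z)) \<le> dist y z"
      using dist_triple_ge(2)[of "snd (fst y)" "snd (fst z)" "fst (fst y)" "snd y" "fst (fst z)" "snd z"]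
      by (intro order_trans[OF infnorm_le_norm]) (simp add: dist_norm)
  qed (auto simp: infnorm_pos_le)
  finally show ?thesis by simp
qed

lemma lip_gradient_fst: "lip policy_points (\<lambda>z. fst (gradient f (fst z)))"
  using order_trans[OF norm_fst_le_norm f_Lipschitz_policy_points] by (intro lipI) (simp flip: fst_diff)

text \<open>The assumed bound holds only at optimal policies. Two policies are at sup-norm distance
  at most 1, so the Lipschitz condition extends it to all policies at the cost of
  \<open>\<bar>Lf\<bar>\<close>.\<close>

lemma blip_gradient_snd: "blip policy_points (\<lambda>z. snd (gradient f (fst z)))"
proof (rule blipI[OF lipI])
  show "norm (snd (gradient f (fst y)) - snd (gradient f (fst z))) \<le> (2 * \<bar>Lf\<bar>) * dist y z"
    if "y \<in> policy_points" "z \<in> policy_points" for y z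
    using order_trans[OF norm_snd_le_norm f_Lipschitz_policy_points[OF that]] by (simp flip: snd_diff)
  fix z assume z: "z \<in> policy_points"
  let ?x = "fst (fst z)" and ?\<pi> = "snd (fst z)"
  have "infnorm (?\<pi> - pol ?x) \<le> 1"
    unfolding infnorm_le_iff
  proof
    fix i show "\<bar>(?\<pi> - pol ?x) $ i\<bar> \<le> 1"
      using is_policy_nonneg[OF policy_pointsD[OF z], of i] is_policy_le_1[OF policy_pointsD[OF z], of i]
        is_policy_nonneg[OF pol_policy, of ?x i] is_policy_le_1[OF pol_policy, of ?x i] by simp
  qed
  then have "Lf * infnorm (?\<pi> - pol ?x) \<le> \<bar>Lf\<bar> * 1"
    by (intro mult_mono) (auto simp: infnorm_pos_le)
  then have "norm (gradient f (fst z) - gradient f (?x, pol ?x)) \<le> \<bar>Lf\<bar>"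
    using f_Lipschitz[OF policy_pointsD[OF z] pol_policy[of ?x], of ?x ?x] by simp
  then have "norm (snd (gradient f (fst z) - gradient f (?x, pol ?x))) \<le> \<bar>Lf\<bar>"
    using norm_snd_le_norm order_trans by blast
  moreover have "norm (snd (gradient f (?x, pol ?x))) \<le> Cf"
    using f_bound[of ?x] by (simp add: pol_def Qstar_def)
  ultimately show "norm (snd (gradient f (fst z))) \<le> \<bar>Lf\<bar> + Cf"
    using norm_triangle_ineq[of "snd (gradient f (fst z)) - snd (gradient f (?x, pol ?x))" "snd (gradient f (?x, pol ?x))"]
    by simp
qed

lemma reward_Lipschitz: "infnorm (r x - r y) \<le> Crx * norm (x - y)"
  unfolding infnorm_le_iff
proof
  fix i
  have "norm (r x $ i - r y $ i) \<le> Crx * norm (x - y)"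
  proof (rule differentiable_bound[of UNIV "\<lambda>x. r x $ i"])
    fix x
    show "((\<lambda>x. r x $ i) has_derivative (\<lambda>h. h \<bullet> reward_grad r x i)) (at x within UNIV)"
      using GDERIV_component[OF r] by (simp add: gderiv_def reward_grad_def)
    show "onorm (\<lambda>h. h \<bullet> reward_grad r x i) \<le> Crx"
    proof (rule onorm_bound[OF Crx_nonneg])
      fix h
      have "norm (h \<bullet> reward_grad r x i) \<le> norm h * norm (reward_grad r x i)"
        using Cauchy_Schwarz_ineq2 by simp
      also have "\<dots> \<le> norm h * Crx"
        by (intro mult_left_mono r_gradient_bound) auto
      finally show "norm (h \<bullet> reward_grad r x i) \<le> Crx * norm h"
        by (simp add: mult.commute)
    qed
  qed auto
  then show "\<bar>(r x - r y) $ i\<bar> \<le> Crx * norm (x - y)" by simp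
qed

lemma softmax_scaled_Lipschitz:
  fixes Q R :: "real ^ ('s \<times> 'a)"
  shows "infnorm (softmax ((1 / \<tau>) *\<^sub>R Q) - softmax ((1 / \<tau>) *\<^sub>R R)) \<le> 2 / \<tau> * infnorm (Q - R)"
proof -
  have "\<bar>((1 / \<tau>) *\<^sub>R Q) $ i - ((1 / \<tau>) *\<^sub>R R) $ i\<bar> \<le> infnorm (Q - R) / \<tau>" for i
    using component_le_infnorm_cart[of "Q - R" i] \<tau>
    by (simp add: diff_divide_distrib[symmetric] divide_right_mono)
  from softmax_Lipschitz[OF this] show ?thesis
    by (simp add: infnorm_le_iff)
qed

lemma blip_next_pol: "blip policy_points (\<lambda>z. next_pol z $ i)"
proof (rule blipI[OF lipI])
  show "norm (next_pol z $ i) \<le> 1" for z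
    using is_policy_nonneg[OF softmax_is_policy, of _ i] is_policy_le_1[OF softmax_is_policy, of _ i]
    by (simp add: next_pol_def)
  fix y z :: "((real ^ 'n) \<times> (real ^ ('s \<times> 'a))) \<times> (real ^ ('s \<times> 'a))"
  let ?R = "\<lambda>z. r (fst (fst z)) + soft_lookahead P \<gamma> \<tau> (snd z)"
  have "infnorm (?R y - ?R z) \<le> infnorm (r (fst (fst y)) - r (fst (fst z)))
      + infnorm (soft_lookahead P \<gamma> \<tau> (snd y) - soft_lookahead P \<gamma> \<tau> (snd z))"
    using infnorm_triangle by (simp add: add_diff_add)
  also have "\<dots> \<le> Crx * norm (fst (fst y) - fst (fst z)) + \<gamma> * infnorm (snd y - snd z)"
    by (intro add_mono reward_Lipschitz soft_lookahead_contraction \<gamma> \<tau>)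
  also have "\<dots> \<le> Crx * dist y z + \<gamma> * dist y z"
  proof (intro add_mono mult_left_mono)
    show "norm (fst (fst y) - fst (fst z)) \<le> dist y z"
      using dist_triple_ge(1)[of "fst (fst y)" "fst (fst z)" "snd (fst y)" "snd y" "snd (fst z)" "snd z"]
      by (simp add: dist_norm)
    show "infnorm (snd y - snd z) \<le> dist y z"
      using dist_triple_ge(3)[of "snd y" "snd z" "fst (fst y)" "snd (fst y)" "fst (fst z)" "snd (fst z)"]
      by (intro order_trans[OF infnorm_le_norm]) (simp add: dist_norm)
  qed (use \<gamma> Crx_nonneg in auto)
  finally have "2 / \<tau> * infnorm (?R y - ?R z) \<le> 2 / \<tau> * (Crx * dist y z + \<gamma> * dist y z)"
    using \<tau> by (intro mult_left_mono) auto
  moreover have "infnorm (next_pol y - next_pol z) \<le> 2 / \<tau> * infnorm (?R y - ?R z)"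
    unfolding next_pol_def by (rule softmax_scaled_Lipschitz)
  moreover have "2 / \<tau> * (Crx * dist y z + \<gamma> * dist y z) = (2 / \<tau> * (Crx + \<gamma>)) * dist y z"
    by (simp only: mult.assoc distrib_right)
  ultimately have "infnorm (next_pol y - next_pol z) \<le> (2 / \<tau> * (Crx + \<gamma>)) * dist y z"
    by linarith
  then show "norm (next_pol y $ i - next_pol z $ i) \<le> (2 / \<tau> * (Crx + \<gamma>)) * dist y z"
    using component_le_infnorm_cart[of "next_pol y - next_pol z" i] by simp
qed

lemma blip_adjoint_target: "blip policy_points adjoint_target"
proof (rule blip_cart)
  fix s
  have "adjoint_target z $ s = (\<Sum>i\<in>UNIV. U_mat P \<gamma> $ i $ s * (snd (fst z) $ i * snd (gradient f (fst z)) $ i))" for z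
    unfolding adjoint_target_def adjoint_rhs_def diag_mult
    by (simp add: matrix_vector_mult_def transpose_def del: transpose_matrix_vector)
  moreover have "blip policy_points (\<lambda>z. \<Sum>i\<in>UNIV. U_mat P \<gamma> $ i $ s * (snd (fst z) $ i * snd (gradient f (fst z)) $ i))"
    by (intro blip_sum blip_mult blip_const blip_policy blip_component[OF blip_gradient_snd])
  ultimately show "blip policy_points (\<lambda>z. adjoint_target z $ s)" by simp
qed

definition \<kappa> :: real where "\<kappa> = real CARD('s) / (1 - \<gamma>)"

lemma \<kappa>_pos: "0 < \<kappa>"
  using \<gamma> by (simp add: \<kappa>_def)

lemma adjoint_sol: "z \<in> policy_points \<Longrightarrow> adjoint_mat P \<gamma> (snd (fst z)) *v adjoint_sol z = adjoint_target z"
  unfolding adjoint_sol_def by (rule adjoint_solve[OF \<gamma> policy_pointsD])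

text \<open>Perturbation of a linear system: the matrix at \<open>y\<close> sends the difference of
  the solutions to the difference of the right-hand sides minus the change of the matrix applied to
  the solution at \<open>z\<close>. That solution is bounded, and the uniform lower bound inverts
  the matrix.\<close>

lemma blip_adjoint_sol: "blip policy_points adjoint_sol"
proof -
  obtain B where B: "0 \<le> B" "\<And>z. z \<in> policy_points \<Longrightarrow> norm (adjoint_target z) \<le> B"
    "\<And>y z. y \<in> policy_points \<Longrightarrow> z \<in> policy_points \<Longrightarrow> norm (adjoint_target y - adjoint_target z) \<le> B * dist y z"
    using blip_adjoint_target by (rule blipE) blast
  let ?A = "\<lambda>z. adjoint_mat P \<gamma> (snd (fst z))"
  have bound: "norm (adjoint_sol z) \<le> \<kappa> * B" if "z \<in> policy_points" for z
  proof -
    have "norm (adjoint_sol z) \<le> \<kappa> * norm (?A z *v adjoint_sol z)"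
      unfolding \<kappa>_def by (rule adjoint_mat_lower_bound[OF \<gamma> policy_pointsD[OF that]])
    also have "\<dots> \<le> \<kappa> * B"
      unfolding adjoint_sol[OF that] using B(2)[OF that] \<kappa>_pos by simp
    finally show ?thesis .
  qed
  define D where "D = real CARD('s) * (real CARD('s) * (real CARD('a) * (\<kappa> * B)))"
  have A_diff: "norm (?A y *v v - ?A z *v v) \<le> D * dist y z"
    if yz: "y \<in> policy_points" "z \<in> policy_points" and v: "norm v \<le> \<kappa> * B" for y z v
  proof -
    let ?T = "\<lambda>z. policy_trans P (snd (fst z))"
    have T: "\<bar>?T y $ s $ s' - ?T z $ s $ s'\<bar> \<le> real CARD('a) * dist y z" for s s'
    proof -
      have "\<bar>?T y $ s $ s' - ?T z $ s $ s'\<bar> = \<bar>\<Sum>a\<in>UNIV. (snd (fst y) $ (s, a) - snd (fst z) $ (s, a)) * pmf (P s a) s'\<bar>"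
        by (simp add: policy_trans_def sum_subtractf left_diff_distrib)
      also have "\<dots> \<le> (\<Sum>a\<in>(UNIV :: 'a set). dist y z * 1)"
      proof (intro order_trans[OF sum_abs] sum_mono)
        fix a
        have "\<bar>snd (fst y) $ (s, a) - snd (fst z) $ (s, a)\<bar> \<le> norm (snd (fst y) - snd (fst z))"
          using component_le_norm_cart[of "snd (fst y) - snd (fst z)" "(s, a)"] by simp
        also have "\<dots> \<le> dist y z"
          using dist_triple_ge(2)[of "snd (fst y)" "snd (fst z)" "fst (fst y)" "snd y" "fst (fst z)" "snd z"]
          by (simp add: dist_norm)
        finally show "\<bar>(snd (fst y) $ (s, a) - snd (fst z) $ (s, a)) * pmf (P s a) s'\<bar> \<le> dist y z * 1"
          unfolding abs_mult by (intro mult_mono) (auto simp: pmf_le_1)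
      qed
      finally show ?thesis by simp
    qed
    have "infnorm (?A y *v v - ?A z *v v) \<le> real CARD('s) * (real CARD('a) * dist y z * (\<kappa> * B))"
      unfolding infnorm_le_iff
    proof
      fix s'
      have "\<bar>(?A y *v v - ?A z *v v) $ s'\<bar> = \<gamma> * \<bar>\<Sum>s\<in>UNIV. (?T y $ s $ s' - ?T z $ s $ s') * v $ s\<bar>"
        using \<gamma> by (simp add: adjoint_mat_mult_component left_diff_distrib sum_subtractf
            right_diff_distrib[symmetric] abs_mult abs_minus_commute)
      also have "\<dots> \<le> 1 * (\<Sum>s\<in>(UNIV :: 's set). (real CARD('a) * dist y z) * (\<kappa> * B))"
      proof (intro mult_mono order_trans[OF sum_abs] sum_mono)
        fix s
        have "\<bar>v $ s\<bar> \<le> \<kappa> * B"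
          using component_le_norm_cart[of v s] v by simp
        then show "\<bar>(?T y $ s $ s' - ?T z $ s $ s') * v $ s\<bar> \<le> (real CARD('a) * dist y z) * (\<kappa> * B)"
          unfolding abs_mult using T by (intro mult_mono) auto
      qed (use \<gamma> in auto)
      finally show "\<bar>(?A y *v v - ?A z *v v) $ s'\<bar> \<le> real CARD('s) * (real CARD('a) * dist y z * (\<kappa> * B))"
        by simp
    qed
    from order_trans[OF norm_le_card_infnorm mult_left_mono[OF this]]
    show ?thesis by (simp add: D_def mult_ac)
  qed
  show ?thesis
  proof (rule blipI[OF lipI bound])
    fix y z assume yz: "y \<in> policy_points" "z \<in> policy_points"
    have "?A y *v (adjoint_sol y - adjoint_sol z) = (adjoint_target y - adjoint_target z) - (?A y *v adjoint_sol z - ?A z *v adjoint_sol z)"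
      by (simp add: matrix_vector_mult_diff_distrib adjoint_sol yz)
    then have "norm (?A y *v (adjoint_sol y - adjoint_sol z)) \<le> norm (adjoint_target y - adjoint_target z) + norm (?A y *v adjoint_sol z - ?A z *v adjoint_sol z)"
      using norm_triangle_ineq4 by simp
    also have "\<dots> \<le> B * dist y z + D * dist y z"
      by (intro add_mono B(3) A_diff bound yz)
    finally have "\<kappa> * norm (?A y *v (adjoint_sol y - adjoint_sol z)) \<le> \<kappa> * (B * dist y z + D * dist y z)"
      using \<kappa>_pos by simp
    with adjoint_mat_lower_bound[OF \<gamma> policy_pointsD[OF yz(1)], of "adjoint_sol y - adjoint_sol z" P]
    have "norm (adjoint_sol y - adjoint_sol z) \<le> \<kappa> * (B * dist y z + D * dist y z)"
      unfolding \<kappa>_def by linarith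
    then show "norm (adjoint_sol y - adjoint_sol z) \<le> (\<kappa> * (B + D)) * dist y z"
      by (simp add: algebra_simps)
  qed
qed

section \<open>Lipschitz bounds for the estimator and the hyper-gradient\<close>

lemma lip_est: "lip policy_points (\<lambda>z. est z (adjoint_sol z))"
  unfolding est_eq
  by (intro lip_add lip_gradient_fst blip_imp_lip blip_scaleR blip_const blip_sum blip_diff blip_mult
      blip_policy blip_component[OF blip_gradient_snd] blip_component[OF blip_adjoint_sol] blip_next_pol blip_reward_grad)

text \<open>The constant does not depend on the size of \<open>w\<close>, so the bound applies to
  the algorithm's adjoint vectors before anything is known about their growth.\<close>

lemma est_diff:
  "norm (est z w - est z v) \<le> (1 / \<tau> * (real CARD('s \<times> 'a) * Crx)) * norm (w - v)"
proof -
  have "est z w - est z v = (1 / \<tau>) *\<^sub>R (\<Sum>i\<in>UNIV. ((v - w) $ fst i * next_pol z $ i) *\<^sub>R reward_grad r (fst (fst z)) i)"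
  proof -
    have "(c - w $ fst i * next_pol z $ i) *\<^sub>R g - (c - v $ fst i * next_pol z $ i) *\<^sub>R g
        = ((v - w) $ fst i * next_pol z $ i) *\<^sub>R g" for c i and g :: "real ^ 'n"
      by (simp add: scaleR_diff_left[symmetric] left_diff_distrib)
    then show ?thesis
      unfolding est_eq by (simp only: add_diff_cancel_left scaleR_diff_right[symmetric] sum_subtractf[symmetric])
  qed
  moreover have "norm (\<Sum>i\<in>UNIV. ((v - w) $ fst i * next_pol z $ i) *\<^sub>R reward_grad r (fst (fst z)) i)
      \<le> (\<Sum>i\<in>(UNIV :: ('s \<times> 'a) set). norm (w - v) * 1 * Crx)"
  proof (rule sum_norm_le)
    fix i :: "'s \<times> 'a"
    have "\<bar>(v - w) $ fst i\<bar> \<le> norm (w - v)"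
      using component_le_norm_cart[of "v - w" "fst i"] by (simp add: norm_minus_commute)
    moreover have "\<bar>next_pol z $ i\<bar> \<le> 1"
      using is_policy_nonneg[OF softmax_is_policy, of _ i] is_policy_le_1[OF softmax_is_policy, of _ i]
      by (simp add: next_pol_def)
    ultimately show "norm (((v - w) $ fst i * next_pol z $ i) *\<^sub>R reward_grad r (fst (fst z)) i) \<le> norm (w - v) * 1 * Crx"
      unfolding norm_scaleR abs_mult by (intro mult_mono r_gradient_bound) auto
  qed
  ultimately show ?thesis
    using \<tau> by (simp add: divide_right_mono mult_ac)
qed

lemma Qstar_Lipschitz: "infnorm (Qstar x - Qstar y) \<le> Crx / (1 - \<gamma>) * norm (x - y)"
proof -
  have "infnorm (Qstar x - Qstar y) \<le> infnorm (r x - r y) / (1 - \<gamma>)"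
    unfolding Qstar_def by (rule soft_Q_Lipschitz[OF \<gamma> \<tau>])
  also have "\<dots> \<le> Crx * norm (x - y) / (1 - \<gamma>)"
    using \<gamma> by (intro divide_right_mono reward_Lipschitz) auto
  finally show ?thesis by simp
qed

lemma policy_error: "norm (softmax ((1 / \<tau>) *\<^sub>R Q) - softmax ((1 / \<tau>) *\<^sub>R R))
    \<le> real CARD('s \<times> 'a) * (2 / \<tau>) * infnorm (Q - R)" for Q R :: "real ^ ('s \<times> 'a)"
  using order_trans[OF norm_le_card_infnorm mult_left_mono[OF softmax_scaled_Lipschitz[of Q R]]]
  by (simp only: mult.assoc of_nat_0_le_iff)

lemma opt_Lipschitz: "\<exists>C. \<forall>x y. dist (opt x) (opt y) \<le> C * norm (x - y)"
proof -
  let ?c = "real CARD('s \<times> 'a)" and ?L = "Crx / (1 - \<gamma>)"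
  have "dist (opt x) (opt y) \<le> (1 + ?c * (2 / \<tau>) * ?L + ?c * ?L) * norm (x - y)" for x y
  proof -
    have "dist (opt x) (opt y) \<le> norm (x - y) + norm (pol x - pol y) + norm (Qstar x - Qstar y)"
      unfolding opt_def using dist_triple_le[of x "pol x" "Qstar x" y "pol y" "Qstar y"] by (simp add: dist_norm)
    also have "norm (pol x - pol y) \<le> ?c * (2 / \<tau>) * (?L * norm (x - y))"
      unfolding pol_def using \<tau> by (intro order_trans[OF policy_error] mult_left_mono Qstar_Lipschitz) auto
    also have "norm (Qstar x - Qstar y) \<le> ?c * (?L * norm (x - y))"
      by (intro order_trans[OF norm_le_card_infnorm] mult_left_mono Qstar_Lipschitz) auto
    finally show ?thesis
      by (simp only: distrib_right mult.assoc mult_1 add_mono order_refl)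
  qed
  then show ?thesis by blast
qed

lemma grad_Lipschitz: "\<exists>L\<ge>0. \<forall>x y. norm (grad x - grad y) \<le> L * norm (x - y)"
proof -
  obtain C where C: "0 \<le> C" "\<And>y z. y \<in> policy_points \<Longrightarrow> z \<in> policy_points \<Longrightarrow> norm (est y (adjoint_sol y) - est z (adjoint_sol z)) \<le> C * dist y z"
    using lip_est by (rule lipE) blast
  obtain D where D: "\<And>x y. dist (opt x) (opt y) \<le> D * norm (x - y)"
    using opt_Lipschitz by blast
  have "norm (grad x - grad y) \<le> (C * \<bar>D\<bar>) * norm (x - y)" for x y
  proof -
    have "norm (grad x - grad y) \<le> C * dist (opt x) (opt y)"
      unfolding grad_def by (intro C opt_policy_points)
    also have "\<dots> \<le> C * (\<bar>D\<bar> * norm (x - y))"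
      using C(1) by (intro mult_left_mono order_trans[OF D] mult_right_mono) auto
    finally show ?thesis by (simp add: mult.assoc)
  qed
  then show ?thesis
    using C(1) by (intro exI[of _ "C * \<bar>D\<bar>"]) auto
qed

text \<open>The intermediate point is the estimator at the same triple with its exact adjoint
  solution: \<open>est_diff\<close> bounds the first leg and \<open>lip_est\<close> the second,
  since the hyper-gradient is the same expression at the optimal triple.\<close>

lemma est_error: "\<exists>C\<ge>0. \<forall>x Q w. norm (est ((x, softmax ((1 / \<tau>) *\<^sub>R Q)), Q) w - grad x)
    \<le> C * (norm (w - adjoint_sol ((x, softmax ((1 / \<tau>) *\<^sub>R Q)), Q)) + infnorm (Q - Qstar x))"
proof -
  let ?c = "real CARD('s \<times> 'a)"
  obtain C where C: "0 \<le> C" "\<And>y z. y \<in> policy_points \<Longrightarrow> z \<in> policy_points \<Longrightarrow> norm (est y (adjoint_sol y) - est z (adjoint_sol z)) \<le> C * dist y z"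
    using lip_est by (rule lipE) blast
  define D where "D = 1 / \<tau> * (?c * Crx)"
  define E where "E = C * (?c * (2 / \<tau>) + ?c)"
  have DE: "0 \<le> D" "0 \<le> E"
    using \<tau> Crx_nonneg C(1) by (auto simp: D_def E_def)
  have "norm (est ((x, softmax ((1 / \<tau>) *\<^sub>R Q)), Q) w - grad x)
    \<le> (D + E) * (norm (w - adjoint_sol ((x, softmax ((1 / \<tau>) *\<^sub>R Q)), Q)) + infnorm (Q - Qstar x))" for x Q w
  proof -
    let ?z = "((x, softmax ((1 / \<tau>) *\<^sub>R Q)), Q)"
    have z: "?z \<in> policy_points"
      by (simp add: policy_points_def softmax_is_policy)
    have "dist ?z (opt x) \<le> norm (softmax ((1 / \<tau>) *\<^sub>R Q) - pol x) + norm (Q - Qstar x)"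
      unfolding opt_def using dist_triple_le[of x "softmax ((1 / \<tau>) *\<^sub>R Q)" Q x "pol x" "Qstar x"] by (simp add: dist_norm)
    also have "\<dots> \<le> ?c * (2 / \<tau>) * infnorm (Q - Qstar x) + ?c * infnorm (Q - Qstar x)"
      unfolding pol_def by (intro add_mono policy_error norm_le_card_infnorm)
    finally have "C * dist ?z (opt x) \<le> C * (?c * (2 / \<tau>) * infnorm (Q - Qstar x) + ?c * infnorm (Q - Qstar x))"
      using C(1) by (rule mult_left_mono)
    then have 1: "norm (est ?z (adjoint_sol ?z) - grad x) \<le> E * infnorm (Q - Qstar x)"
      using C(2)[OF z opt_policy_points[of x]] by (simp add: grad_def E_def algebra_simps)
    have "norm (est ?z w - grad x) \<le> norm (est ?z w - est ?z (adjoint_sol ?z)) + norm (est ?z (adjoint_sol ?z) - grad x)"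
      using norm_triangle_ineq[of "est ?z w - est ?z (adjoint_sol ?z)" "est ?z (adjoint_sol ?z) - grad x"] by simp
    also have "\<dots> \<le> D * norm (w - adjoint_sol ?z) + E * infnorm (Q - Qstar x)"
      unfolding D_def by (intro add_mono est_diff 1)
    also have "\<dots> \<le> (D + E) * norm (w - adjoint_sol ?z) + (D + E) * infnorm (Q - Qstar x)"
      using DE by (intro add_mono mult_right_mono) (auto simp: infnorm_pos_le)
    finally show ?thesis by (simp only: distrib_left)
  qed
  then show ?thesis
    using DE by (intro exI[of _ "D + E"]) auto
qed

end

section \<open>Convergence\<close>

context soft_bilevel
begin

text \<open>The first entry uses the bound \<open>CARD('s) * 2\<close> of the transposed adjoint
  matrix to control the quadratic term of the step; the second keeps the radicand of \<sigma>
  nonnegative.\<close>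

definition \<eta> :: real where "\<eta> = min (1 / (real CARD('s) * 2)\<^sup>2) (\<kappa>\<^sup>2)"

definition \<sigma> :: real where "\<sigma> = sqrt (1 - \<eta> / \<kappa>\<^sup>2)"

lemma \<eta>: "0 < \<eta>" "\<eta> * (real CARD('s) * 2)\<^sup>2 \<le> 1" "\<eta> \<le> \<kappa>\<^sup>2"
proof -
  have "\<eta> \<le> 1 / (real CARD('s) * 2)\<^sup>2"
    by (simp add: \<eta>_def)
  then show "\<eta> * (real CARD('s) * 2)\<^sup>2 \<le> 1"
    by (simp add: field_simps)
qed (use \<kappa>_pos in \<open>auto simp: \<eta>_def\<close>)

lemma \<sigma>: "0 \<le> \<sigma>" "\<sigma> < 1"
  using \<eta> \<kappa>_pos by (auto simp: \<sigma>_def)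

lemma adjoint_step_contraction:
  assumes z: "z \<in> policy_points"
  defines "A \<equiv> adjoint_mat P \<gamma> (snd (fst z))"
  shows "norm (w - \<eta> *\<^sub>R (transpose A *v (A *v w) - transpose A *v adjoint_target z) - adjoint_sol z) \<le> \<sigma> * norm (w - adjoint_sol z)"
  unfolding \<sigma>_def A_def
proof (rule least_squares_step_contraction)
  show "norm v \<le> \<kappa> * norm (adjoint_mat P \<gamma> (snd (fst z)) *v v)" for v
    unfolding \<kappa>_def by (rule adjoint_mat_lower_bound[OF \<gamma> policy_pointsD[OF z]])
  show "norm (transpose (adjoint_mat P \<gamma> (snd (fst z))) *v v) \<le> (real CARD('s) * 2) * norm v" for v
    by (rule transpose_adjoint_mat_bound[OF \<gamma> policy_pointsD[OF z]])
qed (use \<kappa>_pos \<eta> adjoint_sol[OF z] in auto)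

section \<open>One-step recursions for the two errors\<close>

lemma soft_bellman_step:
  "infnorm (soft_bellman P \<gamma> \<tau> r y Q - Qstar y) \<le> \<gamma> * (infnorm (Q - Qstar x) + Crx / (1 - \<gamma>) * norm (y - x))"
proof -
  have fixp: "Qstar y = r y + soft_lookahead P \<gamma> \<tau> (Qstar y)"
    unfolding Qstar_def by (rule soft_Q_fixpoint[OF \<gamma> \<tau>])
  have "soft_bellman P \<gamma> \<tau> r y Q - Qstar y = soft_lookahead P \<gamma> \<tau> Q - soft_lookahead P \<gamma> \<tau> (Qstar y)"
    unfolding soft_bellman_eq by (subst fixp) simp
  then have "infnorm (soft_bellman P \<gamma> \<tau> r y Q - Qstar y) \<le> \<gamma> * infnorm (Q - Qstar y)"
    by (simp only: soft_lookahead_contraction[OF \<gamma>(1) \<tau>])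
  also have "infnorm (Q - Qstar y) \<le> infnorm (Q - Qstar x) + infnorm (Qstar y - Qstar x)"
    using infnorm_triangle[of "Q - Qstar x" "Qstar x - Qstar y"] by (simp add: infnorm_sub[of "Qstar x" "Qstar y"])
  also have "\<dots> \<le> infnorm (Q - Qstar x) + Crx / (1 - \<gamma>) * norm (y - x)"
    by (intro add_left_mono Qstar_Lipschitz)
  finally show ?thesis
    using \<gamma> by simp
qed

text \<open>Ties the policy to the Q-function by softmax, so that policy drift is bounded by
  Q-function drift.\<close>

definition iter :: "real ^ 'n \<Rightarrow> real ^ ('s \<times> 'a) \<Rightarrow> ((real ^ 'n) \<times> (real ^ ('s \<times> 'a))) \<times> (real ^ ('s \<times> 'a))"
  where "iter x Q = ((x, softmax ((1 / \<tau>) *\<^sub>R Q)), Q)"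

lemma iter_policy_points: "iter x Q \<in> policy_points"
  by (simp add: iter_def policy_points_def softmax_is_policy)

lemma adjoint_sol_drift: "\<exists>C\<ge>0. \<forall>x y Q R. norm (adjoint_sol (iter x Q) - adjoint_sol (iter y R)) \<le> C * (norm (x - y) + infnorm (Q - R))"
proof -
  let ?c = "real CARD('s \<times> 'a)"
  obtain C where C: "0 \<le> C" "\<And>y z. y \<in> policy_points \<Longrightarrow> z \<in> policy_points \<Longrightarrow> norm (adjoint_sol y - adjoint_sol z) \<le> C * dist y z"
    using blip_adjoint_sol by (rule blipE) blast
  define D where "D = 1 + ?c * (2 / \<tau>) + ?c"
  have D: "0 \<le> D" "1 \<le> D" "?c * (2 / \<tau>) + ?c \<le> D"
    using \<tau> by (auto simp: D_def)
  have "norm (adjoint_sol (iter x Q) - adjoint_sol (iter y R)) \<le> (C * D) * (norm (x - y) + infnorm (Q - R))" for x y Q R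
  proof -
    have "dist (iter x Q) (iter y R) \<le> norm (x - y)
        + norm (softmax ((1 / \<tau>) *\<^sub>R Q) - softmax ((1 / \<tau>) *\<^sub>R R)) + norm (Q - R)"
      unfolding iter_def
      using dist_triple_le[of x "softmax ((1 / \<tau>) *\<^sub>R Q)" Q y "softmax ((1 / \<tau>) *\<^sub>R R)" R] by (simp add: dist_norm)
    also have "\<dots> \<le> norm (x - y) + ?c * (2 / \<tau>) * infnorm (Q - R) + ?c * infnorm (Q - R)"
      by (intro add_mono order_refl policy_error norm_le_card_infnorm)
    also have "\<dots> = 1 * norm (x - y) + (?c * (2 / \<tau>) + ?c) * infnorm (Q - R)"
      by (simp only: distrib_right mult_1 add.assoc)
    also have "\<dots> \<le> D * norm (x - y) + D * infnorm (Q - R)"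
      using D by (intro add_mono mult_right_mono) (auto simp: infnorm_pos_le)
    finally have "C * dist (iter x Q) (iter y R) \<le> C * (D * norm (x - y) + D * infnorm (Q - R))"
      using C(1) by (rule mult_left_mono)
    then show ?thesis
      using C(2)[OF iter_policy_points[of x Q] iter_policy_points[of y R]] by (simp only: distrib_left mult.assoc)
  qed
  then show ?thesis
    using C(1) D(1) by (intro exI[of _ "C * D"]) auto
qed

text \<open>The algorithm updates the adjoint vector after the parameter and the policy, so the
  contraction is towards the target at the new point. The old error is first transported to that
  target and only then contracted.\<close>

lemma error_recursion:
  obtains C where "0 \<le> C"
    and "\<And>x y Q w R A. \<lbrakk>R = soft_bellman P \<gamma> \<tau> r y Q; A = adjoint_mat P \<gamma> (softmax ((1 / \<tau>) *\<^sub>R R))\<rbrakk> \<Longrightarrow>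
      norm (w - \<eta> *\<^sub>R (transpose A *v (A *v w) - transpose A *v adjoint_target (iter y R)) - adjoint_sol (iter y R))
        \<le> \<sigma> * norm (w - adjoint_sol (iter x Q)) + C * (infnorm (Q - Qstar x) + norm (y - x))"
    and "\<And>x y Q. infnorm (soft_bellman P \<gamma> \<tau> r y Q - Qstar y) \<le> \<gamma> * infnorm (Q - Qstar x) + C * norm (y - x)"
proof -
  define L where "L = Crx / (1 - \<gamma>)"
  have L: "0 \<le> L"
    using \<gamma> Crx_nonneg by (simp add: L_def)
  obtain C where C: "0 \<le> C" and drift: "\<And>x y Q R. norm (adjoint_sol (iter x Q) - adjoint_sol (iter y R)) \<le> C * (norm (x - y) + infnorm (Q - R))"
    using adjoint_sol_drift by blast
  \<comment> \<open>The factor \<open>2 + 2 * L\<close> collects the parameter step and the bound on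
    \<open>infnorm (Q - R)\<close>; the summand \<open>L\<close> lets the same constant serve the
    recursion for the Q-function.\<close>
  define D where "D = C * (2 + 2 * L) + L"
  have D0: "0 \<le> D"
    using C L by (simp add: D_def)
  have main: "norm (w - \<eta> *\<^sub>R (transpose A *v (A *v w) - transpose A *v adjoint_target (iter y R)) - adjoint_sol (iter y R))
        \<le> \<sigma> * norm (w - adjoint_sol (iter x Q)) + D * (q + norm (y - x))"
    and bellman: "infnorm (R - Qstar y) \<le> \<gamma> * q + D * norm (y - x)"
    if R: "R = soft_bellman P \<gamma> \<tau> r y Q" and A: "A = adjoint_mat P \<gamma> (softmax ((1 / \<tau>) *\<^sub>R R))"
      and q: "q = infnorm (Q - Qstar x)"
    for x y Q w R A q
  proof -
    let ?d = "norm (y - x)"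
    have q0: "0 \<le> q"
      by (simp add: q infnorm_pos_le)
    have step: "infnorm (R - Qstar y) \<le> \<gamma> * (q + L * ?d)"
      unfolding R q L_def by (rule soft_bellman_step)
    have gLd: "\<gamma> * (L * ?d) \<le> L * ?d"
      using \<gamma> L by (simp add: mult_left_le_one_le)
    have "L * ?d \<le> D * ?d"
      using C L by (intro mult_right_mono) (auto simp: D_def)
    with step gLd show "infnorm (R - Qstar y) \<le> \<gamma> * q + D * ?d"
      by (simp add: distrib_left)
    \<comment> \<open>The change of the Q-function is estimated through the two fixed points, whose
      distance is controlled by the parameter step.\<close>
    have "infnorm (Q - R) \<le> infnorm (Q - Qstar x) + infnorm (Qstar x - R)"
      using infnorm_triangle[of "Q - Qstar x" "Qstar x - R"] by simp
    also have "infnorm (Qstar x - R) \<le> infnorm (R - Qstar y) + infnorm (Qstar y - Qstar x)"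
      using infnorm_triangle[of "R - Qstar y" "Qstar y - Qstar x"] by (simp add: infnorm_sub[of "Qstar x" R])
    also have "infnorm (Qstar y - Qstar x) \<le> L * ?d"
      unfolding L_def by (rule Qstar_Lipschitz)
    finally have "infnorm (Q - R) \<le> q + (infnorm (R - Qstar y) + L * ?d)"
      by (simp add: q)
    moreover have "\<gamma> * q \<le> q"
      using \<gamma> q0 by (simp add: mult_left_le_one_le)
    ultimately have QR: "infnorm (Q - R) \<le> 2 * q + 2 * L * ?d"
      using step gLd by (simp add: distrib_left)
    have "norm (adjoint_sol (iter x Q) - adjoint_sol (iter y R)) \<le> C * (?d + infnorm (Q - R))"
      using drift[of x Q y R] by (simp add: norm_minus_commute)
    also have "\<dots> \<le> C * (?d + (2 * q + 2 * L * ?d))"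
      using C QR by (intro mult_left_mono) auto
    also have "\<dots> \<le> D * (q + ?d)"
    proof -
      have "0 \<le> C * ?d" "0 \<le> C * L * q" "0 \<le> L * q" "0 \<le> L * ?d"
        using C L q0 by auto
      then show ?thesis
        by (simp add: D_def algebra_simps)
    qed
    finally have d: "norm (adjoint_sol (iter x Q) - adjoint_sol (iter y R)) \<le> D * (q + ?d)" .
    have "norm (w - adjoint_sol (iter y R)) \<le> norm (w - adjoint_sol (iter x Q)) + D * (q + ?d)"
      using norm_triangle_ineq[of "w - adjoint_sol (iter x Q)" "adjoint_sol (iter x Q) - adjoint_sol (iter y R)"] d by simp
    then have "\<sigma> * norm (w - adjoint_sol (iter y R)) \<le> \<sigma> * (norm (w - adjoint_sol (iter x Q)) + D * (q + ?d))"
      using \<sigma> by (intro mult_left_mono) auto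
    also have "\<dots> \<le> \<sigma> * norm (w - adjoint_sol (iter x Q)) + D * (q + ?d)"
      unfolding distrib_left[of \<sigma>] using \<sigma> order_trans[OF norm_ge_zero d]
      by (intro add_left_mono mult_left_le_one_le) auto
    finally show "norm (w - \<eta> *\<^sub>R (transpose A *v (A *v w) - transpose A *v adjoint_target (iter y R)) - adjoint_sol (iter y R))
        \<le> \<sigma> * norm (w - adjoint_sol (iter x Q)) + D * (q + ?d)"
      using adjoint_step_contraction[OF iter_policy_points, of w y R] unfolding A by (simp add: iter_def)
  qed
  show thesis
  proof (rule that[OF D0])
    fix x y Q w R A
    assume "R = soft_bellman P \<gamma> \<tau> r y Q" "A = adjoint_mat P \<gamma> (softmax ((1 / \<tau>) *\<^sub>R R))"
    from main[OF this refl] show "norm (w - \<eta> *\<^sub>R (transpose A *v (A *v w) - transpose A *v adjoint_target (iter y R)) - adjoint_sol (iter y R))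
        \<le> \<sigma> * norm (w - adjoint_sol (iter x Q)) + D * (infnorm (Q - Qstar x) + norm (y - x))" .
  next
    fix x y Q
    from bellman[OF refl refl refl] show "infnorm (soft_bellman P \<gamma> \<tau> r y Q - Qstar y)
        \<le> \<gamma> * infnorm (Q - Qstar x) + D * norm (y - x)" .
  qed
qed

text \<open>A single Bellman update per outer iteration is enough.  The first iterate is excluded because
  \<open>\<pi>\<^sub>1\<close> is unrelated to \<open>Q\<^sub>1\<close>.\<close>

lemma msobirl_gradients_summable:
  assumes bdd: "bdd_below (range (\<lambda>x. f (x, pol x)))"
  obtains \<beta> where "0 < \<beta>"
    and "\<And>x \<pi> Q w. msobirl_run P \<gamma> \<tau> r f \<beta> \<eta> 1 x \<pi> Q w \<Longrightarrow> \<exists>S. \<forall>n. (\<Sum>k=2..<n. (norm (grad (x k)))\<^sup>2) \<le> S"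
proof -
  obtain L where L: "0 \<le> L" "\<And>x y. norm (grad x - grad y) \<le> L * norm (x - y)"
    using grad_Lipschitz by blast
  obtain E where E: "0 \<le> E" and est: "\<And>x Q w. norm (est (iter x Q) w - grad x)
      \<le> E * (norm (w - adjoint_sol (iter x Q)) + infnorm (Q - Qstar x))"
    unfolding iter_def using est_error by blast
  obtain C where C: "0 \<le> C" and rec: "\<And>x y Q w R A. R = soft_bellman P \<gamma> \<tau> r y Q \<Longrightarrow> A = adjoint_mat P \<gamma> (softmax ((1 / \<tau>) *\<^sub>R R)) \<Longrightarrow>
      norm (w - \<eta> *\<^sub>R (transpose A *v (A *v w) - transpose A *v adjoint_target (iter y R)) - adjoint_sol (iter y R))
        \<le> \<sigma> * norm (w - adjoint_sol (iter x Q)) + C * (infnorm (Q - Qstar x) + norm (y - x))"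
    and bellman: "\<And>x y Q. infnorm (soft_bellman P \<gamma> \<tau> r y Q - Qstar y) \<le> \<gamma> * infnorm (Q - Qstar x) + C * norm (y - x)"
    by (fact error_recursion)
  obtain \<theta> M D where \<theta>: "0 \<le> \<theta>" "\<theta> < 1" and M: "1 \<le> M" and D: "0 \<le> D"
    and combine: "\<And>e q e' q' d. \<lbrakk>0 \<le> e; 0 \<le> q; 0 \<le> d; e' \<le> \<sigma> * e + C * (q + d); q' \<le> \<gamma> * q + C * d\<rbrakk>
      \<Longrightarrow> e' + M * q' \<le> \<theta> * (e + M * q) + D * d"
    by (fact coupled_contraction[OF less_imp_le[OF \<gamma>(1)] \<gamma>(2) \<sigma> C])
  \<comment> \<open>\<open>E\<close>, \<theta> and \<open>D\<close> are already fixed and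
    independent of \<beta>, since drift is still expressed by the step in \<open>x\<close>.\<close>
  obtain \<beta> where \<beta>: "0 < \<beta>"
    and descent: "\<And>x g \<Delta> m. \<lbrakk>\<And>k. k \<ge> m \<Longrightarrow> x (Suc k) = x k - \<beta> *\<^sub>R g k;
        \<And>k. k \<ge> m \<Longrightarrow> norm (grad (x k) - g k) \<le> E * \<Delta> k;
        \<And>k. k \<ge> m \<Longrightarrow> \<Delta> (Suc k) \<le> \<theta> * \<Delta> k + D * norm (x (Suc k) - x k);
        \<And>k. 0 \<le> \<Delta> k\<rbrakk>
      \<Longrightarrow> \<exists>S. \<forall>n. (\<Sum>k=m..<n. (norm (grad (x k)))\<^sup>2) \<le> S"
    by (fact inexact_gradient_descent[OF grad L(2) bdd L(1) \<theta> D, where C = E])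
  show thesis
  proof (rule that[OF \<beta>])
    fix x \<pi> Q w assume run: "msobirl_run P \<gamma> \<tau> r f \<beta> \<eta> 1 x \<pi> Q w"
    let ?z = "\<lambda>k. ((x k, \<pi> k), Q k)"
    have run_w: "w k = w (k - 1) - \<eta> *\<^sub>R (transpose A *v (A *v w (k - 1)) - transpose A *v adjoint_target (?z k))"
      and run_x: "x (Suc k) = x k - \<beta> *\<^sub>R est (?z k) (w k)"
      and run_Q: "Q (Suc k) = soft_bellman P \<gamma> \<tau> r (x (Suc k)) (Q k)"
      and run_\<pi>: "\<pi> (Suc k) = softmax ((1 / \<tau>) *\<^sub>R Q (Suc k))"
      if "1 \<le> k" "A = adjoint_mat P \<gamma> (\<pi> k)" for k A
      using run that unfolding msobirl_run_def Let_def
      by (auto simp: adjoint_target_def adjoint_rhs_def adjoint_mat_def est_def gradient_snd_eq[OF f])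
    have z: "?z k = iter (x k) (Q k)" if "2 \<le> k" for k
      using run_\<pi>[of "k - 1"] that by (simp add: iter_def)
    define e where "e k = norm (w k - adjoint_sol (iter (x k) (Q k)))" for k
    define q where "q k = infnorm (Q k - Qstar (x k))" for k
    have q0: "0 \<le> q k" and e0: "0 \<le> e k" for k
      by (simp_all add: q_def e_def infnorm_pos_le)
    show "\<exists>S. \<forall>n. (\<Sum>k=2..<n. (norm (grad (x k)))\<^sup>2) \<le> S"
    proof (rule descent[where g = "\<lambda>k. est (?z k) (w k)" and \<Delta> = "\<lambda>k. e k + M * q k"])
      fix k :: nat assume k: "2 \<le> k"
      show "x (Suc k) = x k - \<beta> *\<^sub>R est (?z k) (w k)"
        using run_x k by simp
      have "q k \<le> M * q k"
        using mult_right_mono[OF M q0] by simp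
      then have "E * (e k + q k) \<le> E * (e k + M * q k)"
        using E by (intro mult_left_mono) auto
      then show "norm (grad (x k) - est (?z k) (w k)) \<le> E * (e k + M * q k)"
        using est[of "x k" "Q k" "w k"] unfolding z[OF k] e_def q_def by (simp add: norm_minus_commute)
      have "q (Suc k) \<le> \<gamma> * q k + C * norm (x (Suc k) - x k)"
        using bellman[of "x (Suc k)" "Q k" "x k"] run_Q[of k, OF _ refl] k by (simp add: q_def)
      moreover have "e (Suc k) \<le> \<sigma> * e k + C * (q k + norm (x (Suc k) - x k))"
        using rec[OF run_Q[of k, OF _ refl] refl, where w = "w k" and x = "x k"]
          run_w[of "Suc k", OF _ refl] run_\<pi>[of k, OF _ refl] z[of "Suc k"] k
        unfolding e_def q_def by simp
      ultimately show "e (Suc k) + M * q (Suc k) \<le> \<theta> * (e k + M * q k) + D * norm (x (Suc k) - x k)"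
        using combine[OF e0 q0 norm_ge_zero] by blast
    next
      show "0 \<le> e k + M * q k" for k
        using e0[of k] q0[of k] M by simp
    qed
  qed
qed

end

theorem theorem7p4:
  fixes P :: "'s::finite \<Rightarrow> 'a::finite \<Rightarrow> 's pmf"
    and \<gamma> \<tau> :: real
    and \<rho> :: "'s pmf"
    and r :: "real ^ 'n \<Rightarrow> real ^ ('s \<times> 'a)"
    and f :: "(real ^ 'n) \<times> (real ^ ('s \<times> 'a)) \<Rightarrow> real"
    and L\<^sub>f C\<^sub>f\<^sub>\<pi> C\<^sub>r C\<^sub>r\<^sub>x L\<^sub>r :: real
  assumes "0 < \<gamma>" and "\<gamma> < 1" and "0 < \<tau>"
    and "\<And>s. 0 < pmf \<rho> s"
    and r_differentiable: "\<And>x. r differentiable (at x)"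
    and f_differentiable: "\<And>z. f differentiable (at z)"
    and f_C1: "continuous_on UNIV (gradient f)"
    and f_Lipschitz: "\<And>x\<^sub>1 x\<^sub>2 \<pi>\<^sub>1 \<pi>\<^sub>2. is_policy \<pi>\<^sub>1 \<Longrightarrow> is_policy \<pi>\<^sub>2 \<Longrightarrow>
        norm (gradient f (x\<^sub>1, \<pi>\<^sub>1) - gradient f (x\<^sub>2, \<pi>\<^sub>2)) \<le> L\<^sub>f * (norm (x\<^sub>1 - x\<^sub>2) + infnorm (\<pi>\<^sub>1 - \<pi>\<^sub>2))"
    and f_bound: "\<And>x. norm (gradient_snd f (x, opt_policy P \<gamma> \<tau> \<rho> r x)) \<le> C\<^sub>f\<^sub>\<pi>"
    and r_bound: "\<And>x s a. \<bar>r x $ (s, a)\<bar> \<le> C\<^sub>r"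
    and r_gradient_bound: "\<And>x s a. norm (gradient (\<lambda>y. r y $ (s, a)) x) \<le> C\<^sub>r\<^sub>x"
    and r_gradient_Lipschitz: "\<And>x\<^sub>1 x\<^sub>2 s a.
        norm (gradient (\<lambda>y. r y $ (s, a)) x\<^sub>1 - gradient (\<lambda>y. r y $ (s, a)) x\<^sub>2) \<le> L\<^sub>r * norm (x\<^sub>1 - x\<^sub>2)"
    and bounded_below: "bdd_below (range (hyper_objective P \<gamma> \<tau> \<rho> r f))"
  shows "(\<forall>x. hyper_objective P \<gamma> \<tau> \<rho> r f differentiable (at x)) \<and>
    (\<exists>\<beta> \<eta> N. 0 < \<beta> \<and> 0 < \<eta> \<and> 1 \<le> N \<and>
      (\<forall>x \<pi> Q w. msobirl_run P \<gamma> \<tau> r f \<beta> \<eta> N x \<pi> Q w \<longrightarrow>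
        (\<lambda>K. (1 / real K) * (\<Sum>k=1..K. (norm (gradient (hyper_objective P \<gamma> \<tau> \<rho> r f) (x k)))\<^sup>2))
          \<in> O(\<lambda>K. 1 / real K)))"
proof -
  note opt = opt_policy_eq_softmax[OF assms(1-4), where r = r]
  interpret soft_bilevel P \<gamma> \<tau> r f L\<^sub>f C\<^sub>f\<^sub>\<pi> C\<^sub>r\<^sub>x L\<^sub>r
  proof
    show "norm (snd (gradient f (x, softmax ((1 / \<tau>) *\<^sub>R soft_Q P \<gamma> \<tau> (r x))))) \<le> C\<^sub>f\<^sub>\<pi>" for x
      using f_bound[of x] by (simp add: opt gradient_snd_eq[OF f_differentiable])
    show "norm (reward_grad r x i) \<le> C\<^sub>r\<^sub>x" for x i
      using r_gradient_bound[where s = "fst i" and a = "snd i"] by (simp add: reward_grad_def)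
    show "norm (reward_grad r x i - reward_grad r y i) \<le> L\<^sub>r * norm (x - y)" for x y i
      using r_gradient_Lipschitz[where s = "fst i" and a = "snd i"] by (simp add: reward_grad_def)
  qed (use assms in auto)
  have obj: "hyper_objective P \<gamma> \<tau> \<rho> r f = (\<lambda>x. f (x, pol x))"
    by (simp add: fun_eq_iff hyper_objective_def opt pol_def Qstar_def)
  have gradient: "gradient (hyper_objective P \<gamma> \<tau> \<rho> r f) x = grad x" for x
    unfolding obj by (rule gradient_unique[OF grad])
  obtain \<beta> where \<beta>: "0 < \<beta>" and summable: "\<And>x \<pi> Q w. msobirl_run P \<gamma> \<tau> r f \<beta> \<eta> 1 x \<pi> Q w
      \<Longrightarrow> \<exists>S. \<forall>n. (\<Sum>k=2..<n. (norm (grad (x k)))\<^sup>2) \<le> S"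
    by (fact msobirl_gradients_summable[OF bounded_below[unfolded obj]])
  have "(\<lambda>K. (1 / real K) * (\<Sum>k=1..K. (norm (grad (x k)))\<^sup>2)) \<in> O(\<lambda>K. 1 / real K)"
    if run: "msobirl_run P \<gamma> \<tau> r f \<beta> \<eta> 1 x \<pi> Q w" for x \<pi> Q w
  proof -
    obtain S where S: "\<And>n. (\<Sum>k=2..<n. (norm (grad (x k)))\<^sup>2) \<le> S"
      using summable[OF run] by blast
    show ?thesis
    \<comment> \<open>The summed bound starts at 2; the gradient at the first iterate is a constant
      of the run and is added separately.\<close>
    proof (rule bigoI[of _ "(norm (grad (x 1)))\<^sup>2 + S"], rule eventually_sequentiallyI[of 1])
      fix K :: nat assume "1 \<le> K"
      have "(\<Sum>k=1..K. (norm (grad (x k)))\<^sup>2) = (norm (grad (x 1)))\<^sup>2 + (\<Sum>k=2..<Suc K. (norm (grad (x k)))\<^sup>2)"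
        using sum.atLeast_Suc_atMost[OF \<open>1 \<le> K\<close>] by (simp add: atLeastLessThanSuc_atLeastAtMost numeral_2_eq_2)
      also have "\<dots> \<le> (norm (grad (x 1)))\<^sup>2 + S"
        by (intro add_left_mono S)
      finally have "(\<Sum>k=1..K. (norm (grad (x k)))\<^sup>2) \<le> (norm (grad (x 1)))\<^sup>2 + S" .
      then show "norm ((1 / real K) * (\<Sum>k=1..K. (norm (grad (x k)))\<^sup>2)) \<le> ((norm (grad (x 1)))\<^sup>2 + S) * norm (1 / real K)"
        by (simp add: sum_nonneg divide_right_mono)
    qed
  qed
  moreover have "hyper_objective P \<gamma> \<tau> \<rho> r f differentiable (at x)" for x
    unfolding obj using grad by (auto simp: gderiv_def intro: differentiableI)
  ultimately show ?thesis
    unfolding gradient using \<beta> \<eta>(1) by (intro conjI allI exI[of _ \<beta>] exI[of _ \<eta>] exI[of _ 1]) auto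
qed

end
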